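(* Let $n\ge 1$. The order complex of any interval in the $B_n$ Tamari lattice $T_n^B$ is either contractible or homotopy equivalent to a single sphere.
   Context: Consider a convex, centrally symmetric $(2n+2)$-gon with vertices labelled clockwise $1,2,\dots,n+1,\bar 1,\bar 2,\dots,\overline{n+1}$, so that the half-turn exchanges $i$ and $\bar i$. A triangulation is a division of the polygon into triangles by chords (segments joining two non-adjacent vertices) which do not cross in the interior. $T_n^B$ is the set of triangulations fixed under the half-turn. For a chord $C$, $\bar C$ denotes its image under the half-turn. In a triangulation $S$, each chord $C$ of $S$ is a diagonal of a unique quadrilateral $Q(C)$, the union of the two triangles of $S$ having $C$ as a side. A chord is pure if it joins two barred or two unbarred vertices; otherwise it is mixed. A pure chord $C$ of $S$ is red if $Q(C)$ contains another vertex of the same type (barred/unbarred) as the endpoints of $C$ whose label is higher than those of both endpoints of $C$, and green otherwise. A mixed chord $C$ is red if $Q(C)$ contains an unbarred vertex whose label is higher than that of the unbarred endpoint of $C$, or a barred vertex whose label is higher than that of the barred endpoint of $C$; otherwise it is green. The $B_n$ Tamari lattice is the partial order on $T_n^B$ (which is a lattice) whose covering relations are: $S\lessdot T$ iff $T$ is obtained from $S$ by replacing a green chord $C$ of $S$ and its partner $\bar C$ (possibly $C=\bar C$) by the other diagonals of $Q(C)$ and $Q(\bar C)$. The order complex of an interval $[Y,Z]$, $Y<Z$, means the simplicial complex of finite chains of the open interval $(Y,Z)=\{X: Y<X<Z\}$; the empty complex is regarded as the sphere of dimension $-1$. *)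

theory Defs
  imports "HOL-Analysis.Analysis"
begin

datatype vertex =
    is_unbarred: Unbarred (label: nat)
  | is_barred: Barred (label: nat)

definition same_type :: "vertex \<Rightarrow> vertex \<Rightarrow> bool" where
  "same_type u v \<longleftrightarrow> (is_barred u \<longleftrightarrow> is_barred v)"

definition vertices :: "nat \<Rightarrow> vertex set" where
  "vertices n = Unbarred ` {1..n+1} \<union> Barred ` {1..n+1}"

text \<open>
  The vertices of a convex polygon are represented by their positions \<open>1, \<dots>, 2n+2\<close> in the
  clockwise order in which they are met along the boundary, starting at the vertex \<open>1\<close>.
\<close>

fun pos :: "nat \<Rightarrow> vertex \<Rightarrow> nat" where
  "pos n (Unbarred i) = i"
| "pos n (Barred i) = n + 1 + i"

fun half_turn :: "vertex \<Rightarrow> vertex" where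
  "half_turn (Unbarred i) = Barred i"
| "half_turn (Barred i) = Unbarred i"

definition adjacent :: "nat \<Rightarrow> vertex \<Rightarrow> vertex \<Rightarrow> bool" where
  "adjacent n u v \<longleftrightarrow>
     pos n v mod (2 * n + 2) = Suc (pos n u) mod (2 * n + 2) \<or>
     pos n u mod (2 * n + 2) = Suc (pos n v) mod (2 * n + 2)"

text \<open>A segment joining two vertices is represented by the set of its two endpoints.\<close>

definition sides :: "nat \<Rightarrow> vertex set set" where
  "sides n = {{u, v} | u v. u \<in> vertices n \<and> v \<in> vertices n \<and> adjacent n u v}"

definition chords :: "nat \<Rightarrow> vertex set set" where
  "chords n = {{u, v} | u v. u \<in> vertices n \<and> v \<in> vertices n \<and> u \<noteq> v \<and> \<not> adjacent n u v}"

text \<open>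
  Two chords of a convex polygon meet in an interior point of both iff their endpoints alternate
  along the boundary.
\<close>

definition crosses :: "nat \<Rightarrow> vertex set \<Rightarrow> vertex set \<Rightarrow> bool" where
  "crosses n C D \<longleftrightarrow> (\<exists>a b c d. C = {a, b} \<and> D = {c, d} \<and>
     (pos n a < pos n c \<and> pos n c < pos n b \<and> pos n b < pos n d \<or>
      pos n c < pos n a \<and> pos n a < pos n d \<and> pos n d < pos n b))"

text \<open>
  The triangles, given by their three corners, all of whose sides are sides of the polygon or
  chords in \<open>S\<close>. When the chords in \<open>S\<close> do not cross, each of them is a region of the division
  of the polygon by \<open>S\<close>: no chord can enter a triangle without crossing one of its sides.
\<close>

definition triangles :: "nat \<Rightarrow> vertex set set \<Rightarrow> vertex set set" where
  "triangles n S = {t. t \<subseteq> vertices n \<and> card t = 3 \<and>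
     (\<forall>u\<in>t. \<forall>v\<in>t. u \<noteq> v \<longrightarrow> {u, v} \<in> S \<union> sides n)}"

text \<open>
  Non-crossing chords divide the polygon into triangles when every region is a triangle. A chord
  borders two regions and a side of the polygon borders one, so this says that a triangle lies on
  each of the two sides of every chord, and one triangle on the inner side of every polygon side.
\<close>

definition triangulation :: "nat \<Rightarrow> vertex set set \<Rightarrow> bool" where
  "triangulation n S \<longleftrightarrow> S \<subseteq> chords n \<and>
     (\<forall>C\<in>S. \<forall>D\<in>S. \<not> crosses n C D) \<and>
     (\<forall>C\<in>S. card {t \<in> triangles n S. C \<subseteq> t} = 2) \<and>
     (\<forall>e\<in>sides n. card {t \<in> triangles n S. e \<subseteq> t} = 1)"

definition typeB_triangulations :: "nat \<Rightarrow> vertex set set set" where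
  "typeB_triangulations n = {S. triangulation n S \<and> image half_turn ` S = S}"

text \<open>
  \<open>Q(C)\<close> is given by its four corners, so that its diagonal other than \<open>C\<close> is \<open>Q(C) - C\<close>.
\<close>

definition quad :: "nat \<Rightarrow> vertex set set \<Rightarrow> vertex set \<Rightarrow> vertex set" where
  "quad n S C = \<Union>{t \<in> triangles n S. C \<subseteq> t}"

definition other_diagonal :: "nat \<Rightarrow> vertex set set \<Rightarrow> vertex set \<Rightarrow> vertex set" where
  "other_diagonal n S C = quad n S C - C"

definition pure :: "vertex set \<Rightarrow> bool" where
  "pure C \<longleftrightarrow> (\<forall>u\<in>C. \<forall>v\<in>C. same_type u v)"

definition red :: "nat \<Rightarrow> vertex set set \<Rightarrow> vertex set \<Rightarrow> bool" where
  "red n S C \<longleftrightarrow>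
     (if pure C
      then \<exists>v\<in>quad n S C. \<forall>u\<in>C. same_type u v \<and> label u < label v
      else \<exists>v\<in>quad n S C. \<exists>u\<in>C. same_type u v \<and> label u < label v)"

definition green :: "nat \<Rightarrow> vertex set set \<Rightarrow> vertex set \<Rightarrow> bool" where
  "green n S C \<longleftrightarrow> \<not> red n S C"

definition tamari_cover :: "nat \<Rightarrow> vertex set set \<Rightarrow> vertex set set \<Rightarrow> bool" where
  "tamari_cover n S T \<longleftrightarrow> S \<in> typeB_triangulations n \<and> T \<in> typeB_triangulations n \<and>
     (\<exists>C\<in>S. green n S C \<and>
        T = (S - {C, half_turn ` C}) \<union>
            {other_diagonal n S C, other_diagonal n S (half_turn ` C)})"

text \<open>
  A partial order on a finite set is the reflexive transitive closure of its covering relation.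
\<close>

definition tamari_le :: "nat \<Rightarrow> vertex set set \<Rightarrow> vertex set set \<Rightarrow> bool" where
  "tamari_le n S T \<longleftrightarrow> S \<in> typeB_triangulations n \<and> T \<in> typeB_triangulations n \<and>
     (tamari_cover n)\<^sup>*\<^sup>* S T"

definition tamari_less :: "nat \<Rightarrow> vertex set set \<Rightarrow> vertex set set \<Rightarrow> bool" where
  "tamari_less n S T \<longleftrightarrow> tamari_le n S T \<and> S \<noteq> T"

definition tamari_open_interval ::
  "nat \<Rightarrow> vertex set set \<Rightarrow> vertex set set \<Rightarrow> vertex set set set" where
  "tamari_open_interval n Y Z = {X. tamari_less n Y X \<and> tamari_less n X Z}"

definition order_complex :: "'a set \<Rightarrow> ('a \<Rightarrow> 'a \<Rightarrow> bool) \<Rightarrow> 'a set set" where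
  "order_complex P r = {c. c \<subseteq> P \<and> finite c \<and> totalp_on c r}"

definition interval_complex :: "nat \<Rightarrow> vertex set set \<Rightarrow> vertex set set \<Rightarrow> vertex set set set set" where
  "interval_complex n Y Z = order_complex (tamari_open_interval n Y Z) (tamari_less n)"

text \<open>
  The realization of an abstract simplicial complex by barycentric coordinates. The product
  topology is the correct one for complexes with finitely many vertices only. The empty face
  contributes no point.
\<close>

definition geometric_realization :: "'a set set \<Rightarrow> ('a \<Rightarrow> real) topology" where
  "geometric_realization K = subtopology (powertop_real UNIV)
     {x. (\<forall>v. 0 \<le> x v) \<and> {v. x v \<noteq> 0} \<in> K \<and> (\<Sum>v | x v \<noteq> 0. x v) = 1}"

text \<open>The sphere of dimension \<open>d\<close>, for \<open>d \<ge> -1\<close>; the one of dimension \<open>-1\<close> is empty.\<close>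

definition sphere_space :: "int \<Rightarrow> (nat \<Rightarrow> real) topology" where
  "sphere_space d = (if d = -1 then trivial_topology else nsphere (nat d))"

end

(*
  Call a chord C below a chord D if they cross and flipping C to D in the quadrilateral spanned
  by their endpoints is an upward (green) flip. Then S \<le> T in the Tamari order iff no chord of T
  is below a chord of S. This relies on two facts about an upward flip of C to D in S: every chord
  below C is below a side of the quadrilateral Q(C); and if some chord of S is below a chord w,
  then there is an upward flip C \<rightarrow> D of S such that every chord below D is below a chord of S,
  below w, or below the half-turn of w. By the second fact a maximal lower bound of a set of
  triangulations is its greatest lower bound, and each set of atoms of an interval [Y, Z] has a
  join, which lies above no other atom. Hence X \<mapsto> join of the atoms below X retracts (Y, Z),
  decreasingly, onto the joins of nonempty sets of atoms. If the join of all atoms is not Z, this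
  retract has a top element and (Y, Z) is contractible; otherwise it is the proper part of a Boolean
  lattice, whose realization is the unit sphere of the norm max - min on R^m / R(1, ..., 1).
*)
theory Submission
  imports Defs
begin

section \<open>Chords of a polygon by position\<close>

text \<open>Comparison by chords is not visibly transitive, and meets are never computed. The two
  facts repair this. By the first, flip sequences respect the comparison. By the second, if S \<le>
  X and S differs from X, some upward flip of S stays under X. So comparison is reachability by
  flips, hence a partial order. In the second fact a chord of S below w may be barred. The half-turn
  moves it, and w with it, to the unbarred half, where the argument is carried out; this is why the
  half-turn of w occurs. A join of a set B of atoms lies above no further atom for this reason: let
  c be a chord of Y flipped by such an atom. All flips in B keep c, and a maximal triangulation
  containing all chords kept by B lies above B, yet still contains c. Monotone maps f \<le> g are
  homotopic, but not along straight segments: for u < v, nothing compares f v with g u. So mass is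
  moved from the bottom of a chain upwards. With p + 2 atoms the sphere has dimension p: vectors on
  the atoms are taken modulo constants, then normalized.\<close>

definition polyg :: "nat \<Rightarrow> (nat \<Rightarrow> nat \<Rightarrow> bool) \<Rightarrow> bool" where
  "polyg N e \<longleftrightarrow>
     (\<forall>x y. e x y \<longrightarrow> e y x \<and> x \<noteq> y \<and> 1 \<le> x \<and> x \<le> N) \<and>
     (\<forall>x. 1 \<le> x \<and> x < N \<longrightarrow> e x (Suc x)) \<and> e 1 N \<and>
     (\<forall>a b c d. e a b \<and> e c d \<longrightarrow> \<not> (a < c \<and> c < b \<and> b < d))"

definition maximal_edges :: "nat \<Rightarrow> (nat \<Rightarrow> nat \<Rightarrow> bool) \<Rightarrow> bool" where
  "maximal_edges N e \<longleftrightarrow> (\<forall>a b. 1 \<le> a \<and> a < b \<and> b \<le> N \<and>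
     (\<forall>c d. e c d \<longrightarrow> \<not> (a < c \<and> c < b \<and> b < d) \<and> \<not> (c < a \<and> a < d \<and> d < b)) \<longrightarrow> e a b)"

text \<open>Counting triangles on edges yields \<open>has_apexes\<close>, whereas
  \<open>maximal_edges\<close> is the form that passes easily through a flip. The exceptions are the
  polygon sides: consecutive positions leave no room inside, the side from 1 to \<open>N\<close>
  none outside.\<close>

definition has_apexes :: "nat \<Rightarrow> (nat \<Rightarrow> nat \<Rightarrow> bool) \<Rightarrow> bool" where
  "has_apexes N e \<longleftrightarrow> (\<forall>a b. e a b \<and> a < b \<longrightarrow>
     (Suc a < b \<longrightarrow> (\<exists>x. a < x \<and> x < b \<and> e a x \<and> e x b)) \<and>
     (\<not> (a = 1 \<and> b = N) \<longrightarrow> (\<exists>x. (x < a \<or> b < x) \<and> e a x \<and> e x b)))"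

lemma polyg_sym: "polyg N e \<Longrightarrow> e x y \<Longrightarrow> e y x"
  unfolding polyg_def by blast

lemma polyg_range: "polyg N e \<Longrightarrow> e x y \<Longrightarrow> 1 \<le> x \<and> x \<le> N \<and> 1 \<le> y \<and> y \<le> N \<and> x \<noteq> y"
  unfolding polyg_def by metis

lemma polyg_nc: "polyg N e \<Longrightarrow> e a b \<Longrightarrow> e c d \<Longrightarrow> a < c \<Longrightarrow> c < b \<Longrightarrow> b < d \<Longrightarrow> False"
  unfolding polyg_def by meson

lemma polyg_side: "polyg N e \<Longrightarrow> 1 \<le> x \<Longrightarrow> x < N \<Longrightarrow> e x (Suc x)"
  unfolding polyg_def by meson

lemma polyg_long_side: "polyg N e \<Longrightarrow> e 1 N"
  unfolding polyg_def by meson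

lemma polyg_side_back: "polyg N e \<Longrightarrow> 1 < x \<Longrightarrow> x \<le> N \<Longrightarrow> e x (x - 1)"
  using polyg_side[of N e "x - 1"] polyg_sym[of N e "x-1" x] by auto

lemma maximal_edges_D:
  assumes "maximal_edges N e" "1 \<le> a" "a < b" "b \<le> N"
    "\<And>c d. e c d \<Longrightarrow> a < c \<Longrightarrow> c < b \<Longrightarrow> b < d \<Longrightarrow> False"
    "\<And>c d. e c d \<Longrightarrow> c < a \<Longrightarrow> a < d \<Longrightarrow> d < b \<Longrightarrow> False"
  shows "e a b"
  using assms unfolding maximal_edges_def by blast

lemma Max_nat_witness:
  fixes P :: "nat \<Rightarrow> bool"
  assumes "P x" "\<And>y. P y \<Longrightarrow> y \<le> N"
  shows "\<exists>y. P y \<and> (\<forall>z. P z \<longrightarrow> z \<le> y)"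
  using GreatestI_ex_nat[of P N] Greatest_le_nat[of P _ N] assms by blast

text \<open>Let \<open>w\<close> be the last neighbour of \<open>a\<close> before \<open>b\<close>.
  The third corner of the outer triangle on \<open>(a, w)\<close> must be \<open>b\<close>: any
  other position gives an edge across \<open>(a, b)\<close> or a later neighbour.\<close>

lemma apexes_imp_maximal:
  assumes p: "polyg N e" and t: "has_apexes N e"
  shows "maximal_edges N e"
  unfolding maximal_edges_def
proof (intro allI impI, elim conjE)
  fix a b assume ab: "1 \<le> a" "a < b" "b \<le> N"
    and nc: "\<forall>c d. e c d \<longrightarrow> \<not> (a < c \<and> c < b \<and> b < d) \<and> \<not> (c < a \<and> a < d \<and> d < b)"
  show "e a b"
  proof (cases "Suc a = b")
    case True then show ?thesis using polyg_side[OF p, of a] ab by auto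
  next
    case False
    have "e a (Suc a)" using polyg_side[OF p, of a] ab by auto
    then obtain w where w: "a < w" "w < b" "e a w" "\<And>z. a < z \<Longrightarrow> z < b \<Longrightarrow> e a z \<Longrightarrow> z \<le> w"
      using Max_nat_witness[of "\<lambda>z. a < z \<and> z < b \<and> e a z" "Suc a" b] ab False by force
    then obtain x where x: "x < a \<or> w < x" "e a x" "e x w"
      using t ab unfolding has_apexes_def by (metis leD)
    have "x = b"
    proof (rule ccontr)
      assume "x \<noteq> b"
      then consider "x < a" | "w < x" "x < b" | "b < x" using x by linarith
      then show False
      proof cases
        case 1 then show ?thesis using nc x(3) w by blast
      next
        case 2 then show ?thesis using w(4)[of x] w(1) x by simp
      next
        case 3 then show ?thesis using nc polyg_sym[OF p x(3)] x(3) w by blast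
      qed
    qed
    then show ?thesis using x by blast
  qed
qed

text \<open>A suitable extreme neighbour \<open>w\<close> of \<open>a\<close> is the apex: an edge
  across the missing third side would cross a known edge or end at a neighbour of \<open>a\<close>
  that the choice of \<open>w\<close> excludes.\<close>

lemma maximal_imp_apexes:
  assumes p: "polyg N e" and t: "maximal_edges N e"
  shows "has_apexes N e"
  unfolding has_apexes_def
proof (intro allI impI, elim conjE, intro conjI impI)
  fix a b assume ab: "e a b" "a < b"
  have rg: "1 \<le> a" "b \<le> N" using polyg_range[OF p ab(1)] by auto
  note nc = polyg_nc[OF p] and sym = polyg_sym[OF p] and ran = polyg_range[OF p]
  {
    assume "Suc a < b"
    have "e a (Suc a)" using polyg_side[OF p, of a] ab rg by auto
    then obtain w where w: "a < w" "w < b" "e a w" "\<And>z. a < z \<Longrightarrow> z < b \<Longrightarrow> e a z \<Longrightarrow> z \<le> w"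
      using Max_nat_witness[of "\<lambda>z. a < z \<and> z < b \<and> e a z" "Suc a" b] \<open>Suc a < b\<close> by force
    have "e w b"
    proof (rule maximal_edges_D[OF t])
      show "False" if h: "e c d" "w < c" "c < b" "b < d" for c d
        using nc[of a b c d] ab h w by linarith
      show "False" if h: "e c d" "c < w" "w < d" "d < b" for c d
      proof -
        consider "c < a" | "c = a" | "a < c" by linarith
        then show False
        proof cases
          case 1 then show ?thesis using nc[of c d a b] ab h w by linarith
        next
          case 2 then have "d \<le> w" using w(1) w(4)[of d] h by auto
          then show ?thesis using h by simp
        next
          case 3 then show ?thesis using nc[of a w c d] h w by linarith
        qed
      qed
    qed (use w rg in auto)
    then show "\<exists>x>a. x < b \<and> e a x \<and> e x b" using w by blast
  }
  assume not_top: "\<not> (a = 1 \<and> b = N)"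
  show "\<exists>x. (x < a \<or> b < x) \<and> e a x \<and> e x b"
  \<comment> \<open>The next neighbour of \<open>a\<close> going round from \<open>b\<close> has a
    larger position or, if there is none up to \<open>N\<close>, the smallest one.\<close>
  proof (cases "\<exists>w>b. e a w")
    case True
    define w where "w = (LEAST w. b < w \<and> e a w)"
    have w: "b < w" "e a w" using LeastI_ex[of "\<lambda>w. b < w \<and> e a w"] True unfolding w_def by auto
    have wl: "\<And>z. b < z \<Longrightarrow> e a z \<Longrightarrow> w \<le> z" unfolding w_def by (auto intro: Least_le)
    have "e b w"
    proof (rule maximal_edges_D[OF t])
      show "False" if h: "e c d" "b < c" "c < w" "w < d" for c d
        using nc[of a w c d] ab h w by linarith
      show "False" if h: "e c d" "c < b" "b < d" "d < w" for c d
      proof -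
        consider "c < a" | "c = a" | "a < c" by linarith
        then show False
        proof cases
          case 1 then show ?thesis using nc[of c d a w] ab h w by linarith
        next
          case 2 then have "w \<le> d" using wl[of d] h by auto
          then show ?thesis using h by simp
        next
          case 3 then show ?thesis using nc[of a b c d] ab h w by linarith
        qed
      qed
    qed (use w rg ab ran[OF w(2)] in auto)
    then show ?thesis using w sym by blast
  next
    case False
    have "1 < a"
    proof (rule ccontr)
      assume "\<not> 1 < a" then have "a = 1" using rg by simp
      then have "e a N" "b < N" using polyg_long_side[OF p] not_top rg by auto
      then show False using False by blast
    qed
    then have ex: "\<exists>w<a. e a w" using polyg_side_back[OF p, of a] ab rg by (intro exI[of _ "a - 1"]) auto
    define w where "w = (LEAST w. w < a \<and> e a w)"
    have w: "w < a" "e a w" using LeastI_ex[of "\<lambda>w. w < a \<and> e a w"] ex unfolding w_def by auto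
    have wl: "\<And>z. z < a \<Longrightarrow> e a z \<Longrightarrow> w \<le> z" unfolding w_def by (auto intro: Least_le)
    have "e w b"
    proof (rule maximal_edges_D[OF t])
      show "False" if h: "e c d" "w < c" "c < b" "b < d" for c d
      proof -
        consider "c < a" | "c = a" | "a < c" by linarith
        then show False
        proof cases
          case 1 then show ?thesis using nc[of w a c d] ab h w sym by (meson less_trans)
        next
          case 2 then show ?thesis using False h by force
        next
          case 3 then show ?thesis using nc[of a b c d] ab h w by linarith
        qed
      qed
      show "False" if h: "e c d" "c < w" "w < d" "d < b" for c d
      proof -
        consider "d < a" | "d = a" | "a < d" by linarith
        then show False
        proof cases
          case 1 then show ?thesis using nc[of c d w a] ab h w sym by (meson less_trans)
        next
          case 2 then have "w \<le> c" using wl[of c] w(1) sym[OF h(1)] h by auto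
          then show ?thesis using h by simp
        next
          case 3 then show ?thesis using nc[of c d a b] ab h w by linarith
        qed
      qed
    qed (use w rg ab ran[OF w(2)] in auto)
    then show ?thesis using w by blast
  qed
qed

lemma apex_inside_unique:
  assumes p: "polyg N e" and "a < x" "x < b" "e a x" "e x b" "a < y" "y < b" "e a y" "e y b"
  shows "x = y"
  using polyg_nc[OF p, of a y x b] polyg_nc[OF p, of a x y b] assms by (metis linorder_neqE_nat)

lemma apex_outside_unique:
  assumes p: "polyg N e" and "a < b" "x < a \<or> b < x" "e a x" "e x b" "y < a \<or> b < y" "e a y" "e y b"
  shows "x = y"
proof (rule ccontr)
  assume ne: "x \<noteq> y"
  note nc = polyg_nc[OF p] and sym = polyg_sym[OF p]
  have *: "False" if h: "x < y" "x < a \<or> b < x" "e a x" "e x b" "y < a \<or> b < y" "e a y" "e y b" for x y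
  proof -
    consider "y < a" | "x < a" "b < y" | "b < x" using h assms(2) by fastforce
    then show False
    proof cases
      case 1 then show ?thesis using nc[of x a y b] h assms(2) sym[OF h(3)] sym[OF h(4)] sym[OF h(6)] sym[OF h(7)] by simp
    next
      case 2 then show ?thesis using nc[of x b a y] h assms(2) sym[OF h(3)] sym[OF h(4)] sym[OF h(6)] sym[OF h(7)] by simp
    next
      case 3 then show ?thesis using nc[of a x b y] h assms(2) sym[OF h(3)] sym[OF h(4)] sym[OF h(6)] sym[OF h(7)] by simp
    qed
  qed
  show False using *[of x y] *[of y x] assms ne by (metis linorder_neqE_nat)
qed

section \<open>Exchanging the diagonals of a quadrilateral\<close>

definition flip_edges :: "(nat \<Rightarrow> nat \<Rightarrow> bool) \<Rightarrow> nat \<Rightarrow> nat \<Rightarrow> nat \<Rightarrow> nat \<Rightarrow> nat \<Rightarrow> nat \<Rightarrow> bool" where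
  "flip_edges e a b k l x y \<longleftrightarrow> e x y \<and> {x, y} \<noteq> {a, b} \<or> {x, y} = {k, l}"

definition quad_at :: "(nat \<Rightarrow> nat \<Rightarrow> bool) \<Rightarrow> nat \<Rightarrow> nat \<Rightarrow> nat \<Rightarrow> nat \<Rightarrow> bool" where
  "quad_at e a b k l \<longleftrightarrow> e a b \<and> a < k \<and> k < b \<and> (l < a \<or> b < l) \<and> e a k \<and> e k b \<and> e a l \<and> e l b"

text \<open>Everything rests on \<open>crossing\<close>: an old edge separating \<open>k\<close>
  from \<open>l\<close> is the diagonal \<open>(a, b)\<close>, since any other would cross one of
  the four sides of the quadrilateral.\<close>

lemma flip_edges_polyg:
  assumes p: "polyg N e" and q: "quad_at e a b k l"
  shows "polyg N (flip_edges e a b k l)"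
proof -
  note nc = polyg_nc[OF p] and sym = polyg_sym[OF p] and ran = polyg_range[OF p]
  have q': "e a b" "a < k" "k < b" "l < a \<or> b < l" "e a k" "e k b" "e a l" "e l b"
    using q by (auto simp: quad_at_def)
  have crossing: "{c, d} = {a, b}" if h: "e c d" "c < x" "x < d" "y < c \<or> d < y" "{x, y} = {k, l}" for c d x y
  proof -
    have *: "\<And>u v. e u v \<Longrightarrow> \<not> (u < c \<and> c < v \<and> v < d) \<and> \<not> (c < u \<and> u < d \<and> d < v)"
      using nc h by blast
    consider "x = k" "y = l" | "x = l" "y = k" using h(5) by (auto simp: doubleton_eq_iff)
    then have "c = a \<and> d = b"
    proof cases
      case 1
      have "c \<le> a" using nc[of a k c d] q' h(1-3) 1 by (metis not_le)
      moreover have "b \<le> d" using nc[of c d k b] q' h(1-3) 1 by (metis not_le)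
      moreover have "\<not> c < a" using nc[of l a c d] nc[of c d a l] q' h(1-4) 1 sym \<open>b \<le> d\<close> by (metis less_le_trans less_trans)
      moreover have "\<not> b < d" using nc[of l b c d] nc[of c d b l] q' h(1-4) 1 sym \<open>c \<le> a\<close>
        by (metis le_less_trans less_trans)
      ultimately show ?thesis by auto
    next
      case 2
      consider "k < c" | "d < k" using h(4) 2 by auto
      then show ?thesis
      proof cases
        case 1
        then have "b < l" using q' h 2 by auto
        then show ?thesis using nc[of a l c d] q' h 1 2 by auto
      next
        case l: 2
        then have "l < a" using q' h 2 by auto
        then show ?thesis using nc[of c d l b] q' h l 2 by auto
      qed
    qed
    then show ?thesis by blast
  qed
  have kl: "k \<noteq> l" "1 \<le> k" "k \<le> N" "1 \<le> l" "l \<le> N" using q' ran[OF q'(5)] ran[OF q'(7)] by auto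
  have A: "\<forall>x y. flip_edges e a b k l x y \<longrightarrow> flip_edges e a b k l y x \<and> x \<noteq> y \<and> 1 \<le> x \<and> x \<le> N"
    unfolding flip_edges_def using sym ran kl by (auto simp: insert_commute doubleton_eq_iff)
  have B: "\<forall>x. 1 \<le> x \<and> x < N \<longrightarrow> flip_edges e a b k l x (Suc x)"
    using polyg_side[OF p] q' unfolding flip_edges_def by (auto simp: doubleton_eq_iff)
  have "{1, N} \<noteq> {a, b}" using q' ran[OF q'(7)] by (auto simp: doubleton_eq_iff)
  then have C: "flip_edges e a b k l 1 N"
    using polyg_long_side[OF p] unfolding flip_edges_def by blast
  have D: "False" if h: "flip_edges e a b k l c d" "flip_edges e a b k l u v" "c < u" "u < d" "d < v" for c d u v
  proof -
    consider "e c d" "e u v" | "e c d" "{c, d} \<noteq> {a, b}" "{u, v} = {k, l}"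
      | "e u v" "{u, v} \<noteq> {a, b}" "{c, d} = {k, l}" | "{c, d} = {k, l}" "{u, v} = {k, l}"
      using h unfolding flip_edges_def by blast
    then show False
    proof cases
      case 1 then show ?thesis using nc h by blast
    next
      case 2 then show ?thesis using crossing[of c d u v] h by auto
    next
      case 3 then show ?thesis using crossing[of u v d c] h by (auto simp: insert_commute)
    next
      case 4 then show ?thesis using h by (auto simp: doubleton_eq_iff)
    qed
  qed
  show ?thesis unfolding polyg_def using A B C D by blast
qed

text \<open>A segment crossing no new edge either avoids \<open>(a, b)\<close>, and the old
  maximality applies, or it crosses \<open>(a, b)\<close> but no side of the quadrilateral, and then
  it joins \<open>k\<close> and \<open>l\<close>.\<close>

lemma flip_edges_maximal:
  assumes p: "polyg N e" and t: "maximal_edges N e" and q: "quad_at e a b k l"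
  shows "maximal_edges N (flip_edges e a b k l)"
  unfolding maximal_edges_def
proof (intro allI impI, elim conjE)
  fix u v assume uv: "1 \<le> u" "u < v" "v \<le> N" and
    nc: "\<forall>c d. flip_edges e a b k l c d \<longrightarrow> \<not> (u < c \<and> c < v \<and> v < d) \<and> \<not> (c < u \<and> u < d \<and> d < v)"
  note sym = polyg_sym[OF p]
  have q': "e a b" "a < k" "k < b" "l < a \<or> b < l" "e a k" "e k b" "e a l" "e l b"
    using q by (auto simp: quad_at_def)
  have s: "flip_edges e a b k l a k" "flip_edges e a b k l k b" "flip_edges e a b k l a l"
    "flip_edges e a b k l l b" "flip_edges e a b k l k l"
    "flip_edges e a b k l k a" "flip_edges e a b k l b k" "flip_edges e a b k l l a"
    "flip_edges e a b k l b l" "flip_edges e a b k l l k"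
    using q' sym unfolding flip_edges_def by (auto simp: doubleton_eq_iff)
  have ne: "{u, v} \<noteq> {a, b}"
    using nc s(5,10) q' uv by (auto simp: doubleton_eq_iff)
  show "flip_edges e a b k l u v"
  proof (cases "u < a \<and> a < v \<and> v < b \<or> a < u \<and> u < b \<and> b < v")
    case False
    have fe: "flip_edges e a b k l c d" if "e c d" "{c, d} \<noteq> {a, b}" for c d
      using that unfolding flip_edges_def by blast
    have "e u v"
    proof (rule maximal_edges_D[OF t uv])
      fix c d assume h: "e c d" "u < c" "c < v" "v < d"
      then have "{c, d} \<noteq> {a, b}" using False q'(2,3) by (auto simp: doubleton_eq_iff)
      then show False using nc fe[OF h(1)] h by blast
    next
      fix c d assume h: "e c d" "c < u" "u < d" "d < v"
      then have "{c, d} \<noteq> {a, b}" using False q'(2,3) by (auto simp: doubleton_eq_iff)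
      then show False using nc fe[OF h(1)] h by blast
    qed
    then show ?thesis using ne unfolding flip_edges_def by blast
  next
    case True
    have nc': "\<not> (u < c \<and> c < v \<and> v < d)" "\<not> (c < u \<and> u < d \<and> d < v)"
      if "flip_edges e a b k l c d" for c d using nc that by auto
    have "u = k \<and> v = l \<or> u = l \<and> v = k"
      using True
    proof (elim disjE conjE)
      assume h: "u < a" "a < v" "v < b"
      have "v = k" using nc'(1)[OF s(1)] nc'(1)[OF s(2)] h q'(2,3) by (metis linorder_neqE_nat less_trans)
      moreover have "l < a" using nc'(1)[OF s(3)] h q'(4) by (metis less_trans)
      then have "u = l" using nc'(2)[OF s(8)] nc'(1)[OF s(4)] h by (metis linorder_neqE_nat less_trans)
      ultimately show ?thesis by simp
    next
      assume h: "a < u" "u < b" "b < v"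
      have "u = k" using nc'(2)[OF s(1)] nc'(2)[OF s(2)] h q'(2,3) by (metis linorder_neqE_nat less_trans)
      moreover have "b < l" using nc'(2)[OF s(4)] h q'(4) by (metis less_trans)
      then have "v = l" using nc'(1)[OF s(9)] nc'(2)[OF s(3)] h by (metis linorder_neqE_nat less_trans)
      ultimately show ?thesis by simp
    qed
    then show ?thesis unfolding flip_edges_def by auto
  qed
qed

section \<open>Upward flips\<close>

text \<open>
  Positions up to \<open>m\<close> are unbarred, larger ones barred. The chord \<open>(a, b)\<close> crosses \<open>(c, d)\<close>, and
  flipping \<open>(a, b)\<close> to \<open>(c, d)\<close> in the quadrilateral spanned by both is a flip at a green chord.
\<close>

definition below_chord :: "nat \<Rightarrow> nat \<Rightarrow> nat \<Rightarrow> nat \<Rightarrow> nat \<Rightarrow> bool" where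
  "below_chord m a b c d \<longleftrightarrow> a < b \<and> c < d \<and>
     (c < a \<and> a < d \<and> d < b \<and> (a \<le> m \<and> m < b \<longrightarrow> m < d) \<or>
      a < c \<and> c < b \<and> b < d \<and> b \<le> m \<and> m < d)"

definition antipode :: "nat \<Rightarrow> nat \<Rightarrow> nat" where
  "antipode m p = (if p \<le> m then p + m else p - m)"

lemma below_chord_crossing:
  assumes "a < b" "c < d"
  shows "(a < c \<and> c < b \<and> b < d) \<or> (c < a \<and> a < d \<and> d < b) \<longleftrightarrow> below_chord m a b c d \<or> below_chord m c d a b"
  using assms unfolding below_chord_def by auto

lemma below_chord_asym: "below_chord m a b c d \<Longrightarrow> \<not> below_chord m c d a b"
  unfolding below_chord_def by auto

text \<open>The first fact on upward flips. A chord below \<open>(a, b)\<close> leaves its span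
  either past \<open>b\<close>, and is then below the side joining \<open>l\<close> and
  \<open>b\<close>, or before \<open>a\<close>; in that case its right end is unbarred and
  \<open>k\<close> is barred, so it is below \<open>(a, k)\<close>.\<close>

lemma below_diagonal_imp_below_side:
  assumes k: "a < k" "k < b" and l: "l < a \<or> b < l"
    and up: "below_chord m a b (min k l) (max k l)" and d: "below_chord m u v a b"
  shows "below_chord m u v a k \<or> below_chord m u v l b \<or> below_chord m u v b l"
proof (cases "l < a")
  case True
  then have "a \<le> m \<and> m < b \<longrightarrow> m < k" using up k unfolding below_chord_def by simp
  then show ?thesis using d k True unfolding below_chord_def by auto
next
  case False
  then have "b < l" "b \<le> m" "m < l" using up k l unfolding below_chord_def by simp_all
  then have "below_chord m u v b l" using d k unfolding below_chord_def by auto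
  then show ?thesis by blast
qed

text \<open>
  The last condition keeps the flipped triangulation under all those that contain no chord below
  an edge of \<open>e\<close> and no chord satisfying \<open>G\<close>.
\<close>

definition up_flip :: "nat \<Rightarrow> (nat \<Rightarrow> nat \<Rightarrow> bool) \<Rightarrow> (nat \<Rightarrow> nat \<Rightarrow> bool) \<Rightarrow> nat \<Rightarrow> nat \<Rightarrow> nat \<Rightarrow> nat \<Rightarrow> bool" where
  "up_flip m e G a b k l \<longleftrightarrow> quad_at e a b k l \<and> below_chord m a b (min k l) (max k l) \<and>
    (\<forall>u v. below_chord m u v (min k l) (max k l) \<longrightarrow> (\<exists>x y. e x y \<and> below_chord m u v x y) \<or> G u v)"

text \<open>
  The chord to be flipped is chosen innermost as seen from \<open>b\<close> in its left endpoint, then outermost in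
  its right endpoint: the first makes the new chord attainable from the given data, the second makes
  the flip go up.
\<close>

lemma up_flip_pure:
  assumes p: "polyg (2 * m) e" and t: "has_apexes (2 * m) e"
    and h: "e c d" "a < c" "c < b" "b < d" "d \<le> m"
    and G: "\<And>u v. a < u \<Longrightarrow> u < b \<Longrightarrow> b < v \<Longrightarrow> v \<le> m \<Longrightarrow> G u v"
  shows "\<exists>x y k l. up_flip m e G x y k l"
proof -
  note nc = polyg_nc[OF p] and sym = polyg_sym[OF p] and ran = polyg_range[OF p]
  define P where "P c \<longleftrightarrow> a < c \<and> c < b \<and> (\<exists>d. e c d \<and> b < d \<and> d \<le> m)" for c
  have "P c" using h unfolding P_def by blast
  moreover have "z \<le> b" if "P z" for z using that unfolding P_def by simp
  ultimately obtain c1 where c1: "P c1" "\<And>z. P z \<Longrightarrow> z \<le> c1"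
    using Max_nat_witness[of P c b] by blast
  define Q where "Q d \<longleftrightarrow> e c1 d \<and> b < d \<and> d \<le> m" for d
  obtain d0 where "Q d0" using c1 unfolding P_def Q_def by blast
  moreover have "z \<le> m" if "Q z" for z using that unfolding Q_def by simp
  ultimately obtain d1 where d1: "Q d1" "\<And>z. Q z \<Longrightarrow> z \<le> d1"
    using Max_nat_witness[of Q d0 m] by blast
  have o: "a < c1" "c1 < b" "b < d1" "d1 \<le> m" "e c1 d1" using c1 d1 unfolding P_def Q_def by auto
  have lt: "c1 < d1" "Suc c1 < d1" "\<not> (c1 = 1 \<and> d1 = 2 * m)" using o by linarith+
  obtain k where k: "c1 < k" "k < d1" "e c1 k" "e k d1"
    using t o(5) lt unfolding has_apexes_def by meson
  obtain l where l: "l < c1 \<or> d1 < l" "e c1 l" "e l d1"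
    using t o(5) lt unfolding has_apexes_def by meson
  \<comment> \<open>An apex \<open>k\<close> before \<open>b\<close> would be a better left endpoint
    than \<open>c1\<close>; likewise an apex \<open>l\<close> between \<open>d1\<close> and
    \<open>m\<close> would be a better right endpoint than \<open>d1\<close>.\<close>
  have "\<not> k < b" using c1(2)[of k] k o unfolding P_def by force
  then have kb: "b \<le> k" by simp
  have lb: "l < c1 \<or> m < l" using l d1(2)[of l] o unfolding Q_def by force
  have "quad_at e c1 d1 k l" using o k l unfolding quad_at_def by blast
  moreover have "below_chord m c1 d1 (min k l) (max k l)"
    using k o lb unfolding below_chord_def by (auto simp: min_def max_def)
  moreover have "(\<exists>x y. e x y \<and> below_chord m u v x y) \<or> G u v"
    if uv: "below_chord m u v (min k l) (max k l)" for u v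
  proof -
    \<comment> \<open>If \<open>u\<close> lies before \<open>b\<close>, the chord spans
      \<open>b\<close> and falls under \<open>G\<close>; otherwise it starts after \<open>c1\<close>
      and is below \<open>(c1, k)\<close>.\<close>
    have inside: "below_chord m u v c1 k \<or> (a < u \<and> u < b \<and> b < v \<and> v \<le> m)"
      if "c1 \<le> u" "u < k" "k < v" "v \<le> m"
      using that o kb unfolding below_chord_def by (cases "u < b") auto
    consider "l < c1" "l < u" "u < k" "k < v" "v \<le> m" | "m < l" "k < u" "u < l" "l < v"
      | "m < l" "u < k" "k < v" "v \<le> m"
      using uv lb k o unfolding below_chord_def by (auto simp: min_def max_def split: if_splits)
    then have "below_chord m u v l c1 \<or> below_chord m u v l d1 \<or> below_chord m u v c1 k \<or>
      below_chord m u v c1 l \<or> (a < u \<and> u < b \<and> b < v \<and> v \<le> m)"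
    proof cases
      case 1
      then have "below_chord m u v l c1" if "u < c1" using that k o unfolding below_chord_def by auto
      then show ?thesis using inside 1 by (meson leI)
    next
      case 2
      then have "below_chord m u v c1 l" using k o unfolding below_chord_def by auto
      then show ?thesis by blast
    next
      case 3
      then have "below_chord m u v c1 l" if "u < c1" using that k o unfolding below_chord_def by auto
      then show ?thesis using inside 3 by (meson leI)
    qed
    then show ?thesis using G k l o sym by blast
  qed
  ultimately show ?thesis unfolding up_flip_def by blast
qed

text \<open>Here the right endpoint is made extreme before the left one. The absence of unbarred
  edges across \<open>a\<close> and of barred edges across \<open>b\<close> gives
  \<open>a \<le> k\<close> and \<open>b \<le> l\<close>. This forces every chord below the new one
  either below an old edge or into the region of \<open>G\<close>.\<close>

lemma up_flip_mixed:
  assumes p: "polyg (2 * m) e" and t: "has_apexes (2 * m) e"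
    and h: "e c d" "1 \<le> a" "a < c" "c \<le> m" "m < b" "b < d"
    and G: "\<And>u v. a < u \<Longrightarrow> u < b \<Longrightarrow> b < v \<Longrightarrow> G u v"
    and no_pure: "\<And>u v. e u v \<Longrightarrow> u < a \<Longrightarrow> a < v \<Longrightarrow> v \<le> m \<Longrightarrow> False"
      "\<And>u v. e u v \<Longrightarrow> m < u \<Longrightarrow> u < b \<Longrightarrow> b < v \<Longrightarrow> False"
  shows "\<exists>x y k l. up_flip m e G x y k l"
proof -
  note nc = polyg_nc[OF p] and sym = polyg_sym[OF p] and ran = polyg_range[OF p]
  define P where "P d \<longleftrightarrow> b < d \<and> (\<exists>c. e c d \<and> a < c \<and> c \<le> m)" for d
  have "P d" using h unfolding P_def by blast
  moreover have "\<And>z. P z \<Longrightarrow> z \<le> 2 * m" unfolding P_def using ran by blast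
  ultimately obtain d1 where d1: "P d1" "\<And>z. P z \<Longrightarrow> z \<le> d1"
    using Max_nat_witness[of P d "2 * m"] by blast
  define Q where "Q c \<longleftrightarrow> e c d1 \<and> a < c \<and> c \<le> m" for c
  obtain c0 where "Q c0" using d1 unfolding P_def Q_def by blast
  moreover have "z \<le> m" if "Q z" for z using that unfolding Q_def by simp
  ultimately obtain c1 where c1: "Q c1" "\<And>z. Q z \<Longrightarrow> z \<le> c1"
    using Max_nat_witness[of Q c0 m] by blast
  have o: "b < d1" "a < c1" "c1 \<le> m" "e c1 d1" using c1 d1 unfolding P_def Q_def by auto
  have lt: "c1 < d1" "Suc c1 < d1" "\<not> (c1 = 1 \<and> d1 = 2 * m)" using o h by linarith+
  obtain l where l: "c1 < l" "l < d1" "e c1 l" "e l d1"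
    using t o(4) lt unfolding has_apexes_def by meson
  obtain k where k: "k < c1 \<or> d1 < k" "e c1 k" "e k d1"
    using t o(4) lt unfolding has_apexes_def by meson
  have kb: "a \<le> k" "k < c1" 
  proof -
    have "\<not> d1 < k" using d1(2)[of k] k o h sym[OF k(2)] unfolding P_def by force
    then show "k < c1" using k by blast
    show "a \<le> k" using no_pure(1)[of k c1] sym[OF k(2)] \<open>k < c1\<close> o by (meson leI)
  qed
  \<comment> \<open>An unbarred apex would be a better left endpoint than \<open>c1\<close>. That
    \<open>l\<close> is barred is what makes the flip of this mixed chord go up.\<close>
  have lb: "m < l" using c1(2)[of l] l o unfolding Q_def by force
  have bl: "l \<ge> b" using no_pure(2)[of l d1] l o lb by (meson leI)
  have "quad_at e c1 d1 l k" using o k l kb unfolding quad_at_def by blast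
  moreover have "below_chord m c1 d1 (min l k) (max l k)"
    using k o lb l kb h unfolding below_chord_def by (auto simp: min_def max_def)
  moreover have "(\<exists>x y. e x y \<and> below_chord m u v x y) \<or> G u v"
    if uv: "below_chord m u v (min l k) (max l k)" for u v
  proof -
    have "below_chord m u v k d1 \<or> below_chord m u v c1 l \<or> (a < u \<and> u < b \<and> b < v)"
    proof (cases "k < u \<and> u < l \<and> l < v")
      case True
      consider "d1 < v" | "c1 < u" | "v \<le> d1" "u \<le> c1" by linarith
      then show ?thesis
      proof cases
        case 1
        then have "below_chord m u v k d1" using True kb o l lb h unfolding below_chord_def by auto
        then show ?thesis by blast
      next
        case 2
        then have "below_chord m u v c1 l" using True kb o l lb h unfolding below_chord_def by auto
        then show ?thesis by blast
      next
        case 3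
        then show ?thesis using True kb o bl h by linarith
      qed
    next
      case False
      then have "u < k" "k < v" "v \<le> m" "u < v" using uv kb l unfolding below_chord_def by auto
      then have "below_chord m u v k d1" using kb o l lb h unfolding below_chord_def by auto
      then show ?thesis by blast
    qed
    then show ?thesis using G k l o sym by blast
  qed
  ultimately show ?thesis unfolding up_flip_def by blast
qed

text \<open>The second fact on upward flips. Unbarred chords go to \<open>up_flip_pure\<close>,
  barred ones too after a half-turn. A mixed chord goes to \<open>up_flip_mixed\<close>, unless a
  pure edge across \<open>a\<close> or \<open>b\<close> leads back to the former cases.\<close>

lemma up_flip_exists:
  assumes p: "polyg (2 * m) e" and t: "has_apexes (2 * m) e"
    and e_half: "\<And>x y. e x y \<Longrightarrow> e (antipode m x) (antipode m y)"
    and ab: "1 \<le> a" "b \<le> 2 * m" and cd: "e c d" "below_chord m c d a b"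
    and G: "\<And>u v. below_chord m u v a b \<Longrightarrow> G u v"
     "\<And>u v a' b'. below_chord m u v a' b' \<Longrightarrow> {a', b'} = {antipode m a, antipode m b} \<Longrightarrow> G u v"
  shows "\<exists>x y k l. up_flip m e G x y k l"
proof -
  note ran = polyg_range[OF p]
  have ab': "a < b" "c < d" using cd(2) unfolding below_chord_def by auto
  have unbarred: ?thesis if h: "e c d" "c < a" "a < d" "d \<le> m" "m < b" for c d
  proof -
    have "e d c" "1 \<le> c" using ran[OF h(1)] polyg_sym[OF p h(1)] by auto
    \<comment> \<open>The left bound 0 imposes no restriction; the role of \<open>b\<close> is
      played by \<open>a\<close>.\<close>
    then show ?thesis using up_flip_pure[OF p t h(1) _ h(2-4), of 0 G] G(1) h(5) unfolding below_chord_def by auto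
  qed
  have barred: ?thesis if h: "e c d" "a < c" "c < b" "b < d" "m < c" for c d
  proof -
    have e': "e (c - m) (d - m)" and d: "d \<le> 2 * m"
      using e_half[OF h(1)] ran[OF h(1)] h unfolding antipode_def by auto
    have b': "c - m < b - m" "b - m < d - m" "d - m \<le> m" using h d by auto
    have anti: "antipode m b = b - m" using h unfolding antipode_def by auto
    show ?thesis
    \<comment> \<open>If \<open>a\<close> is unbarred, the half-turn exchanges the order of the ends
      and \<open>(a, b)\<close> becomes \<open>(b - m, a + m)\<close>; otherwise both ends move down
      by \<open>m\<close>.\<close>
    proof (cases "a \<le> m")
      case True
      then have "G u v" if "0 < u" "u < b - m" "b - m < v" "v \<le> m" for u v
        using that G(2)[of u v "b - m" "a + m"] anti ab unfolding below_chord_def antipode_def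
        by (auto simp: insert_commute)
      moreover have "0 < c - m" using h by simp
      ultimately show ?thesis using up_flip_pure[OF p t e' _ b', of 0 G] by blast
    next
      case False
      then have "G u v" if "a - m < u" "u < b - m" "b - m < v" "v \<le> m" for u v
        using that G(2)[of u v "a - m" "b - m"] anti ab unfolding below_chord_def antipode_def by auto
      moreover have "a - m < c - m" using h False by simp
      ultimately show ?thesis using up_flip_pure[OF p t e' _ b', of "a - m" G] by blast
    qed
  qed
  consider "a < c" "c < b" "b < d" "d \<le> m" | "c < a" "a < d" "d \<le> m" "m < b"
    | "a < c" "c \<le> m" "m < b" "b < d" | "a < c" "c < b" "b < d" "m < c"
    using cd(2) unfolding below_chord_def by linarith
  then show ?thesis
  proof cases
    case 1
    then show ?thesis using up_flip_pure[OF p t cd(1) 1] G(1) unfolding below_chord_def by auto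
  next
    case 2
    then show ?thesis using unbarred cd(1) by blast
  next
    case 3
    show ?thesis
    proof (cases "(\<exists>u v. e u v \<and> u < a \<and> a < v \<and> v \<le> m) \<or> (\<exists>u v. e u v \<and> m < u \<and> u < b \<and> b < v)")
      case True
      have "a < u" if "m < u" for u using that 3 by simp
      then show ?thesis using True unbarred barred 3(3) by blast
    next
      case False
      have "G u v" if "a < u" "u < b" "b < v" for u v
        using that 3 G(1) unfolding below_chord_def by auto
      then show ?thesis using up_flip_mixed[OF p t cd(1) ab(1) 3] False by blast
    qed
  next
    case 4
    then show ?thesis using barred cd(1) by blast
  qed
qed

section \<open>Triangulations as edge relations\<close>

definition vx :: "nat \<Rightarrow> nat \<Rightarrow> vertex" where
  "vx n p = (if p \<le> n + 1 then Unbarred p else Barred (p - (n + 1)))"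

lemma pos_vx: "pos n (vx n p) = p"
  unfolding vx_def by auto

lemma vx_mem: "1 \<le> p \<Longrightarrow> p \<le> 2 * (n + 1) \<Longrightarrow> vx n p \<in> vertices n"
  unfolding vx_def vertices_def by (auto simp: image_iff)

lemma vx_pos: "u \<in> vertices n \<Longrightarrow> vx n (pos n u) = u"
  unfolding vx_def vertices_def by auto

lemma pos_range: "u \<in> vertices n \<Longrightarrow> 1 \<le> pos n u \<and> pos n u \<le> 2 * (n + 1)"
  unfolding vertices_def by auto

lemma vx_eq_iff: "vx n p = vx n q \<longleftrightarrow> p = q"
  using pos_vx by metis

lemma half_turn_half_turn [simp]: "half_turn (half_turn u) = u"
  by (cases u) auto

lemma half_turn_vx: "1 \<le> p \<Longrightarrow> p \<le> 2 * (n + 1) \<Longrightarrow> half_turn (vx n p) = vx n (antipode (n + 1) p)"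
  unfolding vx_def antipode_def by auto

lemma antipode_range: "1 \<le> p \<Longrightarrow> p \<le> 2 * m \<Longrightarrow> 1 \<le> antipode m p \<and> antipode m p \<le> 2 * m"
  unfolding antipode_def by auto

lemma antipode_antipode: "1 \<le> p \<Longrightarrow> p \<le> 2 * m \<Longrightarrow> antipode m (antipode m p) = p"
  unfolding antipode_def by auto

lemma finite_vertices: "finite (vertices n)"
  unfolding vertices_def by auto

lemma adjacent_vx:
  assumes "1 \<le> a" "a < b" "b \<le> 2 * (n + 1)"
  shows "adjacent n (vx n a) (vx n b) \<longleftrightarrow> b = Suc a \<or> (a = 1 \<and> b = 2 * (n + 1))"
proof -
  have "b mod (2 * n + 2) = (if b = 2 * n + 2 then 0 else b)" "a mod (2 * n + 2) = a"
    "Suc a mod (2 * n + 2) = (if a = 2 * n + 1 then 0 else Suc a)"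
    "Suc b mod (2 * n + 2) = (if b = 2 * n + 2 then 1 else if b = 2 * n + 1 then 0 else Suc b)"
    using assms by (auto simp: mod_Suc)
  then show ?thesis using assms unfolding adjacent_def pos_vx by auto
qed

lemma adjacent_sym: "adjacent n u v \<longleftrightarrow> adjacent n v u"
  unfolding adjacent_def by blast

lemma sides_vx:
  assumes "1 \<le> a" "a < b" "b \<le> 2 * (n + 1)"
  shows "{vx n a, vx n b} \<in> sides n \<longleftrightarrow> b = Suc a \<or> (a = 1 \<and> b = 2 * (n + 1))"
proof -
  have "{vx n a, vx n b} \<in> sides n \<longleftrightarrow> adjacent n (vx n a) (vx n b)"
    using vx_mem[of a n] vx_mem[of b n] assms adjacent_sym[of n]
    unfolding sides_def by (auto simp: doubleton_eq_iff)
  then show ?thesis using adjacent_vx[OF assms] by simp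
qed

lemma chords_vx:
  assumes "1 \<le> a" "a < b" "b \<le> 2 * (n + 1)"
  shows "{vx n a, vx n b} \<in> chords n \<longleftrightarrow> b \<noteq> Suc a \<and> \<not> (a = 1 \<and> b = 2 * (n + 1))"
proof -
  have "vx n a \<noteq> vx n b" using assms vx_eq_iff by simp
  then have "{vx n a, vx n b} \<in> chords n \<longleftrightarrow> \<not> adjacent n (vx n a) (vx n b)"
    using vx_mem[of a n] vx_mem[of b n] assms adjacent_sym[of n]
    unfolding chords_def by (auto simp: doubleton_eq_iff)
  then show ?thesis using adjacent_vx[OF assms] by simp
qed

lemma pair_vx:
  assumes "u \<in> vertices n" "v \<in> vertices n" "u \<noteq> v"
  shows "\<exists>a b. {u, v} = {vx n a, vx n b} \<and> 1 \<le> a \<and> a < b \<and> b \<le> 2 * (n + 1)"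
proof -
  have "pos n u \<noteq> pos n v" using assms vx_pos by metis
  then consider "pos n u < pos n v" | "pos n v < pos n u" by linarith
  then show ?thesis
  proof cases
    case 1
    then show ?thesis using assms(1,2)
      by (intro exI[of _ "pos n u"] exI[of _ "pos n v"]) (simp add: vx_pos pos_range[simplified])
  next
    case 2
    then show ?thesis using assms(1,2)
      by (intro exI[of _ "pos n v"] exI[of _ "pos n u"]) (simp add: vx_pos pos_range[simplified] insert_commute)
  qed
qed

lemma chord_vx: "C \<in> chords n \<Longrightarrow> \<exists>a b. C = {vx n a, vx n b} \<and> 1 \<le> a \<and> a < b \<and> b \<le> 2 * (n + 1)"
  unfolding chords_def using pair_vx by blast

lemma sides_chords_disjoint: "C \<in> sides n \<Longrightarrow> C \<in> chords n \<Longrightarrow> False"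
  using chord_vx[of C n] chords_vx sides_vx by metis

lemma side_vx:
  assumes "C \<in> sides n" "n \<ge> 1"
  shows "\<exists>a b. C = {vx n a, vx n b} \<and> 1 \<le> a \<and> a < b \<and> b \<le> 2 * (n + 1)"
proof -
  obtain u v where uv: "C = {u, v}" "u \<in> vertices n" "v \<in> vertices n" "adjacent n u v"
    using assms(1) unfolding sides_def by blast
  have "\<not> adjacent n u u" using assms(2) unfolding adjacent_def by (simp add: mod_Suc)
  then show ?thesis using pair_vx uv by metis
qed

text \<open>Polygon sides are included, so that triangles are just triples of pairwise related
  positions.\<close>

definition edges :: "nat \<Rightarrow> vertex set set \<Rightarrow> nat \<Rightarrow> nat \<Rightarrow> bool" where
  "edges n S x y \<longleftrightarrow> 1 \<le> x \<and> x \<le> 2 * (n + 1) \<and> 1 \<le> y \<and> y \<le> 2 * (n + 1) \<and> x \<noteq> y \<and>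
     {vx n x, vx n y} \<in> S \<union> sides n"

lemma edges_sym: "edges n S x y \<longleftrightarrow> edges n S y x"
  unfolding edges_def by (auto simp: insert_commute)

text \<open>A polygon side has all other positions on one side of it, so an edge with positions on
  both sides comes from \<open>S\<close>.\<close>

lemma edges_chord:
  assumes "edges n S a b" "a < c" "c < b" "d < a \<or> b < d" "1 \<le> d" "d \<le> 2 * (n + 1)"
  shows "{vx n a, vx n b} \<in> S"
  using assms sides_vx[of a b n] unfolding edges_def by auto

lemma crossesI:
  assumes "a < c" "c < b" "b < d"
  shows "crosses n {vx n a, vx n b} {vx n c, vx n d}"
  unfolding crosses_def using assms pos_vx by metis

lemma noncrossing_iff_polyg:
  assumes "S \<subseteq> chords n" "n \<ge> 1"
  shows "(\<forall>C\<in>S. \<forall>D\<in>S. \<not> crosses n C D) \<longleftrightarrow> polyg (2 * (n + 1)) (edges n S)"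
proof
  assume nc: "\<forall>C\<in>S. \<forall>D\<in>S. \<not> crosses n C D"
  have "False" if h: "edges n S a b" "edges n S c d" "a < c" "c < b" "b < d" for a b c d
  proof -
    have "{vx n a, vx n b} \<in> S" using edges_chord[OF h(1,3,4), of d] h(5) h(2) unfolding edges_def by auto
    moreover have "{vx n c, vx n d} \<in> S"
      using edges_chord[OF h(2,4,5), of a] h(3) h(1) unfolding edges_def by auto
    ultimately show False using nc crossesI[OF h(3-5)] by blast
  qed
  moreover have "edges n S x (Suc x)" if "1 \<le> x" "x < 2 * (n + 1)" for x
    using that sides_vx[of x "Suc x" n] unfolding edges_def by auto
  moreover have "edges n S 1 (2 * (n + 1))"
    using sides_vx[of 1 "2 * (n + 1)" n] unfolding edges_def by auto
  moreover have "edges n S y x \<and> x \<noteq> y \<and> 1 \<le> x \<and> x \<le> 2 * (n + 1)" if "edges n S x y" for x y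
    using that unfolding edges_def by (auto simp: insert_commute)
  ultimately show "polyg (2 * (n + 1)) (edges n S)" unfolding polyg_def by blast
next
  assume p: "polyg (2 * (n + 1)) (edges n S)"
  have ed: "edges n S (pos n u) (pos n v)" if "{u, v} \<in> S" for u v
  proof -
    have "u \<in> vertices n" "v \<in> vertices n" "u \<noteq> v"
      using that assms(1) unfolding chords_def by (auto simp: doubleton_eq_iff)
    then show ?thesis using that pos_range vx_pos[of u n] vx_pos[of v n] unfolding edges_def by (metis UnI1)
  qed
  show "\<forall>C\<in>S. \<forall>D\<in>S. \<not> crosses n C D"
  proof (intro ballI notI)
    fix C D assume "C \<in> S" "D \<in> S" "crosses n C D"
    then obtain a b c d where "{a, b} \<in> S" "{c, d} \<in> S"
      "pos n a < pos n c \<and> pos n c < pos n b \<and> pos n b < pos n d \<or>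
       pos n c < pos n a \<and> pos n a < pos n d \<and> pos n d < pos n b"
      unfolding crosses_def by metis
    then show False using polyg_nc[OF p] ed by meson
  qed
qed

section \<open>Triangles on an edge and their third corners\<close>

definition apexes :: "nat \<Rightarrow> vertex set set \<Rightarrow> nat \<Rightarrow> nat \<Rightarrow> nat set" where
  "apexes n S a b = {x. edges n S a x \<and> edges n S x b}"

lemma triangles_on_edge:
  assumes "edges n S a b"
  shows "{t \<in> triangles n S. {vx n a, vx n b} \<subseteq> t} = (\<lambda>x. {vx n a, vx n b, vx n x}) ` apexes n S a b"
proof (intro equalityI subsetI)
  fix t assume t: "t \<in> {t \<in> triangles n S. {vx n a, vx n b} \<subseteq> t}"
  have ab: "a \<noteq> b" using assms unfolding edges_def by blast
  have t': "t \<subseteq> vertices n" "card t = 3" "vx n a \<in> t" "vx n b \<in> t"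
    and tE: "\<And>u v. u \<in> t \<Longrightarrow> v \<in> t \<Longrightarrow> u \<noteq> v \<Longrightarrow> {u, v} \<in> S \<union> sides n"
    using t unfolding triangles_def by auto
  have "finite t" using t'(2) card.infinite by fastforce
  then have "card (t - {vx n a, vx n b}) = 1"
    using t' ab vx_eq_iff[of n a b] by (simp add: card_Diff_subset)
  then obtain w where w: "t - {vx n a, vx n b} = {w}" by (auto simp: card_1_singleton_iff)
  then have w': "w \<in> t" "w \<noteq> vx n a" "w \<noteq> vx n b" "t = {vx n a, vx n b, w}" using t' by auto
  define x where "x = pos n w"
  have wx: "w = vx n x" "1 \<le> x" "x \<le> 2 * (n + 1)"
    using w' t' vx_pos[of w n] pos_range[of w n] unfolding x_def by auto
  have "edges n S a x" "edges n S x b"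
    using assms tE[of "vx n a" w] tE[of w "vx n b"] w' t' wx unfolding edges_def by auto
  then show "t \<in> (\<lambda>x. {vx n a, vx n b, vx n x}) ` apexes n S a b"
    unfolding apexes_def using w'(4) wx(1) by blast
next
  fix t assume "t \<in> (\<lambda>x. {vx n a, vx n b, vx n x}) ` apexes n S a b"
  then obtain x where x: "edges n S a x" "edges n S x b" "t = {vx n a, vx n b, vx n x}"
    unfolding apexes_def by blast
  then have "card t = 3" using assms unfolding edges_def by (simp add: vx_eq_iff card_insert_if)
  moreover have "t \<subseteq> vertices n" using x assms vx_mem unfolding edges_def by simp
  moreover have "{u, v} \<in> S \<union> sides n" if "u \<in> t" "v \<in> t" "u \<noteq> v" for u v
  proof -
    have "{vx n a, vx n b} \<in> S \<union> sides n" "{vx n a, vx n x} \<in> S \<union> sides n" "{vx n x, vx n b} \<in> S \<union> sides n"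
      using x assms unfolding edges_def by blast+
    then show ?thesis using that x(3) by (auto simp: insert_commute)
  qed
  ultimately show "t \<in> {t \<in> triangles n S. {vx n a, vx n b} \<subseteq> t}"
    unfolding triangles_def using x(3) by blast
qed

lemma card_triangles_on_edge:
  assumes "edges n S a b"
  shows "card {t \<in> triangles n S. {vx n a, vx n b} \<subseteq> t} = card (apexes n S a b)"
proof -
  have "inj_on (\<lambda>x. {vx n a, vx n b, vx n x}) (apexes n S a b)"
  proof (rule inj_onI)
    fix x y assume x: "x \<in> apexes n S a b" and eq: "{vx n a, vx n b, vx n x} = {vx n a, vx n b, vx n y}"
    have "vx n x \<in> {vx n a, vx n b, vx n y}" using eq by blast
    moreover have "x \<noteq> a" "x \<noteq> b" using x unfolding apexes_def edges_def by auto
    ultimately show "x = y" by (simp add: vx_eq_iff)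
  qed
  then show ?thesis unfolding triangles_on_edge[OF assms] by (rule card_image)
qed

definition inner_apexes where
  "inner_apexes n S a b = {x \<in> apexes n S a b. a < x \<and> x < b}"

definition outer_apexes where
  "outer_apexes n S a b = {x \<in> apexes n S a b. x < a \<or> b < x}"

text \<open>Two apexes on the same side of an edge would produce crossing edges, so each side
  contributes at most one triangle.\<close>

lemma card_apexes:
  assumes p: "polyg (2 * (n + 1)) (edges n S)" and "a < b"
  shows "card (apexes n S a b) = (if inner_apexes n S a b = {} then 0 else 1) + (if outer_apexes n S a b = {} then 0 else 1)"
proof -
  have at_most_1: "finite X \<and> card X = (if X = {} then 0 else 1)" if h: "\<And>x y. x \<in> X \<Longrightarrow> y \<in> X \<Longrightarrow> x = y" for X :: "nat set"
  proof (cases "X = {}")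
    case False
    then obtain x where "x \<in> X" by blast
    then have "X = {x}" using h by blast
    then show ?thesis by simp
  qed auto
  have i: "x = y" if "x \<in> inner_apexes n S a b" "y \<in> inner_apexes n S a b" for x y
    using apex_inside_unique[OF p, of a x b y] that unfolding inner_apexes_def apexes_def by blast
  have o: "x = y" if "x \<in> outer_apexes n S a b" "y \<in> outer_apexes n S a b" for x y
    using apex_outside_unique[OF p assms(2)] that unfolding outer_apexes_def apexes_def by blast
  have "x \<noteq> a \<and> x \<noteq> b" if "x \<in> apexes n S a b" for x using that unfolding apexes_def edges_def by blast
  then have "apexes n S a b = inner_apexes n S a b \<union> outer_apexes n S a b"
    unfolding inner_apexes_def outer_apexes_def by (auto simp: neq_iff)
  moreover have "inner_apexes n S a b \<inter> outer_apexes n S a b = {}"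
    unfolding inner_apexes_def outer_apexes_def by auto
  ultimately show ?thesis using at_most_1[OF i] at_most_1[OF o] by (simp add: card_Un_disjoint)
qed

text \<open>Counts turn into existence: a chord with two triangles has an apex on each side. A
  polygon side can have an apex on one side only, so its single triangle lies there.\<close>

lemma triangulation_iff:
  assumes "n \<ge> 1"
  shows "triangulation n S \<longleftrightarrow> S \<subseteq> chords n \<and> polyg (2 * (n + 1)) (edges n S) \<and> has_apexes (2 * (n + 1)) (edges n S)"
proof (cases "S \<subseteq> chords n \<and> polyg (2 * (n + 1)) (edges n S)")
  case False
  then show ?thesis unfolding triangulation_def using noncrossing_iff_polyg assms by blast
next
  case True
  then have S: "S \<subseteq> chords n" and p: "polyg (2 * (n + 1)) (edges n S)" by auto
  have range: "1 \<le> a \<and> b \<le> 2 * (n + 1)" if "edges n S a b" for a b using that unfolding edges_def by blast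
  have inner: "inner_apexes n S a b \<noteq> {} \<longleftrightarrow> (\<exists>x. a < x \<and> x < b \<and> edges n S a x \<and> edges n S x b)" for a b
    unfolding inner_apexes_def apexes_def by blast
  have outer: "outer_apexes n S a b \<noteq> {} \<longleftrightarrow> (\<exists>x. (x < a \<or> b < x) \<and> edges n S a x \<and> edges n S x b)" for a b
    unfolding outer_apexes_def apexes_def by blast
  have inner0: "inner_apexes n S a b = {}" if "b = Suc a" for a b
    unfolding inner_apexes_def using that by auto
  have outer0: "outer_apexes n S 1 (2 * (n + 1)) = {}"
    unfolding outer_apexes_def apexes_def edges_def by auto
  have in_ex: "inner_apexes n S a b \<noteq> {}"
    if "has_apexes (2 * (n + 1)) (edges n S)" "edges n S a b" "a < b" "b \<noteq> Suc a" for a b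
  proof -
    have "Suc a < b" using that(3,4) by simp
    then show ?thesis using that(1-3) unfolding inner has_apexes_def by blast
  qed
  have out_ex: "outer_apexes n S a b \<noteq> {}"
    if "has_apexes (2 * (n + 1)) (edges n S)" "edges n S a b" "a < b" "\<not> (a = 1 \<and> b = 2 * (n + 1))" for a b
    using that unfolding outer has_apexes_def by blast
  have 1: "(\<forall>C\<in>S. card {t \<in> triangles n S. C \<subseteq> t} = 2) \<and> (\<forall>e\<in>sides n. card {t \<in> triangles n S. e \<subseteq> t} = 1)"
    if h: "has_apexes (2 * (n + 1)) (edges n S)"
  proof (intro conjI ballI)
    fix C assume C: "C \<in> S"
    then obtain a b where ab: "C = {vx n a, vx n b}" "1 \<le> a" "a < b" "b \<le> 2 * (n + 1)"
      using S chord_vx by blast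
    have e: "edges n S a b" using ab C unfolding edges_def by auto
    have "b \<noteq> Suc a" "\<not> (a = 1 \<and> b = 2 * (n + 1))"
      using chords_vx[OF ab(2-4)] C S ab(1) by auto
    then have "inner_apexes n S a b \<noteq> {}" "outer_apexes n S a b \<noteq> {}"
      using in_ex[OF h e ab(3)] out_ex[OF h e ab(3)] by blast+
    then show "card {t \<in> triangles n S. C \<subseteq> t} = 2"
      unfolding ab(1) card_triangles_on_edge[OF e] card_apexes[OF p ab(3)] by simp
  next
    fix C assume C: "C \<in> sides n"
    then obtain a b where ab: "C = {vx n a, vx n b}" "1 \<le> a" "a < b" "b \<le> 2 * (n + 1)"
      using side_vx[OF C assms] by blast
    have e: "edges n S a b" using ab C unfolding edges_def by auto
    have "card (apexes n S a b) = 1"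
    proof (cases "b = Suc a")
      case True
      \<comment> \<open>For \<open>n = 0\<close> the edge \<open>(1, 2)\<close> would be both kinds
        of polygon side at once.\<close>
      then have "\<not> (a = 1 \<and> b = 2 * (n + 1))" using assms by auto
      then have "outer_apexes n S a b \<noteq> {}" using out_ex[OF h e ab(3)] by blast
      then show ?thesis using inner0[OF True] card_apexes[OF p ab(3)] by simp
    next
      case False
      then have eq: "a = 1" "b = 2 * (n + 1)" using sides_vx[OF ab(2-4)] C ab(1) by auto
      then have "inner_apexes n S a b \<noteq> {}" using in_ex[OF h e ab(3) False] by blast
      then show ?thesis using outer0 card_apexes[OF p ab(3)] unfolding eq by simp
    qed
    then show "card {t \<in> triangles n S. C \<subseteq> t} = 1"
      unfolding ab(1) card_triangles_on_edge[OF e] .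
  qed
  have 2: "has_apexes (2 * (n + 1)) (edges n S)"
    if S2: "\<And>C. C \<in> S \<Longrightarrow> card {t \<in> triangles n S. C \<subseteq> t} = 2"
      and s1: "\<And>C. C \<in> sides n \<Longrightarrow> card {t \<in> triangles n S. C \<subseteq> t} = 1"
    unfolding has_apexes_def inner[symmetric] outer[symmetric]
  proof (intro allI impI, elim conjE)
    fix a b assume e: "edges n S a b" and ab: "a < b"
    have r: "1 \<le> a" "b \<le> 2 * (n + 1)" using range[OF e] by auto
    note ca = card_triangles_on_edge[OF e] card_apexes[OF p ab]
    show "(Suc a < b \<longrightarrow> inner_apexes n S a b \<noteq> {}) \<and> (\<not> (a = 1 \<and> b = 2 * (n + 1)) \<longrightarrow> outer_apexes n S a b \<noteq> {})"
    proof (cases "{vx n a, vx n b} \<in> S")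
      case True
      have "inner_apexes n S a b \<noteq> {}" "outer_apexes n S a b \<noteq> {}"
        using S2[OF True] unfolding ca by (auto split: if_splits)
      then show ?thesis by blast
    next
      case False
      then have s: "{vx n a, vx n b} \<in> sides n" using e unfolding edges_def by blast
      then have "b = Suc a \<or> (a = 1 \<and> b = 2 * (n + 1))" using sides_vx[OF r(1) ab r(2)] by simp
      then consider "b = Suc a" | "a = 1 \<and> b = 2 * (n + 1)" by blast
      then show ?thesis
      proof cases
        case 1
        then have "outer_apexes n S a b \<noteq> {}" using s1[OF s] inner0[OF 1] unfolding ca by auto
        then show ?thesis using 1 by simp
      next
        case 2
        then have "outer_apexes n S a b = {}" using outer0 by simp
        then have "inner_apexes n S a b \<noteq> {}" using s1[OF s] unfolding ca by auto
        then show ?thesis using 2 by blast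
      qed
    qed
  qed
  show ?thesis using 1 2 True noncrossing_iff_polyg[OF S assms] unfolding triangulation_def by blast
qed

section \<open>Comparison of chords and the half-turn\<close>

definition bw :: "nat \<Rightarrow> vertex set \<Rightarrow> vertex set \<Rightarrow> bool" where
  "bw n C D \<longleftrightarrow> (\<exists>a b c d. 1 \<le> a \<and> b \<le> 2 * (n + 1) \<and> 1 \<le> c \<and> d \<le> 2 * (n + 1) \<and>
     C = {vx n a, vx n b} \<and> D = {vx n c, vx n d} \<and> below_chord (n + 1) a b c d)"

lemma bwI:
  assumes "below_chord (n + 1) a b c d" "1 \<le> a" "b \<le> 2 * (n + 1)" "1 \<le> c" "d \<le> 2 * (n + 1)"
  shows "bw n {vx n a, vx n b} {vx n c, vx n d}"
  unfolding bw_def using assms by blast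

lemma pair_vx_eq_iff: "{vx n x, vx n y} = {vx n a, vx n b} \<longleftrightarrow> {x, y} = {a, b}"
  by (simp add: doubleton_eq_iff vx_eq_iff)

lemma bw_vx:
  assumes "1 \<le> a" "a < b" "b \<le> 2 * (n + 1)" "1 \<le> c" "c < d" "d \<le> 2 * (n + 1)"
  shows "bw n {vx n a, vx n b} {vx n c, vx n d} \<longleftrightarrow> below_chord (n + 1) a b c d"
proof
  assume "bw n {vx n a, vx n b} {vx n c, vx n d}"
  then obtain a' b' c' d' where h: "{a, b} = {a', b'}" "{c, d} = {c', d'}" "below_chord (n + 1) a' b' c' d'"
    unfolding bw_def pair_vx_eq_iff by blast
  then have "a' < b'" "c' < d'" unfolding below_chord_def by auto
  then have "a' = a" "b' = b" "c' = c" "d' = d" using h assms by (auto simp: doubleton_eq_iff)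
  then show "below_chord (n + 1) a b c d" using h by simp
next
  assume "below_chord (n + 1) a b c d"
  then show "bw n {vx n a, vx n b} {vx n c, vx n d}" unfolding bw_def using assms by blast
qed

lemma bw_asym: "bw n C D \<Longrightarrow> \<not> bw n D C"
proof
  assume h: "bw n C D" "bw n D C"
  obtain a b c d where abcd: "1 \<le> a" "b \<le> 2 * (n + 1)" "1 \<le> c" "d \<le> 2 * (n + 1)"
     "C = {vx n a, vx n b}" "D = {vx n c, vx n d}" "below_chord (n + 1) a b c d"
    using h(1) unfolding bw_def by blast
  have lt: "a < b" "c < d" using abcd(7) unfolding below_chord_def by auto
  show False
    using h abcd bw_vx[OF abcd(3) lt(2) abcd(4) abcd(1) lt(1) abcd(2)] below_chord_asym by blast
qed

text \<open>The half-turn shifts positions cyclically: it may reverse the ends of a chord and turn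
  one alternative of \<open>below_chord\<close> into the other. All distributions of the four
  positions over the two halves are checked.\<close>

lemma below_chord_antipode:
  assumes "below_chord m a b c d" "1 \<le> a" "b \<le> 2 * m" "1 \<le> c" "d \<le> 2 * m"
  shows "below_chord m (min (antipode m a) (antipode m b)) (max (antipode m a) (antipode m b))
    (min (antipode m c) (antipode m d)) (max (antipode m c) (antipode m d))"
  using assms unfolding below_chord_def antipode_def min_def max_def
  by (cases "a \<le> m"; cases "b \<le> m"; cases "c \<le> m"; cases "d \<le> m"; auto)

lemma half_turn_pair:
  assumes "1 \<le> a" "a \<le> 2 * (n + 1)" "1 \<le> b" "b \<le> 2 * (n + 1)"
  shows "half_turn ` {vx n a, vx n b} = {vx n (min (antipode (n + 1) a) (antipode (n + 1) b)),
    vx n (max (antipode (n + 1) a) (antipode (n + 1) b))}"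
  using assms by (auto simp: half_turn_vx min_def max_def)

lemma bw_half_turn:
  assumes "bw n C D"
  shows "bw n (half_turn ` C) (half_turn ` D)"
proof -
  obtain a b c d where h: "1 \<le> a" "b \<le> 2 * (n + 1)" "1 \<le> c" "d \<le> 2 * (n + 1)"
     "C = {vx n a, vx n b}" "D = {vx n c, vx n d}" "below_chord (n + 1) a b c d"
    using assms unfolding bw_def by blast
  have lt: "a < b" "c < d" using h(7) unfolding below_chord_def by auto
  have r: "a \<le> 2 * (n + 1)" "1 \<le> b" "c \<le> 2 * (n + 1)" "1 \<le> d" using lt h by auto
  have "half_turn ` C = {vx n (min (antipode (n + 1) a) (antipode (n + 1) b)),
    vx n (max (antipode (n + 1) a) (antipode (n + 1) b))}" 
    unfolding h(5) using half_turn_pair[OF h(1) r(1,2) h(2)] .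
  moreover have "half_turn ` D = {vx n (min (antipode (n + 1) c) (antipode (n + 1) d)),
    vx n (max (antipode (n + 1) c) (antipode (n + 1) d))}" 
    unfolding h(6) using half_turn_pair[OF h(3) r(3,4) h(4)] .
  moreover have "1 \<le> min p q" "max p q \<le> N" if "1 \<le> p \<and> p \<le> N" "1 \<le> q \<and> q \<le> N" for p q N :: nat
    using that by auto
  ultimately show ?thesis
    using bwI[OF below_chord_antipode[OF h(7,1-4)]] antipode_range[OF h(1) r(1)] antipode_range[OF r(2) h(2)]
      antipode_range[OF h(3) r(3)] antipode_range[OF r(4) h(4)] by simp
qed

lemma half_turn_half_turn_image [simp]: "half_turn ` half_turn ` C = C"
  by (simp add: image_image)

lemma half_turn_sides:
  assumes "C \<in> sides n" "n \<ge> 1"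
  shows "half_turn ` C \<in> sides n"
proof -
  obtain a b where ab: "C = {vx n a, vx n b}" "1 \<le> a" "a < b" "b \<le> 2 * (n + 1)"
    using side_vx[OF assms] by blast
  define p where "p = min (antipode (n + 1) a) (antipode (n + 1) b)"
  define q where "q = max (antipode (n + 1) a) (antipode (n + 1) b)"
  have ht: "half_turn ` C = {vx n p, vx n q}"
    unfolding ab(1) p_def q_def using half_turn_pair ab by simp
  have pq: "1 \<le> p" "p < q" "q \<le> 2 * (n + 1)"
    using ab unfolding antipode_def p_def q_def by auto
  have "b = Suc a \<or> (a = 1 \<and> b = 2 * (n + 1))" using sides_vx[OF ab(2-4)] ab(1) assms by simp
  then have "q = Suc p \<or> (p = 1 \<and> q = 2 * (n + 1))"
    using ab(2-4) unfolding antipode_def p_def q_def min_def max_def by (cases "a \<le> n + 1"; cases "b \<le> n + 1") auto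
  then show ?thesis unfolding ht using sides_vx[OF pq] by blast
qed

lemma typeB_chords: "S \<in> typeB_triangulations n \<Longrightarrow> S \<subseteq> chords n"
  unfolding typeB_triangulations_def triangulation_def by blast

lemma typeB_half_turn: "S \<in> typeB_triangulations n \<Longrightarrow> C \<in> S \<Longrightarrow> half_turn ` C \<in> S"
  unfolding typeB_triangulations_def by blast

lemma typeB_polyg: "S \<in> typeB_triangulations n \<Longrightarrow> n \<ge> 1 \<Longrightarrow> polyg (2 * (n + 1)) (edges n S)"
  unfolding typeB_triangulations_def using triangulation_iff by blast

lemma typeB_apexes: "S \<in> typeB_triangulations n \<Longrightarrow> n \<ge> 1 \<Longrightarrow> has_apexes (2 * (n + 1)) (edges n S)"
  unfolding typeB_triangulations_def using triangulation_iff by blast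

lemma typeB_antipode:
  assumes S: "S \<in> typeB_triangulations n" "n \<ge> 1" and e: "edges n S x y"
  shows "edges n S (antipode (n + 1) x) (antipode (n + 1) y)"
proof -
  have r: "1 \<le> x" "x \<le> 2 * (n + 1)" "1 \<le> y" "y \<le> 2 * (n + 1)" "x \<noteq> y" using e unfolding edges_def by auto
  have "{vx n (antipode (n + 1) x), vx n (antipode (n + 1) y)} = half_turn ` {vx n x, vx n y}"
    using r half_turn_vx by simp
  also have "\<dots> \<in> S \<union> sides n"
    using e half_turn_sides[OF _ S(2)] typeB_half_turn[OF S(1)] unfolding edges_def by blast
  finally have "{vx n (antipode (n + 1) x), vx n (antipode (n + 1) y)} \<in> S \<union> sides n" .
  moreover have "antipode (n + 1) x \<noteq> antipode (n + 1) y" using r antipode_antipode by metis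
  ultimately show ?thesis using antipode_range r unfolding edges_def by blast
qed

text \<open>For a mixed diagonal the half-turn reverses the ends and exchanges inside and outside,
  so \<open>k\<close> and \<open>l\<close> change roles; for a pure one both are preserved.\<close>

lemma quad_at_antipode:
  assumes q: "quad_at e a b k l" and h: "\<And>x y. e x y \<Longrightarrow> e (antipode m x) (antipode m y)"
    and sym: "\<And>x y. e x y \<Longrightarrow> e y x" and r: "\<And>x y. e x y \<Longrightarrow> 1 \<le> x \<and> x \<le> 2 * m"
  shows "\<exists>a' b' k' l'. {a', b'} = {antipode m a, antipode m b} \<and> {k', l'} = {antipode m k, antipode m l} \<and>
    quad_at e a' b' k' l'"
proof -
  have q': "e a b" "a < k" "k < b" "l < a \<or> b < l" "e a k" "e k b" "e a l" "e l b"
    using q by (auto simp: quad_at_def)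
  have hs: "e (antipode m x) (antipode m y)" "e (antipode m y) (antipode m x)" if "e x y" for x y
    using h sym that by blast+
  have rr: "1 \<le> a" "b \<le> 2 * m" "1 \<le> l" "l \<le> 2 * m"
    using r[OF q'(1)] r[OF sym[OF q'(1)]] r[OF q'(8)] by auto
  note e = hs[OF q'(1)] hs[OF q'(5)] hs[OF q'(6)] hs[OF q'(7)] hs[OF q'(8)]
  show ?thesis
  proof (cases "a \<le> m \<and> m < b")
    case True
    have "quad_at e (antipode m b) (antipode m a) (antipode m l) (antipode m k)"
      unfolding quad_at_def using e q'(2-4) rr True by (simp add: antipode_def) linarith
    then show ?thesis by blast
  next
    case False
    have "quad_at e (antipode m a) (antipode m b) (antipode m k) (antipode m l)"
      unfolding quad_at_def using e q'(2-4) rr False by (simp add: antipode_def) linarith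
    then show ?thesis by blast
  qed
qed

lemma typeB_quad_antipode:
  assumes S: "S \<in> typeB_triangulations n" "n \<ge> 1" and q: "quad_at (edges n S) a b k l"
  shows "\<exists>a' b' k' l'. half_turn ` {vx n a, vx n b} = {vx n a', vx n b'} \<and>
    half_turn ` {vx n k, vx n l} = {vx n k', vx n l'} \<and> quad_at (edges n S) a' b' k' l'"
proof -
  obtain a' b' k' l' where h: "{a', b'} = {antipode (n+1) a, antipode (n+1) b}" "{k', l'} = {antipode (n+1) k, antipode (n+1) l}"
    "quad_at (edges n S) a' b' k' l'"
    using quad_at_antipode[OF q typeB_antipode[OF S]] edges_sym unfolding edges_def by blast
  have "edges n S a b" "edges n S a k" "edges n S a l" using q unfolding quad_at_def by auto
  then have "half_turn ` {vx n a, vx n b} = {vx n (antipode (n+1) a), vx n (antipode (n+1) b)}"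
    "half_turn ` {vx n k, vx n l} = {vx n (antipode (n+1) k), vx n (antipode (n+1) l)}"
    unfolding edges_def by (simp_all add: half_turn_vx)
  then show ?thesis using h pair_vx_eq_iff by metis
qed

section \<open>Quadrilaterals, colours, and flips of symmetric pairs\<close>

lemma chord_quad:
  assumes "n \<ge> 1" "triangulation n S" "C \<in> S"
  shows "\<exists>a b k l. C = {vx n a, vx n b} \<and> quad_at (edges n S) a b k l"
proof -
  have S: "S \<subseteq> chords n" "has_apexes (2 * (n + 1)) (edges n S)" using assms triangulation_iff by auto
  obtain a b where ab: "C = {vx n a, vx n b}" "1 \<le> a" "a < b" "b \<le> 2 * (n + 1)"
    using S assms chord_vx by blast
  have e: "edges n S a b" using ab assms(3) unfolding edges_def by auto
  have "Suc a < b" "\<not> (a = 1 \<and> b = 2 * (n + 1))"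
    using chords_vx[OF ab(2-4)] assms(3) S ab(1,3) by auto
  then obtain k l where "a < k" "k < b" "edges n S a k" "edges n S k b"
    "l < a \<or> b < l" "edges n S a l" "edges n S l b"
    using S(2) e ab(3) unfolding has_apexes_def by meson
  then show ?thesis using ab(1) e unfolding quad_at_def by blast
qed

lemma quad_at_range:
  assumes "quad_at (edges n S) a b k l"
  shows "1 \<le> a" "a \<le> 2 * (n + 1)" "1 \<le> b" "b \<le> 2 * (n + 1)" "1 \<le> k" "k \<le> 2 * (n + 1)" "1 \<le> l" "l \<le> 2 * (n + 1)"
    "a < k" "k < b" "l < a \<or> b < l"
  using assms unfolding quad_at_def edges_def by auto

lemma quad_eq:
  assumes p: "polyg (2 * (n + 1)) (edges n S)" and q: "quad_at (edges n S) a b k l"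
  shows "quad n S {vx n a, vx n b} = {vx n a, vx n b, vx n k, vx n l}"
    and "other_diagonal n S {vx n a, vx n b} = {vx n k, vx n l}"
proof -
  have q': "edges n S a b" "a < k" "k < b" "l < a \<or> b < l" "edges n S a k" "edges n S k b"
    "edges n S a l" "edges n S l b"
    using q by (auto simp: quad_at_def)
  have "apexes n S a b = {k, l}"
  proof (intro equalityI subsetI)
    fix x assume x: "x \<in> apexes n S a b"
    then have x': "edges n S a x" "edges n S x b" "x \<noteq> a" "x \<noteq> b" unfolding apexes_def edges_def by auto
    then consider "a < x" "x < b" | "x < a \<or> b < x" by linarith
    then show "x \<in> {k, l}"
    proof cases
      case 1
      then show ?thesis using apex_inside_unique[OF p 1 x'(1,2) q'(2,3,5,6)] by simp
    next
      case 2
      have "a < b" using q' by simp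
      then show ?thesis using apex_outside_unique[OF p _ 2 x'(1,2) q'(4,7,8)] by simp
    qed
  qed (use q' in \<open>auto simp: apexes_def\<close>)
  then show qu: "quad n S {vx n a, vx n b} = {vx n a, vx n b, vx n k, vx n l}"
    unfolding quad_def triangles_on_edge[OF q'(1)] by auto
  have "vx n k \<notin> {vx n a, vx n b}" "vx n l \<notin> {vx n a, vx n b}" using q' by (auto simp: vx_eq_iff)
  then show "other_diagonal n S {vx n a, vx n b} = {vx n k, vx n l}"
    unfolding other_diagonal_def qu by auto
qed

lemma vx_label: "label (vx n p) = (if p \<le> n + 1 then p else p - (n + 1))" "is_barred (vx n p) \<longleftrightarrow> \<not> p \<le> n + 1"
  unfolding vx_def by auto

text \<open>Within one type, labels are ordered like positions, so for each combination of types of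
  \<open>a\<close> and \<open>b\<close> the colour becomes a set of inequalities between positions
  and \<open>n + 1\<close>.\<close>

lemma green_iff_below:
  assumes p: "polyg (2 * (n + 1)) (edges n S)" and q: "quad_at (edges n S) a b k l"
  shows "green n S {vx n a, vx n b} \<longleftrightarrow> below_chord (n + 1) a b (min k l) (max k l)"
proof -
  have o: "a < k" "k < b" "l < a \<or> b < l" using q by (auto simp: quad_at_def)
  have pure: "pure {vx n a, vx n b} \<longleftrightarrow> \<not> (a \<le> n + 1 \<and> n + 1 < b)"
    using o by (auto simp: pure_def same_type_def vx_label)
  consider "b \<le> n + 1" | "n + 1 < a" | "a \<le> n + 1" "n + 1 < b" by linarith
  then show ?thesis
  proof cases
    case 1
    then show ?thesis using pure o
      unfolding green_def red_def quad_eq(1)[OF p q] same_type_def below_chord_def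
      by (simp add: vx_label min_def max_def) linarith
  next
    case 2
    then show ?thesis using pure o
      unfolding green_def red_def quad_eq(1)[OF p q] same_type_def below_chord_def
      by (simp add: vx_label min_def max_def) linarith
  next
    case 3
    then show ?thesis using pure o
      unfolding green_def red_def quad_eq(1)[OF p q] same_type_def below_chord_def
      by (simp add: vx_label min_def max_def) linarith
  qed
qed

lemma bw_new_diagonal:
  assumes q: "quad_at (edges n S) a b k l"
  shows "bw n {vx n a, vx n b} {vx n k, vx n l} \<longleftrightarrow> below_chord (n + 1) a b (min k l) (max k l)"
proof -
  have "{vx n k, vx n l} = {vx n (min k l), vx n (max k l)}" by (auto simp: min_def max_def)
  moreover have "min k l < max k l" "1 \<le> min k l" "max k l \<le> 2 * (n + 1)" "a < b"
    using quad_at_range[OF q] by auto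
  ultimately show ?thesis using bw_vx quad_at_range[OF q] by metis
qed

text \<open>By maximality a chord missing from \<open>T\<close> crosses an edge of \<open>T\<close>,
  and of two crossing chords one is always below the other. This separates distinct
  triangulations.\<close>

lemma crossing_chord_exists:
  assumes T: "T \<in> typeB_triangulations n" "n \<ge> 1" and C: "C \<in> chords n" "C \<notin> T"
  shows "\<exists>D\<in>T. bw n C D \<or> bw n D C"
proof -
  obtain a b where ab: "C = {vx n a, vx n b}" "1 \<le> a" "a < b" "b \<le> 2 * (n + 1)"
    using C(1) chord_vx by blast
  have "\<not> edges n T a b" using C sides_chords_disjoint ab(1) unfolding edges_def by blast
  moreover have "maximal_edges (2 * (n + 1)) (edges n T)"
    using apexes_imp_maximal typeB_polyg[OF T] typeB_apexes[OF T] by blast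
  ultimately obtain c d where cd: "edges n T c d" "(a < c \<and> c < b \<and> b < d) \<or> (c < a \<and> a < d \<and> d < b)"
    using maximal_edges_D[of _ _ a b] ab(2-4) by blast
  have r: "c < d" "1 \<le> c" "d \<le> 2 * (n + 1)" using cd unfolding edges_def by auto
  have "{vx n c, vx n d} \<in> T"
    using cd(2) edges_chord[OF cd(1), of b a] edges_chord[OF cd(1), of a b] ab(2-4) by auto
  moreover have "bw n C {vx n c, vx n d} \<or> bw n {vx n c, vx n d} C"
    unfolding ab(1) using bw_vx[OF ab(2-4) r(2,1,3)] bw_vx[OF r(2,1,3) ab(2-4)]
      below_chord_crossing[OF ab(3) r(1)] cd(2) by blast
  ultimately show ?thesis by blast
qed

lemma typeB_noncrossing:
  assumes S: "S \<in> typeB_triangulations n" "n \<ge> 1" "C \<in> S" "D \<in> S"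
  shows "\<not> bw n C D"
proof
  assume "bw n C D"
  then obtain a b c d where h: "C = {vx n a, vx n b}" "D = {vx n c, vx n d}" "below_chord (n + 1) a b c d"
     "1 \<le> a" "b \<le> 2 * (n + 1)" "1 \<le> c" "d \<le> 2 * (n + 1)"
    unfolding bw_def by blast
  have lt: "a < b" "c < d" using h(3) unfolding below_chord_def by auto
  have "edges n S a b" "edges n S c d" using h lt S(3,4) unfolding edges_def by auto
  then show False
    using polyg_nc[OF typeB_polyg[OF S(1,2)]] below_chord_crossing[OF lt] h(3) by blast
qed

lemma edges_flip:
  assumes "S \<subseteq> chords n" "quad_at (edges n S) a b k l"
  shows "edges n (S - {{vx n a, vx n b}} \<union> {{vx n k, vx n l}}) = flip_edges (edges n S) a b k l"
proof (intro ext)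
  fix x y
  have C: "{vx n a, vx n b} \<notin> sides n"
    using assms(2) edges_chord[of n S a b k l] quad_at_range[OF assms(2)] sides_chords_disjoint assms(1)
    unfolding quad_at_def by blast
  have kl: "k \<noteq> l" using quad_at_range[OF assms(2)] by auto
  have in_range: "1 \<le> x \<and> x \<le> 2 * (n + 1) \<and> 1 \<le> y \<and> y \<le> 2 * (n + 1) \<and> x \<noteq> y" if "{x, y} = {k, l}"
    using that kl quad_at_range[OF assms(2)] by (auto simp: doubleton_eq_iff)
  show "edges n (S - {{vx n a, vx n b}} \<union> {{vx n k, vx n l}}) x y \<longleftrightarrow> flip_edges (edges n S) a b k l x y"
  proof (cases "{x, y} = {k, l}")
    case True
    then have "{vx n x, vx n y} = {vx n k, vx n l}" by (simp only: pair_vx_eq_iff not_False_eq_True)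
    then have L: "edges n (S - {{vx n a, vx n b}} \<union> {{vx n k, vx n l}}) x y"
      unfolding edges_def using in_range[OF True] by simp
    have R: "flip_edges (edges n S) a b k l x y"
      unfolding flip_edges_def by (rule disjI2[OF True])
    show ?thesis by (rule iffI, rule R, rule L)
  next
    case False
    then have kl: "{vx n x, vx n y} \<noteq> {vx n k, vx n l}" by (simp only: pair_vx_eq_iff not_False_eq_True)
    show ?thesis
    proof (cases "{x, y} = {a, b}")
      case True
      then have "{vx n x, vx n y} = {vx n a, vx n b}" by (simp only: pair_vx_eq_iff not_False_eq_True)
      then have "{vx n x, vx n y} \<notin> S - {{vx n a, vx n b}} \<union> {{vx n k, vx n l}} \<union> sides n"
        using C kl by simp
      then have L: "\<not> edges n (S - {{vx n a, vx n b}} \<union> {{vx n k, vx n l}}) x y"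
        unfolding edges_def by simp
      have R: "\<not> flip_edges (edges n S) a b k l x y"
        unfolding flip_edges_def using True False by metis
      show ?thesis by (rule iffI, erule notE[OF L], erule notE[OF R])
    next
      case ab: False
      then have "{vx n x, vx n y} \<noteq> {vx n a, vx n b}" by (simp only: pair_vx_eq_iff not_False_eq_True)
      then have "{vx n x, vx n y} \<in> S - {{vx n a, vx n b}} \<union> {{vx n k, vx n l}} \<union> sides n \<longleftrightarrow> {vx n x, vx n y} \<in> S \<union> sides n"
        using kl by simp
      then show ?thesis unfolding edges_def flip_edges_def using ab False by metis
    qed
  qed
qed

text \<open>The apexes after the flip are not constructed; they follow from maximality, which the
  flip preserves.\<close>

lemma triangulation_flip:
  assumes n: "n \<ge> 1" and S: "triangulation n S" and q: "quad_at (edges n S) a b k l"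
  shows "triangulation n (S - {{vx n a, vx n b}} \<union> {{vx n k, vx n l}})"
proof -
  have S': "S \<subseteq> chords n" "polyg (2 * (n + 1)) (edges n S)" "has_apexes (2 * (n + 1)) (edges n S)"
    using S triangulation_iff[OF n] by auto
  note r = quad_at_range[OF q]
  have "{vx n k, vx n l} \<in> chords n"
  proof (cases "l < a")
    case True
    then show ?thesis using chords_vx[of l k n] r by (auto simp: insert_commute)
  next
    case False
    then show ?thesis using chords_vx[of k l n] r by auto
  qed
  moreover have "polyg (2 * (n + 1)) (flip_edges (edges n S) a b k l)"
    by (rule flip_edges_polyg[OF S'(2) q])
  moreover have "has_apexes (2 * (n + 1)) (flip_edges (edges n S) a b k l)"
    using maximal_imp_apexes flip_edges_maximal[OF S'(2) apexes_imp_maximal[OF S'(2,3)] q] flip_edges_polyg[OF S'(2) q]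
    by blast
  ultimately show ?thesis
    unfolding triangulation_iff[OF n] edges_flip[OF S'(1) q] using S'(1) by blast
qed

text \<open>The half-turn is an involution without fixed vertices, so one common endpoint already
  makes it exchange \<open>u\<close> and \<open>v\<close>. Hence the flips of a chord and of its
  partner do not interfere.\<close>

lemma half_turn_disjoint:
  assumes "half_turn ` {u, v} \<noteq> {u, v}"
  shows "half_turn ` {u, v} \<inter> {u, v} = {}"
proof -
  have "half_turn w \<noteq> w" "w \<noteq> half_turn w" for w by (cases w, auto)+
  moreover have "half_turn u = v \<Longrightarrow> half_turn v = u" by auto
  moreover have "half_turn v = u \<Longrightarrow> half_turn u = v" by auto
  ultimately show ?thesis using assms by auto
qed

text \<open>Unless \<open>C\<close> is a diameter, two flips are performed in turn. Each edge of the
  second quadrilateral has an endpoint on the partner of \<open>C\<close>, or is the partner, so the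
  first flip does not remove it.\<close>

lemma typeB_flip:
  assumes n: "n \<ge> 1" and S: "S \<in> typeB_triangulations n" and q: "quad_at (edges n S) a b k l"
    and C: "C = {vx n a, vx n b}" and D: "D = {vx n k, vx n l}"
  shows "S - {C, half_turn ` C} \<union> {D, half_turn ` D} \<in> typeB_triangulations n"
    and "other_diagonal n S C = D" "other_diagonal n S (half_turn ` C) = half_turn ` D"
proof -
  have S': "S \<subseteq> chords n" "polyg (2 * (n + 1)) (edges n S)" "triangulation n S"
    using S n triangulation_iff[OF n] unfolding typeB_triangulations_def by auto
  obtain a' b' k' l' where C': "half_turn ` C = {vx n a', vx n b'}" and D': "half_turn ` D = {vx n k', vx n l'}"
    and q': "quad_at (edges n S) a' b' k' l'"
    using typeB_quad_antipode[OF S n q] unfolding C D by blast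
  show od: "other_diagonal n S C = D" "other_diagonal n S (half_turn ` C) = half_turn ` D"
    using quad_eq(2)[OF S'(2)] q q' unfolding C D C'[unfolded C] D'[unfolded D] by auto
  note r = quad_at_range[OF q]
  have CS: "C \<in> S"
    using q edges_chord[of n S a b k l] r unfolding quad_at_def C by blast
  then have hCS: "half_turn ` C \<in> S" using typeB_half_turn[OF S] by blast
  have t: "triangulation n (S - {C, half_turn ` C} \<union> {D, half_turn ` D})"
  proof (cases "half_turn ` C = C")
    case True
    then have "half_turn ` D = D" using od by simp
    then show ?thesis using triangulation_flip[OF n S'(3) q] True unfolding C D by simp
  next
    case False
    define S1 where "S1 = S - {C} \<union> {D}"
    have "half_turn ` C \<inter> C = {}" using half_turn_disjoint False unfolding C by blast
    then have dis: "a' \<notin> {a, b}" "b' \<notin> {a, b}" unfolding C' unfolding C by auto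
    have e1: "edges n S1 = flip_edges (edges n S) a b k l"
      unfolding S1_def C D by (rule edges_flip[OF S'(1) q])
    have "quad_at (edges n S1) a' b' k' l'"
      using q' dis unfolding quad_at_def e1 flip_edges_def by blast
    moreover have "triangulation n S1" unfolding S1_def C D by (rule triangulation_flip[OF n S'(3) q])
    ultimately have "triangulation n (S1 - {half_turn ` C} \<union> {half_turn ` D})"
      unfolding C' D' using triangulation_flip[OF n] by blast
    \<comment> \<open>The partner lies in \<open>S\<close> and cannot cross \<open>C\<close>, while
      \<open>D\<close> does. So the second flip does not delete the chord created by the
      first.\<close>
    moreover have "D \<noteq> half_turn ` C"
    proof
      assume "D = half_turn ` C"
      then have "edges n S k l" using hCS r unfolding D edges_def by auto
      then show False using polyg_nc[OF S'(2), of a b k l] polyg_nc[OF S'(2), of l k a b] r q polyg_sym[OF S'(2)]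
        unfolding quad_at_def by blast
    qed
    then have "S1 - {half_turn ` C} \<union> {half_turn ` D} = S - {C, half_turn ` C} \<union> {D, half_turn ` D}"
      unfolding S1_def by blast
    ultimately show ?thesis by simp
  qed
  have "inj ((`) half_turn)" by (rule injI) (metis half_turn_half_turn_image)
  then have "(`) half_turn ` (S - {C, half_turn ` C} \<union> {D, half_turn ` D}) =
     (`) half_turn ` S - {half_turn ` C, C} \<union> {half_turn ` D, D}"
    by (simp add: image_Un image_set_diff)
  also have "\<dots> = S - {C, half_turn ` C} \<union> {D, half_turn ` D}"
    using S unfolding typeB_triangulations_def by auto
  finally show "S - {C, half_turn ` C} \<union> {D, half_turn ` D} \<in> typeB_triangulations n"
    using t unfolding typeB_triangulations_def by blast
qed

section \<open>Flip posets\<close>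

text \<open>Polygons are left behind here: \<open>h\<close> is the half-turn, \<open>coverD\<close>
  carries the first fact on upward flips, \<open>cover_exists\<close> the second.\<close>

locale flip_poset =
  fixes \<T> :: "'c set set" and bw :: "'c \<Rightarrow> 'c \<Rightarrow> bool" and h :: "'c \<Rightarrow> 'c"
    and cover :: "'c set \<Rightarrow> 'c set \<Rightarrow> bool"
  assumes finite_\<T>: "finite \<T>"
    and noncrossing: "S \<in> \<T> \<Longrightarrow> c \<in> S \<Longrightarrow> d \<in> S \<Longrightarrow> \<not> bw c d"
    and asym: "bw c d \<Longrightarrow> \<not> bw d c"
    and separated: "S \<in> \<T> \<Longrightarrow> T \<in> \<T> \<Longrightarrow> S \<noteq> T \<Longrightarrow> \<exists>c\<in>S. \<exists>d\<in>T. bw c d \<or> bw d c"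
    and h_bw: "bw c d \<Longrightarrow> bw (h c) (h d)"
    and h_h [simp]: "h (h c) = c"
    and h_mem: "S \<in> \<T> \<Longrightarrow> c \<in> S \<Longrightarrow> h c \<in> S"
    and coverD: "cover S T \<Longrightarrow> S \<in> \<T> \<and> T \<in> \<T> \<and> (\<exists>c c'. c \<in> S \<and> T = S - {c, h c} \<union> {c', h c'} \<and> bw c c' \<and>
      (\<forall>d. bw d c \<longrightarrow> (\<exists>t\<in>T. bw d t)))"
    and cover_exists: "S \<in> \<T> \<Longrightarrow> c0 \<in> S \<Longrightarrow> W \<in> \<T> \<Longrightarrow> w \<in> W \<Longrightarrow> bw c0 w \<Longrightarrow>
      \<exists>T c c'. cover S T \<and> c \<in> S \<and> T = S - {c, h c} \<union> {c', h c'} \<and> bw c c' \<and>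
       (\<forall>d. bw d c' \<longrightarrow> (\<exists>s\<in>S. bw d s) \<or> bw d w \<or> bw d (h w))"
    and cover_unique: "cover S T \<Longrightarrow> cover S T' \<Longrightarrow> c \<in> S - T \<Longrightarrow> c \<in> S - T' \<Longrightarrow> T = T'"
begin

definition R :: "'c set \<Rightarrow> 'c set \<Rightarrow> bool" where
  "R S X \<longleftrightarrow> (\<forall>c\<in>S. \<forall>d\<in>X. \<not> bw d c)"

lemma R_refl: "S \<in> \<T> \<Longrightarrow> R S S"
  unfolding R_def using noncrossing by blast

lemma R_antisym: "S \<in> \<T> \<Longrightarrow> X \<in> \<T> \<Longrightarrow> R S X \<Longrightarrow> R X S \<Longrightarrow> S = X"
  unfolding R_def using separated by blast

text \<open>A chord of \<open>S\<close> either stays in \<open>T\<close> or is flipped; in the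
  latter case whatever is below it is also below a chord of \<open>T\<close>, after a half-turn for
  the partner. Iterating this needs no transitivity of \<open>R\<close>.\<close>

lemma R_step:
  assumes c: "cover S T" and X: "X \<in> \<T>" and R: "R T X"
  shows "R S X"
  unfolding R_def
proof (intro ballI notI)
  fix s d assume s: "s \<in> S" and d: "d \<in> X" and b: "bw d s"
  have T: "T \<in> \<T>" using coverD[OF c] by blast
  obtain c c' where c: "T = S - {c, h c} \<union> {c', h c'}" "\<And>d. bw d c \<Longrightarrow> \<exists>t\<in>T. bw d t"
    using coverD[OF c] by blast
  consider "s \<in> T" | "s = c" | "s = h c" using s c(1) by blast
  then show False
  proof cases
    case 1 then show ?thesis using R d b unfolding R_def by blast
  next
    case 2 then show ?thesis using R c(2) d b unfolding R_def by blast
  next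
    case 3
    then have "bw (h d) c" using h_bw[OF b] by simp
    then show ?thesis using R c(2) h_mem[OF X d] unfolding R_def by blast
  qed
qed

lemma cover_R:
  assumes "cover S T" shows "R S T"
  using R_step[OF assms _ R_refl] coverD[OF assms] by blast

lemma rtranclp_cover_R:
  assumes "cover\<^sup>*\<^sup>* S X" "X \<in> \<T>"
  shows "R S X"
  using assms by (induction rule: converse_rtranclp_induct) (auto intro: R_refl R_step)

text \<open>Only the new chords can spoil the comparison, and as \<open>X\<close> is closed under
  \<open>h\<close> it suffices to look at \<open>c'\<close>.\<close>

lemma cover_above:
  assumes c: "T = S - {c, h c} \<union> {c', h c'}" and X: "X \<in> \<T>" and R: "R S X"
    and up: "\<And>d. d \<in> X \<Longrightarrow> bw d c' \<Longrightarrow> False"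
  shows "R T X"
  unfolding R_def
proof (intro ballI notI)
  fix t d assume t: "t \<in> T" and d: "d \<in> X" and b: "bw d t"
  consider "t \<in> S" | "t = c'" | "t = h c'" using t c by blast
  then show False
  proof cases
    case 1 then show ?thesis using R d b unfolding R_def by blast
  next
    case 2 then show ?thesis using up d b by blast
  next
    case 3
    then have "bw (h d) c'" using h_bw[OF b] by simp
    then show ?thesis using up h_mem[OF X d] by blast
  qed
qed

lemma cover_neq: "cover S T \<Longrightarrow> S \<noteq> T"
proof
  assume c: "cover S T" "S = T"
  obtain c c' where "c \<in> S" "c' \<in> T" "bw c c'" using coverD[OF c(1)] by blast
  then show False using noncrossing coverD[OF c(1)] c(2) by blast
qed

lemma not_R_cover: "cover S T \<Longrightarrow> \<not> R T S"
  using cover_neq cover_R R_antisym coverD by metis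

text \<open>\<open>R S X\<close> settles the direction of a crossing: some \<open>c0\<close> in
  \<open>S\<close> is below some \<open>w\<close> in \<open>X\<close>. The flip provided for
  \<open>w\<close> stays under \<open>X\<close>, since no chord of \<open>X\<close> is below a chord
  of \<open>S\<close>, below \<open>w\<close> or below \<open>h w\<close>.\<close>

lemma R_cover_exists:
  assumes S: "S \<in> \<T>" and X: "X \<in> \<T>" and R: "R S X" and ne: "S \<noteq> X"
  shows "\<exists>T. cover S T \<and> R T X"
proof -
  obtain c0 w where w: "c0 \<in> S" "w \<in> X" "bw c0 w"
    using separated[OF S X ne] R unfolding R_def by blast
  obtain T c c' where T: "cover S T" "T = S - {c, h c} \<union> {c', h c'}"
    "\<And>d. bw d c' \<Longrightarrow> (\<exists>s\<in>S. bw d s) \<or> bw d w \<or> bw d (h w)"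
    using cover_exists[OF S w(1) X w(2,3)] by blast
  have "R T X"
    using cover_above[OF T(2) X R] T(3) noncrossing[OF X] R w(2) h_mem[OF X w(2)] unfolding R_def by blast
  then show ?thesis using T by blast
qed

text \<open>Flips towards \<open>X\<close> terminate because the set of reachable members shrinks:
  \<open>S\<close> cannot be reached again from its cover.\<close>

lemma R_imp_rtranclp_cover:
  assumes "S \<in> \<T>" "X \<in> \<T>" "R S X"
  shows "cover\<^sup>*\<^sup>* S X"
  using assms
proof (induction "card {T \<in> \<T>. cover\<^sup>*\<^sup>* S T}" arbitrary: S rule: less_induct)
  case less
  show ?case
  proof (cases "S = X")
    case False
    then obtain T where T: "cover S T" "R T X" using R_cover_exists less.prems by blast
    have "S \<notin> {U \<in> \<T>. cover\<^sup>*\<^sup>* T U}"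
      using not_R_cover[OF T(1)] rtranclp_cover_R by blast
    moreover have "{U \<in> \<T>. cover\<^sup>*\<^sup>* T U} \<subseteq> {U \<in> \<T>. cover\<^sup>*\<^sup>* S U}"
      using T(1) by (auto intro: converse_rtranclp_into_rtranclp)
    ultimately have "{U \<in> \<T>. cover\<^sup>*\<^sup>* T U} \<subset> {U \<in> \<T>. cover\<^sup>*\<^sup>* S U}"
      using less.prems by blast
    then have "card {U \<in> \<T>. cover\<^sup>*\<^sup>* T U} < card {U \<in> \<T>. cover\<^sup>*\<^sup>* S U}"
      by (intro psubset_card_mono) (auto simp: finite_\<T>)
    then show ?thesis
      using less.hyps[of T] coverD[OF T(1)] T less.prems by (meson converse_rtranclp_into_rtranclp)
  qed auto
qed

lemma R_iff: "S \<in> \<T> \<Longrightarrow> X \<in> \<T> \<Longrightarrow> R S X \<longleftrightarrow> cover\<^sup>*\<^sup>* S X"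
  using rtranclp_cover_R R_imp_rtranclp_cover by blast

lemma R_trans: "S \<in> \<T> \<Longrightarrow> T \<in> \<T> \<Longrightarrow> X \<in> \<T> \<Longrightarrow> R S T \<Longrightarrow> R T X \<Longrightarrow> R S X"
  using R_iff rtranclp_trans by metis

text \<open>Maximality refers to single flips only; the climb ends because the set of members above
  strictly shrinks.\<close>

lemma finite_maximal:
  assumes "M0 \<in> \<M>" "\<M> \<subseteq> \<T>"
  shows "\<exists>M\<in>\<M>. R M0 M \<and> (\<forall>T\<in>\<M>. cover M T \<longrightarrow> False)"
  using assms(1)
proof (induction "card {T \<in> \<T>. R M0 T}" arbitrary: M0 rule: less_induct)
  case less
  show ?case
  proof (cases "\<exists>T\<in>\<M>. cover M0 T")
    case False then show ?thesis using less.prems assms(2) R_refl by blast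
  next
    case True
    then obtain T where T: "T \<in> \<M>" "cover M0 T" by blast
    have m: "M0 \<in> \<T>" "T \<in> \<T>" using T less.prems assms(2) by auto
    have tr: "R M0 U" if "U \<in> \<T>" "R T U" for U using R_trans[OF m that(1) cover_R[OF T(2)]] that by blast
    then have "{U \<in> \<T>. R T U} \<subset> {U \<in> \<T>. R M0 U}"
      using not_R_cover[OF T(2)] m R_refl by blast
    then have "card {U \<in> \<T>. R T U} < card {U \<in> \<T>. R M0 U}"
      by (intro psubset_card_mono) (auto simp: finite_\<T>)
    then obtain M where "M \<in> \<M>" "R T M" "\<forall>T\<in>\<M>. cover M T \<longrightarrow> False"
      using less.hyps[of T] T by blast
    then show ?thesis using tr assms(2) by blast
  qed
qed

text \<open>A maximal lower bound is the greatest one: otherwise a flip would lead to a larger lower bound.\<close>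

lemma greatest_lower_bound:
  assumes U: "U \<subseteq> \<T>" and L: "L \<in> \<T>" "\<forall>X\<in>U. R L X"
  shows "\<exists>M\<in>\<T>. (\<forall>X\<in>U. R M X) \<and> (\<forall>W\<in>\<T>. (\<forall>X\<in>U. R W X) \<longrightarrow> R W M)"
proof -
  obtain M where M: "M \<in> \<T>" "\<forall>X\<in>U. R M X"
    and max: "\<And>T. T \<in> \<T> \<Longrightarrow> \<forall>X\<in>U. R T X \<Longrightarrow> cover M T \<Longrightarrow> False"
    using finite_maximal[of L "{M \<in> \<T>. \<forall>X\<in>U. R M X}"] L by blast
  have "R W M" if W: "W \<in> \<T>" "\<forall>X\<in>U. R W X" for W
  proof (rule ccontr)
    assume "\<not> R W M"
    then obtain w c0 where w: "w \<in> W" "c0 \<in> M" "bw c0 w" unfolding R_def by blast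
    obtain T c c' where T: "cover M T" "T = M - {c, h c} \<union> {c', h c'}"
      "\<And>d. bw d c' \<Longrightarrow> (\<exists>s\<in>M. bw d s) \<or> bw d w \<or> bw d (h w)"
      using cover_exists[OF M(1) w(2) W(1) w(1,3)] by blast
    \<comment> \<open>A chord of \<open>X\<close> below \<open>c'\<close> would be below a chord of
      \<open>M\<close>, below \<open>w\<close> or below \<open>h w\<close>; both \<open>M\<close>
      and \<open>W\<close> are lower bounds, which rules this out.\<close>
    have "R T X" if X: "X \<in> U" for X
    proof (rule cover_above[OF T(2)])
      show "X \<in> \<T>" "R M X" using X U M by auto
      fix d assume "d \<in> X" "bw d c'"
      then show False using T(3) M(2) W(2) X w(1) h_mem[OF W(1) w(1)] unfolding R_def by blast
    qed
    then show False using max T(1) coverD by blast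
  qed
  then show ?thesis using M by blast
qed

text \<open>The witness is the top of the face of all members of \<open>\<T>\<close> containing the chords of \<open>Y\<close> that no member of \<open>B\<close> flips.\<close>

lemma face_top:
  assumes Y: "Y \<in> \<T>" and B: "\<And>a. a \<in> B \<Longrightarrow> cover Y a"
  shows "\<exists>M\<in>\<T>. (\<forall>a\<in>B. R a M) \<and> (\<forall>a. cover Y a \<longrightarrow> R a M \<longrightarrow> a \<in> B)"
proof -
  define F where "F = {c \<in> Y. \<forall>a\<in>B. c \<in> a}"
  have Bm: "a \<in> \<T>" if "a \<in> B" for a using that B coverD by blast
  have hF: "h c \<in> F" if "c \<in> F" for c using that h_mem Y Bm unfolding F_def by blast
  obtain M where M: "M \<in> \<T>" "F \<subseteq> M" and max: "\<And>T. T \<in> \<T> \<Longrightarrow> F \<subseteq> T \<Longrightarrow> cover M T \<Longrightarrow> False"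
    using finite_maximal[of Y "{M \<in> \<T>. F \<subseteq> M}"] Y unfolding F_def by blast
  have "R a M" if a: "a \<in> B" for a
  proof (rule ccontr)
    assume "\<not> R a M"
    then obtain w c0 where w: "w \<in> a" "c0 \<in> M" "bw c0 w" unfolding R_def by blast
    obtain T c c' where T: "cover M T" "c \<in> M" "T = M - {c, h c} \<union> {c', h c'}" "bw c c'"
      "\<And>d. bw d c' \<Longrightarrow> (\<exists>s\<in>M. bw d s) \<or> bw d w \<or> bw d (h w)"
      using cover_exists[OF M(1) w(2) Bm[OF a] w(1,3)] by blast
    show False
    proof (cases "c \<in> F")
      \<comment> \<open>\<open>c\<close> is itself below \<open>c'\<close>, so by the choice of the
        flip it is below a chord of \<open>M\<close>, below \<open>w\<close> or below
        \<open>h w\<close>. But \<open>c\<close> lies in both \<open>M\<close> and \<open>a\<close>,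
        which have no crossings.\<close>
      case True
      then have "c \<in> a" using a unfolding F_def by blast
      then show False
        using T(5)[OF T(4)] noncrossing[OF M(1) T(2)] noncrossing[OF Bm[OF a]] w(1) h_mem[OF Bm[OF a] w(1)] by blast
    next
      case False
      then have "h c \<notin> F" using hF[of "h c"] by auto
      then have "F \<subseteq> T" using M False unfolding T(3) by blast
      then show False using max T(1) coverD by blast
    qed
  qed
  moreover have "a \<in> B" if a: "cover Y a" "R a M" for a
  proof (rule ccontr)
    assume na: "a \<notin> B"
    obtain c c' where c: "c \<in> Y" "c' \<in> a" "bw c c'" using coverD[OF a(1)] by blast
    have "c \<notin> a" using c noncrossing coverD[OF a(1)] by blast
    \<comment> \<open>If \<open>b\<close> lost \<open>c\<close>, it would be the same cover of
      \<open>Y\<close> as \<open>a\<close>.\<close>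
    then have "c \<in> b" if "b \<in> B" for b using cover_unique[OF a(1) B[OF that]] c(1) na that by blast
    then have "c \<in> M" using c M unfolding F_def by blast
    then show False using a(2) c unfolding R_def by blast
  qed
  ultimately show ?thesis using M by blast
qed

text \<open>The join of \<open>B\<close> is the greatest lower bound of all its upper bounds above
  \<open>Y\<close>, taken in the whole of \<open>\<T>\<close>. One such upper bound, given by
  \<open>face_top\<close>, has no atom outside \<open>B\<close> below it, so neither has the
  join.\<close>

lemma interval_joins:
  assumes YZ: "Y \<in> \<T>" "Z \<in> \<T>" "R Y Z"
  defines "A \<equiv> {a. cover Y a \<and> R a Z}"
  shows "\<exists>j. \<forall>B\<subseteq>A. j B \<in> \<T> \<and> R Y (j B) \<and> R (j B) Z \<and> (\<forall>a\<in>A. R a (j B) \<longleftrightarrow> a \<in> B) \<and>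
    (\<forall>X\<in>\<T>. R Y X \<longrightarrow> R X Z \<longrightarrow> (\<forall>a\<in>B. R a X) \<longrightarrow> R (j B) X)"
proof -
  have "\<exists>M. M \<in> \<T> \<and> R Y M \<and> R M Z \<and> (\<forall>a\<in>A. R a M \<longleftrightarrow> a \<in> B) \<and>
    (\<forall>X\<in>\<T>. R Y X \<longrightarrow> R X Z \<longrightarrow> (\<forall>a\<in>B. R a X) \<longrightarrow> R M X)" if B: "B \<subseteq> A" for B
  proof -
    have BT: "a \<in> \<T>" if "a \<in> B" for a using that B coverD unfolding A_def by blast
    define U where "U = {X \<in> \<T>. R Y X \<and> (\<forall>a\<in>B. R a X)}"
    have ZU: "Z \<in> U" using YZ B unfolding U_def A_def by blast
    obtain M where M: "M \<in> \<T>" "\<forall>X\<in>U. R M X" "\<And>W. W \<in> \<T> \<Longrightarrow> \<forall>X\<in>U. R W X \<Longrightarrow> R W M"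
      using greatest_lower_bound[of U Y] YZ unfolding U_def by blast
    have "R Y M" "\<forall>a\<in>B. R a M" using M(3) YZ BT unfolding U_def by blast+
    obtain V where V: "V \<in> \<T>" "\<forall>a\<in>B. R a V" "\<forall>a. cover Y a \<longrightarrow> R a V \<longrightarrow> a \<in> B"
      using face_top[OF YZ(1), of B] B unfolding A_def by blast
    have "a \<in> B" if a: "a \<in> A" "R a M" for a
    \<comment> \<open>The witness of \<open>face_top\<close> is seen to be above \<open>Y\<close>
      through a member of \<open>B\<close>; for empty \<open>B\<close> the join is \<open>Y\<close>
      itself.\<close>
    proof (cases "B = {}")
      case True
      then have "R M Y" using M(2) YZ R_refl unfolding U_def by blast
      then have "R a Y" using R_trans M(1) YZ a coverD unfolding A_def by blast
      then show ?thesis using a not_R_cover unfolding A_def by blast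
    next
      case False
      then obtain b where b: "b \<in> B" by blast
      then have "R Y V" using V R_step[of Y b V] B unfolding A_def by blast
      then have "R M V" using M V unfolding U_def by blast
      then have "R a V" using R_trans[of a M V] M V a coverD unfolding A_def by blast
      then show ?thesis using V a unfolding A_def by blast
    qed
    then show ?thesis using M ZU \<open>R Y M\<close> \<open>\<forall>a\<in>B. R a M\<close> unfolding U_def by (intro exI[of _ M]) blast
  qed
  then show ?thesis by metis
qed

end

section \<open>Realizations of finite orders\<close>

locale finite_order =
  fixes P :: "'a set" and le :: "'a \<Rightarrow> 'a \<Rightarrow> bool"
  assumes finite_P: "finite P"
    and refl: "x \<in> P \<Longrightarrow> le x x"
    and trans: "x \<in> P \<Longrightarrow> y \<in> P \<Longrightarrow> z \<in> P \<Longrightarrow> le x y \<Longrightarrow> le y z \<Longrightarrow> le x z"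
    and antisym: "x \<in> P \<Longrightarrow> y \<in> P \<Longrightarrow> le x y \<Longrightarrow> le y x \<Longrightarrow> x = y"
begin

definition realization :: "('a \<Rightarrow> real) topology" where
  "realization = geometric_realization (order_complex P (\<lambda>x y. le x y \<and> x \<noteq> y))"

definition points :: "('a \<Rightarrow> real) set" where
  "points = {x. (\<forall>v. 0 \<le> x v) \<and> (\<forall>v. v \<notin> P \<longrightarrow> x v = 0) \<and> (\<Sum>v\<in>P. x v) = 1 \<and>
     (\<forall>u v. x u \<noteq> 0 \<longrightarrow> x v \<noteq> 0 \<longrightarrow> le u v \<or> le v u)}"

lemma points_eq:
  "{x. (\<forall>v. 0 \<le> x v) \<and> {v. x v \<noteq> 0} \<in> order_complex P (\<lambda>x y. le x y \<and> x \<noteq> y) \<and>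
    (\<Sum>v | x v \<noteq> 0. x v) = 1} = points"
proof -
  have "{v. x v \<noteq> 0} \<in> order_complex P (\<lambda>x y. le x y \<and> x \<noteq> y) \<longleftrightarrow>
     (\<forall>v. v \<notin> P \<longrightarrow> x v = 0) \<and> (\<forall>u v. x u \<noteq> 0 \<longrightarrow> x v \<noteq> 0 \<longrightarrow> le u v \<or> le v u)" for x :: "'a \<Rightarrow> real"
  proof -
    have "{v. x v \<noteq> 0} \<in> order_complex P (\<lambda>x y. le x y \<and> x \<noteq> y) \<longleftrightarrow>
      {v. x v \<noteq> 0} \<subseteq> P \<and> (\<forall>u v. x u \<noteq> 0 \<longrightarrow> x v \<noteq> 0 \<longrightarrow> u \<noteq> v \<longrightarrow> le u v \<or> le v u)"
      using finite_subset[OF _ finite_P, of "{v. x v \<noteq> 0}"] unfolding order_complex_def totalp_on_def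
      by auto
    moreover have "le v v" if "x v \<noteq> 0" "{v. x v \<noteq> 0} \<subseteq> P" for v
      using that refl[of v] by auto
    then have "(\<forall>u v. x u \<noteq> 0 \<longrightarrow> x v \<noteq> 0 \<longrightarrow> u \<noteq> v \<longrightarrow> le u v \<or> le v u) \<longleftrightarrow>
        (\<forall>u v. x u \<noteq> 0 \<longrightarrow> x v \<noteq> 0 \<longrightarrow> le u v \<or> le v u)" if "{v. x v \<noteq> 0} \<subseteq> P"
      using that by metis
    moreover have "{v. x v \<noteq> 0} \<subseteq> P \<longleftrightarrow> (\<forall>v. v \<notin> P \<longrightarrow> x v = 0)" by auto
    ultimately show ?thesis by argo
  qed
  moreover have "(\<Sum>v | x v \<noteq> 0. x v) = (\<Sum>v\<in>P. x v)" if "\<forall>v. v \<notin> P \<longrightarrow> x v = 0" for x :: "'a \<Rightarrow> real"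
    using that by (intro sum.mono_neutral_left) (auto simp: finite_P)
  ultimately show ?thesis unfolding points_def by auto
qed

lemma realization_eq: "realization = subtopology (powertop_real UNIV) points"
  unfolding realization_def geometric_realization_def points_eq ..

lemma topspace_realization [simp]: "topspace realization = points"
  unfolding realization_eq by simp

lemma continuous_map_into_realization:
  "continuous_map X realization g \<longleftrightarrow>
     (\<forall>v. continuous_map X euclideanreal (\<lambda>x. g x v)) \<and> (\<forall>x\<in>topspace X. g x \<in> points)"
  unfolding realization_eq continuous_map_in_subtopology continuous_map_componentwise_UNIV by (auto simp: image_subset_iff Pi_iff)

lemma continuous_map_coord: "continuous_map realization euclideanreal (\<lambda>x. x v)"
  unfolding realization_eq
  by (intro continuous_map_from_subtopology continuous_map_product_projection) simp

lemma points_nonneg: "x \<in> points \<Longrightarrow> 0 \<le> x v"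
  and points_outside: "x \<in> points \<Longrightarrow> v \<notin> P \<Longrightarrow> x v = 0"
  and points_sum: "x \<in> points \<Longrightarrow> (\<Sum>v\<in>P. x v) = 1"
  and points_chain: "x \<in> points \<Longrightarrow> x u \<noteq> 0 \<Longrightarrow> x v \<noteq> 0 \<Longrightarrow> le u v \<or> le v u"
  unfolding points_def by auto

text \<open>By \<open>chain\<close> the supports of \<open>f x\<close> and \<open>g x\<close> lie in
  a common simplex, which then contains the segment between the two points.\<close>

lemma homotopic_line:
  assumes f: "continuous_map X realization f" and g: "continuous_map X realization g"
    and chain: "\<And>x u v. x \<in> topspace X \<Longrightarrow> f x u \<noteq> 0 \<Longrightarrow> g x v \<noteq> 0 \<Longrightarrow> le u v \<or> le v u"
  shows "homotopic_with (\<lambda>_. True) X realization f g"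
proof -
  define h where "h = (\<lambda>(t::real, x) v. (1 - t) * f x v + t * g x v)"
  have fg: "f x \<in> points" "g x \<in> points" if "x \<in> topspace X" for x
    using f g that unfolding continuous_map_into_realization by auto
  have "continuous_map (prod_topology (top_of_set {0..1}) X) realization h"
    unfolding continuous_map_into_realization
  proof (intro conjI allI ballI)
    fix v
    have 1: "continuous_map (prod_topology (top_of_set {0..1}) X) euclideanreal fst"
      using continuous_map_fst[of "top_of_set {0..1::real}" X] continuous_map_into_fulltopology by blast
    have 2: "continuous_map (prod_topology (top_of_set {0..1::real}) X) euclideanreal (\<lambda>p. f (snd p) v)"
      "continuous_map (prod_topology (top_of_set {0..1::real}) X) euclideanreal (\<lambda>p. g (snd p) v)"
      using f g continuous_map_compose[OF continuous_map_snd, of X euclideanreal "\<lambda>x. f x v"]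
        continuous_map_compose[OF continuous_map_snd, of X euclideanreal "\<lambda>x. g x v"]
      unfolding continuous_map_into_realization by (auto simp: o_def)
    have "continuous_map (prod_topology (top_of_set {0..1}) X) euclideanreal
      (\<lambda>p. (1 - fst p) * f (snd p) v + fst p * g (snd p) v)"
      by (intro continuous_map_add continuous_map_real_mult continuous_map_diff 1 2) simp
    then show "continuous_map (prod_topology (top_of_set {0..1}) X) euclideanreal (\<lambda>p. h p v)"
      unfolding h_def by (simp add: case_prod_unfold)
  next
    fix p assume p: "p \<in> topspace (prod_topology (top_of_set {0..1::real}) X)"
    obtain t x where tx: "p = (t, x)" "0 \<le> t" "t \<le> 1" "x \<in> topspace X" using p by (cases p) auto
    note F = fg[OF tx(4)]
    have supp: "f x v \<noteq> 0 \<or> g x v \<noteq> 0" if "h p v \<noteq> 0" for v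
      using that unfolding h_def tx by auto
    have "(\<Sum>v\<in>P. h p v) = (1 - t) * (\<Sum>v\<in>P. f x v) + t * (\<Sum>v\<in>P. g x v)"
      unfolding h_def tx by (simp add: sum.distrib sum_distrib_left)
    moreover have "le u v \<or> le v u" if "h p u \<noteq> 0" "h p v \<noteq> 0" for u v
      using supp[OF that(1)] supp[OF that(2)] chain[OF tx(4)] points_chain[OF F(1)] points_chain[OF F(2)] by blast
    moreover have "0 \<le> h p v" for v
      unfolding h_def tx using points_nonneg[OF F(1), of v] points_nonneg[OF F(2), of v] tx by simp
    moreover have "h p v = 0" if "v \<notin> P" for v
      unfolding h_def tx using points_outside[OF F(1) that] points_outside[OF F(2) that] by simp
    ultimately show "h p \<in> points" unfolding points_def using points_sum[OF F(1)] points_sum[OF F(2)] by auto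
  qed
  moreover have "h (0, x) = f x" "h (1, x) = g x" for x unfolding h_def by auto
  ultimately show ?thesis unfolding homotopic_with_def by (intro exI[of _ h]) auto
qed

text \<open>The map induced by \<open>f\<close> on barycentric coordinates.\<close>

definition push :: "('a \<Rightarrow> 'a) \<Rightarrow> ('a \<Rightarrow> real) \<Rightarrow> 'a \<Rightarrow> real" where
  "push f x v = (\<Sum>u | u \<in> P \<and> f u = v. x u)"

definition monotone_self :: "('a \<Rightarrow> 'a) \<Rightarrow> bool" where
  "monotone_self f \<longleftrightarrow> (\<forall>x\<in>P. f x \<in> P) \<and> (\<forall>x\<in>P. \<forall>y\<in>P. le x y \<longrightarrow> le (f x) (f y))"

text \<open>The amount of the mass of \<open>x\<close> at \<open>u\<close> that lies in the lowest part of total mass \<open>s\<close>.\<close>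

definition low_mass :: "real \<Rightarrow> ('a \<Rightarrow> real) \<Rightarrow> 'a \<Rightarrow> real" where
  "low_mass s x u = min (x u) (max 0 (s - (\<Sum>w | w \<in> P \<and> le w u \<and> w \<noteq> u. x w)))"

lemma sum_push:
  assumes "\<And>u. u \<in> P \<Longrightarrow> f u \<in> P"
  shows "(\<Sum>v\<in>P. push f x v) = (\<Sum>u\<in>P. x u)"
  unfolding push_def using sum.group[OF finite_P finite_P, of f x] assms by (simp add: image_subset_iff)

lemma push_nonzero:
  assumes "push f x v \<noteq> 0"
  shows "\<exists>u\<in>P. f u = v \<and> x u \<noteq> 0"
  using assms unfolding push_def by (metis (mono_tags, lifting) mem_Collect_eq sum.neutral)

lemma mass_le_1:
  assumes "x \<in> points" "Q \<subseteq> P"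
  shows "(\<Sum>u\<in>Q. x u) \<le> 1"
  using sum_mono2[OF finite_P assms(2), of x] points_nonneg[OF assms(1)] points_sum[OF assms(1)] by simp

lemma low_mass_bounds: "x \<in> points \<Longrightarrow> 0 \<le> low_mass s x u \<and> low_mass s x u \<le> x u"
  unfolding low_mass_def using points_nonneg[of x u] by auto

lemma low_mass_0:
  assumes "x \<in> points" shows "low_mass 0 x u = 0"
proof -
  have "0 \<le> (\<Sum>w | w \<in> P \<and> le w u \<and> w \<noteq> u. x w)" using points_nonneg[OF assms] by (intro sum_nonneg)
  then show ?thesis unfolding low_mass_def using points_nonneg[OF assms, of u] by auto
qed

lemma low_mass_1:
  assumes "x \<in> points" "u \<in> P" shows "low_mass 1 x u = x u"
proof -
  have "finite {w \<in> P. le w u \<and> w \<noteq> u}" using finite_P by simp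
  then have "(\<Sum>w | w \<in> P \<and> le w u \<and> w \<noteq> u. x w) + x u = (\<Sum>w \<in> insert u {w \<in> P. le w u \<and> w \<noteq> u}. x w)"
    by simp
  also have "\<dots> \<le> 1" using assms by (intro mass_le_1) auto
  finally show ?thesis unfolding low_mass_def by auto
qed

text \<open>If \<open>v\<close> came strictly before \<open>u\<close>, the lowest part of mass
  \<open>s\<close> could reach \<open>u\<close> only after exhausting \<open>v\<close>.\<close>

lemma low_mass_order:
  assumes x: "x \<in> points" and u: "u \<in> P" "x u \<noteq> 0" "0 < low_mass s x u"
    and v: "v \<in> P" "x v \<noteq> 0" "low_mass s x v < x v"
  shows "le u v"
proof (rule ccontr)
  assume "\<not> le u v"
  then have vu: "le v u" "v \<noteq> u" using points_chain[OF x u(2) v(2)] refl u by auto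
  have sub: "insert v {w \<in> P. le w v \<and> w \<noteq> v} \<subseteq> {w \<in> P. le w u \<and> w \<noteq> u}"
    using vu v(1) u(1) trans antisym by blast
  have fin: "finite {w \<in> P. le w v \<and> w \<noteq> v}" "finite {w \<in> P. le w u \<and> w \<noteq> u}" using finite_P by auto
  have "(\<Sum>w | w \<in> P \<and> le w v \<and> w \<noteq> v. x w) + x v = (\<Sum>w \<in> insert v {w \<in> P. le w v \<and> w \<noteq> v}. x w)"
    using fin by simp
  also have "\<dots> \<le> (\<Sum>w | w \<in> P \<and> le w u \<and> w \<noteq> u. x w)"
    using sub fin points_nonneg[OF x] by (intro sum_mono2) auto
  also have "\<dots> < s" using u(3) unfolding low_mass_def by (auto simp: min_def max_def split: if_splits)
  finally have "low_mass s x v = x v" unfolding low_mass_def by auto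
  then show False using v(3) by simp
qed

lemma continuous_map_push:
  assumes "\<And>u. u \<in> P \<Longrightarrow> continuous_map X euclideanreal (\<lambda>p. F p u)"
  shows "continuous_map X euclideanreal (\<lambda>p. push f (F p) v)"
  unfolding push_def using assms finite_P by (intro continuous_map_sum) auto

text \<open>The mass is moved from \<open>g u\<close> to \<open>f u\<close> in increasing order of \<open>u\<close>, so that the support stays a chain.\<close>

lemma homotopic_push:
  assumes f: "monotone_self f" and g: "monotone_self g" and fg: "\<And>x. x \<in> P \<Longrightarrow> le (f x) (g x)"
  shows "homotopic_with (\<lambda>_. True) realization realization (push g) (push f)"
proof -
  define h where "h = (\<lambda>(s, x) v. push g (\<lambda>u. x u - low_mass s x u) v + push f (low_mass s x) v)"
  have fP: "f u \<in> P" and gP: "g u \<in> P" if "u \<in> P" for u using f g that unfolding monotone_self_def by auto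
  have f_mono: "le (f u) (f v)" and g_mono: "le (g u) (g v)" if "u \<in> P" "v \<in> P" "le u v" for u v
    using f g that unfolding monotone_self_def by auto
  let ?T = "prod_topology (top_of_set {0..1::real}) realization"
  have "continuous_map ?T realization h"
    unfolding continuous_map_into_realization
  proof (intro conjI allI ballI)
    fix v
    have 1: "continuous_map ?T euclideanreal fst"
      using continuous_map_fst[of "top_of_set {0..1::real}" realization] continuous_map_into_fulltopology by blast
    have 2: "continuous_map ?T euclideanreal (\<lambda>p. (snd p) u)" for u
      using continuous_map_compose[OF continuous_map_snd continuous_map_coord, of "top_of_set {0..1::real}" u]
      by (simp add: o_def)
    have 3: "continuous_map ?T euclideanreal (\<lambda>p. low_mass (fst p) (snd p) u)" for u
      unfolding low_mass_def using finite_P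
      by (intro continuous_map_real_min continuous_map_real_max continuous_map_diff continuous_map_sum 1 2) auto
    have "continuous_map ?T euclideanreal
      (\<lambda>p. push g (\<lambda>u. snd p u - low_mass (fst p) (snd p) u) v + push f (low_mass (fst p) (snd p)) v)"
      by (intro continuous_map_add continuous_map_push continuous_map_diff 2 3)
    then show "continuous_map ?T euclideanreal (\<lambda>p. h p v)"
      unfolding h_def by (simp add: case_prod_unfold)
  next
    fix p assume p: "p \<in> topspace ?T"
    obtain s x where sx: "p = (s, x)" "0 \<le> s" "s \<le> 1" "x \<in> points" using p by (cases p) auto
    note lm = low_mass_bounds[OF sx(4)]
    have nonneg: "0 \<le> push g (\<lambda>u. x u - low_mass s x u) v" "0 \<le> push f (low_mass s x) v" for v
      unfolding push_def using lm by (auto intro!: sum_nonneg)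
    have supp: "(\<exists>u\<in>P. v = f u \<and> 0 < low_mass s x u \<and> x u \<noteq> 0) \<or> (\<exists>u\<in>P. v = g u \<and> low_mass s x u < x u \<and> x u \<noteq> 0)"
      if hv: "h p v \<noteq> 0" for v
    proof -
      consider "push g (\<lambda>u. x u - low_mass s x u) v \<noteq> 0" | "push f (low_mass s x) v \<noteq> 0"
        using hv unfolding h_def sx by fastforce
      then show ?thesis
      proof cases
        case 1
        obtain u where "u \<in> P" "g u = v" "x u - low_mass s x u \<noteq> 0" using push_nonzero[OF 1] by auto
        moreover from this have "low_mass s x u < x u" "x u \<noteq> 0" using lm[of s u] by auto
        ultimately show ?thesis by auto
      next
        case 2
        obtain u where "u \<in> P" "f u = v" "low_mass s x u \<noteq> 0" using push_nonzero[OF 2] by auto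
        moreover from this have "0 < low_mass s x u" "x u \<noteq> 0" using lm[of s u] by auto
        ultimately show ?thesis by auto
      qed
    qed
    have "le u v \<or> le v u" if "h p u \<noteq> 0" "h p v \<noteq> 0" for u v
    proof -
      \<comment> \<open>The moved mass sits at \<open>f a\<close> for low \<open>a\<close>, the rest
        at \<open>g b\<close> for high \<open>b\<close>, and these compare through
        \<open>g a\<close>. Moving all masses at once would also require comparing
        \<open>f b\<close> with \<open>g a\<close>.\<close>
      have mixed: "le (f a) (g b)" if "a \<in> P" "0 < low_mass s x a" "x a \<noteq> 0" "b \<in> P" "low_mass s x b < x b" "x b \<noteq> 0" for a b
      proof -
        have "le (g a) (g b)" using low_mass_order[OF sx(4)] g_mono that by blast
        then show ?thesis using trans[OF fP gP gP] fg that by blast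
      qed
      show ?thesis
        using supp[OF that(1)] supp[OF that(2)]
      proof (elim disjE bexE conjE)
        fix a b assume "a \<in> P" "u = f a" "x a \<noteq> 0" "b \<in> P" "v = f b" "x b \<noteq> 0"
        then show ?thesis using points_chain[OF sx(4), of a b] f_mono by blast
      next
        fix a b assume "a \<in> P" "u = g a" "x a \<noteq> 0" "b \<in> P" "v = g b" "x b \<noteq> 0"
        then show ?thesis using points_chain[OF sx(4), of a b] g_mono by blast
      qed (use mixed in blast)+
    qed
    moreover have "0 \<le> h p v" for v unfolding h_def sx using nonneg[of v] by simp
    moreover have "h p v = 0" if "v \<notin> P" for v using supp[of v] that fP gP by blast
    moreover have "(\<Sum>v\<in>P. h p v) = (\<Sum>u\<in>P. x u - low_mass s x u) + (\<Sum>u\<in>P. low_mass s x u)"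
      unfolding h_def sx using sum_push[of g] sum_push[of f] fP gP by (simp add: sum.distrib)
    moreover have "\<dots> = 1" using points_sum[OF sx(4)] by (simp add: sum_subtractf)
    ultimately show "h p \<in> points" unfolding points_def by auto
  qed
  moreover have "h (0, x) = push g x" "h (1, x) = push f x" if "x \<in> points" for x
    using low_mass_0[OF that] low_mass_1[OF that] unfolding h_def push_def by (auto intro!: sum.cong)
  ultimately show ?thesis by (subst homotopic_with) (auto intro!: exI[of _ h])
qed

lemma push_id:
  assumes "x \<in> points"
  shows "push (\<lambda>u. u) x = x"
proof
  fix v
  have "{u \<in> P. u = v} = (if v \<in> P then {v} else {})" by auto
  then show "push (\<lambda>u. u) x v = x v" unfolding push_def using points_outside[OF assms] by simp
qed

lemma push_const:
  assumes "x \<in> points" "c \<in> P"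
  shows "push (\<lambda>_. c) x = (\<lambda>v. if v = c then 1 else 0)"
  unfolding push_def using points_sum[OF assms(1)] by (auto simp: fun_eq_iff)

lemma homotopic_id_push:
  assumes "monotone_self f" "\<And>x. x \<in> P \<Longrightarrow> le (f x) x"
  shows "homotopic_with (\<lambda>_. True) realization realization id (push f)"
proof -
  have "monotone_self (\<lambda>u. u)" unfolding monotone_self_def by simp
  then have "homotopic_with (\<lambda>_. True) realization realization (push (\<lambda>u. u)) (push f)"
    using homotopic_push assms by blast
  then show ?thesis by (rule homotopic_with_eq) (auto simp: push_id)
qed

text \<open>\<open>f\<close> lies below the identity and below the constant \<open>c\<close>, so
  both are homotopic to \<open>push f\<close>.\<close>

lemma contractible_realization:
  assumes f: "monotone_self f" "\<And>x. x \<in> P \<Longrightarrow> le (f x) x" and c: "c \<in> P" "\<And>x. x \<in> P \<Longrightarrow> le (f x) c"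
  shows "contractible_space realization"
proof -
  have m: "monotone_self (\<lambda>_. c)" unfolding monotone_self_def using c refl by simp
  have "homotopic_with (\<lambda>_. True) realization realization (push (\<lambda>_. c)) (push f)"
    using homotopic_push[OF f(1) m] c by blast
  then have "homotopic_with (\<lambda>_. True) realization realization id (push (\<lambda>_. c))"
    using homotopic_id_push[OF f] homotopic_with_trans homotopic_with_symD by metis
  then have "homotopic_with (\<lambda>_. True) realization realization id (\<lambda>_ v. if v = c then 1 else 0)"
    by (rule homotopic_with_eq) (auto simp: push_const[OF _ c(1)])
  then show ?thesis unfolding contractible_space_def by blast
qed

end

section \<open>Orders retracting to proper parts of Boolean lattices\<close>

definition proper_subsets :: "'i set \<Rightarrow> 'i set set" where
  "proper_subsets I = {B. B \<subseteq> I \<and> B \<noteq> {} \<and> B \<noteq> I}"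

text \<open>The length of the interval of thresholds \<open>t\<close> with \<open>{i \<in> I. t < w i} = B\<close>.\<close>

definition gap :: "'i set \<Rightarrow> ('i \<Rightarrow> real) \<Rightarrow> 'i set \<Rightarrow> real" where
  "gap I w B = max 0 (Min (w ` B) - Max (w ` (I - B)))"

lemma finite_proper_subsets: "finite I \<Longrightarrow> finite (proper_subsets I)"
  unfolding proper_subsets_def by (rule finite_subset[of _ "Pow I"]) auto

lemma superlevel_thresholds:
  assumes I: "finite I" and B: "B \<in> proper_subsets I"
  shows "{t. {i \<in> I. t < w i} = B} = {Max (w ` (I - B)) ..< Min (w ` B)}"
proof -
  have fin: "finite B" "finite (I - B)" "B \<noteq> {}" "I - B \<noteq> {}" "B \<subseteq> I"
    using B I finite_subset unfolding proper_subsets_def by auto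
  have "{i \<in> I. t < w i} = B \<longleftrightarrow> (\<forall>i\<in>B. t < w i) \<and> (\<forall>i\<in>I - B. w i \<le> t)" for t
    using fin(5) by (auto simp: not_less[symmetric])
  also have "\<dots> t \<longleftrightarrow> Max (w ` (I - B)) \<le> t \<and> t < Min (w ` B)" for t
    using fin by (auto simp: Min_gr_iff Max_le_iff)
  finally show ?thesis by auto
qed

text \<open>A layer-cake formula: the thresholds from the minimum up to \<open>w i\<close> are split
  according to their superlevel sets, which are the proper subsets containing \<open>i\<close>.
  Lebesgue measure adds up the lengths without sorting the values of \<open>w\<close>.\<close>

lemma sum_gap:
  assumes I: "finite I" and i: "i \<in> I"
  shows "(\<Sum>B | B \<in> proper_subsets I \<and> i \<in> B. gap I w B) = w i - Min (w ` I)"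
proof -
  let ?Q = "{B \<in> proper_subsets I. i \<in> B}"
  let ?A = "\<lambda>B. {t. {i \<in> I. t < w i} = B}"
  have fin: "finite ?Q" using finite_proper_subsets[OF I] by simp
  have eq: "?A B = {Max (w ` (I - B)) ..< Min (w ` B)}" if "B \<in> ?Q" for B
    using superlevel_thresholds[OF I] that by blast
  have meas: "measure lborel (?A B) = gap I w B" if "B \<in> ?Q" for B
    unfolding eq[OF that] gap_def by (cases "Max (w ` (I - B)) \<le> Min (w ` B)") auto
  have emeas: "emeasure lborel (?A B) \<noteq> \<infinity>" if "B \<in> ?Q" for B
    unfolding eq[OF that] by (cases "Max (w ` (I - B)) \<le> Min (w ` B)") auto
  have un: "(\<Union>B\<in>?Q. ?A B) = {Min (w ` I) ..< w i}"
  proof (intro equalityI subsetI)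
    fix t assume t: "t \<in> (\<Union>B\<in>?Q. ?A B)"
    then have "{k \<in> I. t < w k} \<in> proper_subsets I" "t < w i" by auto
    then obtain k where k: "k \<in> I" "w k \<le> t" unfolding proper_subsets_def by force
    have "Min (w ` I) \<le> w k" using k(1) I by simp
    then show "t \<in> {Min (w ` I) ..< w i}" using \<open>t < w i\<close> k(2) by simp
  next
    fix t assume t: "t \<in> {Min (w ` I) ..< w i}"
    have "Min (w ` I) \<in> w ` I" using I i by (intro Min_in) auto
    then obtain k where k: "k \<in> I" "w k = Min (w ` I)" by auto
    then have "k \<notin> {k \<in> I. t < w k}" "i \<in> {k \<in> I. t < w k}" using t i by auto
    then have "{k \<in> I. t < w k} \<in> proper_subsets I" unfolding proper_subsets_def using k(1) by blast
    then show "t \<in> (\<Union>B\<in>?Q. ?A B)" using t i by auto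
  qed
  have "(\<Sum>B\<in>?Q. gap I w B) = (\<Sum>B\<in>?Q. measure lborel (?A B))"
    using meas by (intro sum.cong) auto
  also have "\<dots> = measure lborel (\<Union>B\<in>?Q. ?A B)"
  proof (rule measure_finite_Union[symmetric, OF fin])
    show "?A ` ?Q \<subseteq> sets lborel" using eq by auto
    show "disjoint_family_on ?A ?Q" unfolding disjoint_family_on_def by auto
  qed (use emeas in auto)
  also have "\<dots> = w i - Min (w ` I)" unfolding un using I i by simp
  finally show ?thesis by simp
qed

lemma gap_pos:
  assumes I: "finite I" and B: "B \<in> proper_subsets I" and g: "gap I w B \<noteq> 0" and i: "i \<in> B" and k: "k \<in> I - B"
  shows "w k < w i"
proof -
  have "finite B" using B I finite_subset unfolding proper_subsets_def by auto
  then have "Min (w ` B) \<le> w i" "w k \<le> Max (w ` (I - B))" using I i k by auto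
  moreover have "Max (w ` (I - B)) < Min (w ` B)" using g unfolding gap_def by (auto simp: max_def split: if_splits)
  ultimately show ?thesis by simp
qed

lemma gap_nonneg: "0 \<le> gap I w B"
  unfolding gap_def by simp

text \<open>An index of maximal value belongs to every set with nonzero gap, so
  \<open>sum_gap\<close> at this index counts them all.\<close>

lemma sum_gap_all:
  assumes I: "finite I" "I \<noteq> {}"
  shows "(\<Sum>B\<in>proper_subsets I. gap I w B) = Max (w ` I) - Min (w ` I)"
proof -
  have "Max (w ` I) \<in> w ` I" using I by (intro Max_in) auto
  then obtain i where i: "i \<in> I" "w i = Max (w ` I)" by auto
  have "gap I w B = 0" if B: "B \<in> proper_subsets I" "i \<notin> B" for B
  proof (rule ccontr)
    assume g: "gap I w B \<noteq> 0"
    obtain k where k: "k \<in> B" "k \<in> I" using B(1) unfolding proper_subsets_def by blast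
    have "w i < w k" using gap_pos[OF I(1) B(1) g k(1)] i(1) B(2) by blast
    moreover have "w k \<le> Max (w ` I)" using k(2) I(1) by (intro Max_ge) auto
    ultimately show False using i(2) by linarith
  qed
  then have "(\<Sum>B\<in>proper_subsets I. gap I w B) = (\<Sum>B | B \<in> proper_subsets I \<and> i \<in> B. gap I w B)"
    using finite_proper_subsets[OF I(1)] by (intro sum.mono_neutral_right) auto
  then show ?thesis using sum_gap[OF I(1) i(1)] i(2) by simp
qed

text \<open>Sets with nonzero gap are superlevel sets of one function, hence nested.\<close>

lemma gap_chain:
  assumes "finite I" "B \<in> proper_subsets I" "B' \<in> proper_subsets I" "gap I w B \<noteq> 0" "gap I w B' \<noteq> 0"
  shows "B \<subseteq> B' \<or> B' \<subseteq> B"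
proof (rule ccontr)
  assume "\<not> (B \<subseteq> B' \<or> B' \<subseteq> B)"
  then obtain i k where ik: "i \<in> B - B'" "k \<in> B' - B" by blast
  then have "i \<in> I" "k \<in> I" using assms unfolding proper_subsets_def by auto
  then show False using gap_pos[OF assms(1,2,4), of i k] gap_pos[OF assms(1,3,5), of k i] ik by simp
qed

lemma continuous_map_Min:
  assumes "finite B" "B \<noteq> {}" "\<And>i. i \<in> B \<Longrightarrow> continuous_map X euclideanreal (\<lambda>x. f x i)"
  shows "continuous_map X euclideanreal (\<lambda>x. Min (f x ` B))"
  using assms by (induction rule: finite_ne_induct) (auto intro: continuous_map_real_min)

lemma continuous_map_Max:
  assumes "finite B" "B \<noteq> {}" "\<And>i. i \<in> B \<Longrightarrow> continuous_map X euclideanreal (\<lambda>x. f x i)"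
  shows "continuous_map X euclideanreal (\<lambda>x. Max (f x ` B))"
  using assms by (induction rule: finite_ne_induct) (auto intro: continuous_map_real_max)

lemma continuous_map_gap:
  assumes "finite I" "B \<in> proper_subsets I" "\<And>i. i \<in> I \<Longrightarrow> continuous_map X euclideanreal (\<lambda>x. f x i)"
  shows "continuous_map X euclideanreal (\<lambda>x. gap I (f x) B)"
proof -
  have "finite B" "finite (I - B)" "B \<noteq> {}" "I - B \<noteq> {}" "B \<subseteq> I"
    using assms finite_subset unfolding proper_subsets_def by auto
  then show ?thesis unfolding gap_def using assms(3)
    by (intro continuous_map_real_max continuous_map_diff continuous_map_Min continuous_map_Max) auto
qed

text \<open>Stated for an arbitrary relation, so that the reversed order yields greatest
  elements.\<close>

lemma finite_chain_least:
  assumes "finite S" "S \<noteq> {}" "\<And>x y. x \<in> S \<Longrightarrow> y \<in> S \<Longrightarrow> r x y \<or> r y x"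
    "\<And>x y z. x \<in> S \<Longrightarrow> y \<in> S \<Longrightarrow> z \<in> S \<Longrightarrow> r x y \<Longrightarrow> r y z \<Longrightarrow> r x z"
  shows "\<exists>x\<in>S. \<forall>y\<in>S. r x y"
  using assms
proof (induction rule: finite_ne_induct)
  case (singleton a)
  then have "r a a" by blast
  then show ?case by simp
next
  case (insert a F)
  then obtain x where x: "x \<in> F" "\<forall>y\<in>F. r x y" by blast
  consider "r x a" | "r a x" using insert.prems(1) x(1) by blast
  then show ?case
  proof cases
    case 2
    then have "r a y" if "y \<in> F" for y using insert.prems(2)[of a x y] x that by blast
    moreover have "r a a" using insert.prems(1) by blast
    ultimately show ?thesis by blast
  qed (use x in blast)
qed

text \<open>\<open>\<alpha> X\<close> is the set of atoms below \<open>X\<close> and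
  \<open>j B\<close> the join of \<open>B\<close>, with the \<open>p + 2\<close> atoms numbered from
  0. Then \<open>j \<circ> \<alpha>\<close> is the decreasing retraction onto the proper part of a
  Boolean lattice.\<close>

locale boolean_retract = finite_order P le
  for P :: "'a set" and le :: "'a \<Rightarrow> 'a \<Rightarrow> bool" +
  fixes p :: nat and \<alpha> :: "'a \<Rightarrow> nat set" and j :: "nat set \<Rightarrow> 'a"
  assumes \<alpha>_proper: "X \<in> P \<Longrightarrow> \<alpha> X \<in> proper_subsets {..Suc p}"
    and \<alpha>_mono: "X \<in> P \<Longrightarrow> X' \<in> P \<Longrightarrow> le X X' \<Longrightarrow> \<alpha> X \<subseteq> \<alpha> X'"
    and j_P: "B \<in> proper_subsets {..Suc p} \<Longrightarrow> j B \<in> P"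
    and \<alpha>_j: "B \<in> proper_subsets {..Suc p} \<Longrightarrow> \<alpha> (j B) = B"
    and j_mono: "B \<in> proper_subsets {..Suc p} \<Longrightarrow> B' \<in> proper_subsets {..Suc p} \<Longrightarrow> B \<subseteq> B' \<Longrightarrow> le (j B) (j B')"
    and j_\<alpha>: "X \<in> P \<Longrightarrow> le (j (\<alpha> X)) X"
begin

section \<open>The maps between the realization and the sphere\<close>

abbreviation "I \<equiv> {..Suc p}"

text \<open>The combination of the indicator vectors of the sets \<open>\<alpha> X\<close> with the
  barycentric coordinates as weights.\<close>

definition height :: "('a \<Rightarrow> real) \<Rightarrow> nat \<Rightarrow> real" where
  "height x i = (\<Sum>X | X \<in> P \<and> i \<in> \<alpha> X. x X)"

definition height_norm :: "('a \<Rightarrow> real) \<Rightarrow> real" where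
  "height_norm x = sqrt (\<Sum>i\<le>p. (height x i - height x (Suc p))\<^sup>2)"

text \<open>Vectors modulo constants are represented by making the coordinate at
  \<open>Suc p\<close> zero. This leaves \<open>p + 1\<close> coordinates, as many as
  \<open>nsphere p\<close> uses, which are scaled to Euclidean norm 1.\<close>

definition to_sphere :: "('a \<Rightarrow> real) \<Rightarrow> nat \<Rightarrow> real" where
  "to_sphere x i = (if i \<le> p then (height x i - height x (Suc p)) / height_norm x else 0)"

definition spread :: "(nat \<Rightarrow> real) \<Rightarrow> real" where
  "spread w = Max (w ` I) - Min (w ` I)"

text \<open>The join of \<open>B\<close> receives the share of thresholds whose superlevel set is
  \<open>B\<close>. A point of the sphere is zero at \<open>Suc p\<close>, so it serves directly as
  a vector on \<open>I\<close>.\<close>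

definition from_sphere :: "(nat \<Rightarrow> real) \<Rightarrow> 'a \<Rightarrow> real" where
  "from_sphere w X = (\<Sum>B | B \<in> proper_subsets I \<and> j B = X. gap I w B / spread w)"

lemma topspace_nsphere: "topspace (nsphere p) = {w. (\<Sum>i\<le>p. (w i)\<^sup>2) = 1 \<and> (\<forall>i>p. w i = 0)}"
  unfolding nsphere by simp

lemma continuous_map_into_nsphere:
  "continuous_map X (nsphere p) g \<longleftrightarrow>
     (\<forall>i. continuous_map X euclideanreal (\<lambda>x. g x i)) \<and> (\<forall>x\<in>topspace X. g x \<in> topspace (nsphere p))"
  unfolding nsphere continuous_map_in_subtopology continuous_map_componentwise_UNIV
  by (auto simp: image_subset_iff Pi_iff)

lemma continuous_map_nsphere_coord: "continuous_map (nsphere p) euclideanreal (\<lambda>w. w i)"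
  unfolding nsphere by (intro continuous_map_from_subtopology continuous_map_product_projection) simp

lemma supp_extremes:
  assumes x: "x \<in> points"
  shows "\<exists>X0\<in>P. \<exists>X1\<in>P. \<forall>X. x X \<noteq> 0 \<longrightarrow> X \<in> P \<and> le X0 X \<and> le X X1"
proof -
  let ?S = "{X. x X \<noteq> 0}"
  have sub: "?S \<subseteq> P" using points_outside[OF x] by blast
  then have fin: "finite ?S" using finite_P finite_subset by blast
  have "?S \<noteq> {}"
  proof
    assume "?S = {}"
    then have "(\<Sum>v\<in>P. x v) = 0" by simp
    then show False using points_sum[OF x] by simp
  qed
  note ne = this
  have ch: "le u v \<or> le v u" if "u \<in> ?S" "v \<in> ?S" for u v using that points_chain[OF x] by blast
  have tr: "le u z" if "u \<in> ?S" "v \<in> ?S" "z \<in> ?S" "le u v" "le v z" for u v z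
    using trans[of u v z] that sub by blast
  have "\<exists>X0\<in>?S. \<forall>y\<in>?S. le X0 y"
  proof (rule finite_chain_least[OF fin ne])
    fix u v z assume "u \<in> ?S" "v \<in> ?S" "z \<in> ?S" "le u v" "le v z"
    then show "le u z" by (rule tr)
  qed (rule ch)
  then obtain X0 where X0: "X0 \<in> ?S" "\<forall>y\<in>?S. le X0 y" by blast
  have "\<exists>X1\<in>?S. \<forall>y\<in>?S. le y X1"
  proof (rule finite_chain_least[OF fin ne])
    fix u v z assume "u \<in> ?S" "v \<in> ?S" "z \<in> ?S" "le v u" "le z v"
    then show "le z u" using tr[of z v u] by blast
  qed (rule ch)
  then obtain X1 where X1: "X1 \<in> ?S" "\<forall>y\<in>?S. le y X1" by blast
  show ?thesis using X0 X1 sub by blast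
qed

text \<open>An index in \<open>\<alpha>\<close> of the least vertex of the support is in
  \<open>\<alpha>\<close> of every vertex; an index outside \<open>\<alpha>\<close> of the greatest
  vertex is in none.\<close>

lemma height_extremes:
  assumes x: "x \<in> points"
  shows "\<exists>i\<in>I. height x i = 1" "\<exists>i\<in>I. height x i = 0"
proof -
  obtain X0 X1 where X: "X0 \<in> P" "X1 \<in> P" "\<And>X. x X \<noteq> 0 \<Longrightarrow> X \<in> P \<and> le X0 X \<and> le X X1"
    using supp_extremes[OF x] by blast
  obtain i where i: "i \<in> \<alpha> X0" using \<alpha>_proper[OF X(1)] unfolding proper_subsets_def by blast
  have "height x i = (\<Sum>v\<in>P. x v)"
    unfolding height_def using finite_P X \<alpha>_mono[OF X(1)] i by (intro sum.mono_neutral_left) blast+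
  moreover have "i \<in> I" using i \<alpha>_proper[OF X(1)] unfolding proper_subsets_def by blast
  ultimately show "\<exists>i\<in>I. height x i = 1" using points_sum[OF x] by auto
  obtain k where k: "k \<in> I" "k \<notin> \<alpha> X1" using \<alpha>_proper[OF X(2)] unfolding proper_subsets_def by blast
  have "x v = 0" if "v \<in> P" "k \<in> \<alpha> v" for v using X(3)[of v] \<alpha>_mono[OF that(1) X(2)] k that by blast
  then have "height x k = 0" unfolding height_def by (intro sum.neutral) auto
  then show "\<exists>i\<in>I. height x i = 0" using k by blast
qed

lemma height_norm_pos:
  assumes x: "x \<in> points"
  shows "height_norm x > 0"
proof (rule ccontr)
  assume "\<not> height_norm x > 0"
  then have "(\<Sum>i\<le>p. (height x i - height x (Suc p))\<^sup>2) \<le> 0" unfolding height_norm_def by simp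
  then have "(\<Sum>i\<le>p. (height x i - height x (Suc p))\<^sup>2) = 0" by (intro order.antisym sum_nonneg) auto
  then have "height x i = height x (Suc p)" if "i \<le> p" for i
    using that by (simp add: sum_nonneg_eq_0_iff)
  then have eq: "height x i = height x (Suc p)" if "i \<in> I" for i using that by (cases "i = Suc p") auto
  obtain i k where "i \<in> I" "height x i = 1" "k \<in> I" "height x k = 0"
    using height_extremes[OF x] by blast
  then show False using eq[of i] eq[of k] by simp
qed

lemma to_sphere_less_iff:
  assumes x: "x \<in> points" and "i \<in> I" "k \<in> I"
  shows "to_sphere x i < to_sphere x k \<longleftrightarrow> height x i < height x k"
proof -
  have *: "to_sphere x i = (height x i - height x (Suc p)) / height_norm x" if "i \<in> I" for i
    using that unfolding to_sphere_def by (cases "i = Suc p") auto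
  show ?thesis unfolding *[OF assms(2)] *[OF assms(3)] using height_norm_pos[OF x]
    by (simp add: divide_less_cancel)
qed

lemma continuous_map_to_sphere: "continuous_map realization (nsphere p) to_sphere"
  unfolding continuous_map_into_nsphere
proof (intro conjI allI ballI)
  have h: "continuous_map realization euclideanreal (\<lambda>x. height x i)" for i
    unfolding height_def using finite_P by (intro continuous_map_sum continuous_map_coord) auto
  show "continuous_map realization euclideanreal (\<lambda>x. to_sphere x i)" for i
  proof (cases "i \<le> p")
    case True
    then show ?thesis unfolding to_sphere_def height_norm_def
      using height_norm_pos unfolding height_norm_def
      by (auto intro!: continuous_map_real_divide continuous_map_sqrt continuous_map_sum continuous_map_real_pow
        continuous_map_diff h) (metis less_irrefl)
  qed (simp add: to_sphere_def)
  fix x assume "x \<in> topspace realization"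
  then have pos: "height_norm x > 0" using height_norm_pos by simp
  have "(\<Sum>i\<le>p. (to_sphere x i)\<^sup>2) = (\<Sum>i\<le>p. (height x i - height x (Suc p))\<^sup>2) / (height_norm x)\<^sup>2"
    unfolding to_sphere_def sum_divide_distrib by (intro sum.cong) (auto simp: power_divide)
  also have "(\<Sum>i\<le>p. (height x i - height x (Suc p))\<^sup>2) = (height_norm x)\<^sup>2"
    unfolding height_norm_def by (simp add: sum_nonneg)
  finally have "(\<Sum>i\<le>p. (to_sphere x i)\<^sup>2) = 1" using pos by simp
  then show "to_sphere x \<in> topspace (nsphere p)" unfolding topspace_nsphere by (simp add: to_sphere_def)
qed

lemma spread_pos:
  assumes w: "w \<in> topspace (nsphere p)"
  shows "spread w > 0"
proof (rule ccontr)
  assume s: "\<not> spread w > 0"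
  have "w i = 0" if "i \<in> I" for i
  proof -
    have "w i \<le> Max (w ` I)" "Min (w ` I) \<le> w i" "w (Suc p) \<le> Max (w ` I)" "Min (w ` I) \<le> w (Suc p)" using that by auto
    then have "w i = w (Suc p)" using s unfolding spread_def by linarith
    then show ?thesis using w unfolding topspace_nsphere by simp
  qed
  then have "(\<Sum>i\<le>p. (w i)\<^sup>2) = 0" by simp
  then show False using w unfolding topspace_nsphere by simp
qed

lemma from_sphere_nonzero:
  assumes "from_sphere w X \<noteq> 0"
  shows "\<exists>B\<in>proper_subsets I. j B = X \<and> gap I w B \<noteq> 0"
proof (rule ccontr)
  assume "\<not> (\<exists>B\<in>proper_subsets I. j B = X \<and> gap I w B \<noteq> 0)"
  then have "from_sphere w X = 0" unfolding from_sphere_def by (intro sum.neutral) auto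
  then show False using assms by simp
qed

text \<open>Since \<open>\<alpha>\<close> undoes \<open>j\<close>, a condition on
  \<open>\<alpha> X\<close> becomes one on \<open>B\<close>. This serves both the total mass and the
  heights.\<close>

lemma sum_from_sphere:
  "(\<Sum>X | X \<in> P \<and> Q (\<alpha> X). from_sphere w X) = (\<Sum>B | B \<in> proper_subsets I \<and> Q B. gap I w B) / spread w"
proof -
  have fin: "finite (proper_subsets I)" by (rule finite_proper_subsets) simp
  have "(\<Sum>X | X \<in> P \<and> Q (\<alpha> X). from_sphere w X) =
     (\<Sum>X | X \<in> P \<and> Q (\<alpha> X). \<Sum>B | B \<in> {B \<in> proper_subsets I. Q B} \<and> j B = X. gap I w B / spread w)"
    unfolding from_sphere_def using \<alpha>_j by (intro sum.cong refl) auto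
  also have "\<dots> = (\<Sum>B | B \<in> proper_subsets I \<and> Q B. gap I w B / spread w)"
    using fin finite_P j_P \<alpha>_j by (intro sum.group) auto
  finally show ?thesis by (simp add: sum_divide_distrib)
qed

lemma continuous_map_from_sphere: "continuous_map (nsphere p) realization from_sphere"
  unfolding continuous_map_into_realization
proof (intro conjI allI ballI)
  have "continuous_map (nsphere p) euclideanreal spread"
    unfolding spread_def by (intro continuous_map_diff continuous_map_Min continuous_map_Max continuous_map_nsphere_coord) auto
  then show "continuous_map (nsphere p) euclideanreal (\<lambda>w. from_sphere w X)" for X
    unfolding from_sphere_def using spread_pos finite_proper_subsets[of I]
    by (intro continuous_map_sum continuous_map_real_divide continuous_map_gap continuous_map_nsphere_coord) force+
  fix w assume w: "w \<in> topspace (nsphere p)"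
  have sp: "spread w > 0" by (rule spread_pos[OF w])
  have "0 \<le> from_sphere w X" for X
    unfolding from_sphere_def using gap_nonneg sp by (intro sum_nonneg divide_nonneg_pos) auto
  moreover have "from_sphere w X = 0" if "X \<notin> P" for X using from_sphere_nonzero j_P that by blast
  moreover have "(\<Sum>X\<in>P. from_sphere w X) = 1"
    using sum_from_sphere[where Q = "\<lambda>_. True" and w = w] sum_gap_all[of I w] sp unfolding spread_def by simp
  moreover have "le X X' \<or> le X' X" if "from_sphere w X \<noteq> 0" "from_sphere w X' \<noteq> 0" for X X'
    using from_sphere_nonzero[OF that(1)] from_sphere_nonzero[OF that(2)] gap_chain[of I _ _ w] j_mono by (metis finite_atMost)
  ultimately show "from_sphere w \<in> points" unfolding points_def by auto
qed

text \<open>By \<open>sum_gap\<close> the heights of \<open>from_sphere w\<close> are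
  \<open>w\<close>, shifted by its minimum and divided by its spread; \<open>to_sphere\<close>
  undoes the shift and the scaling.\<close>

lemma to_sphere_from_sphere:
  assumes w: "w \<in> topspace (nsphere p)"
  shows "to_sphere (from_sphere w) = w"
proof -
  have sp: "spread w > 0" by (rule spread_pos[OF w])
  have h: "height (from_sphere w) i = (w i - Min (w ` I)) / spread w" if "i \<in> I" for i
    unfolding height_def sum_from_sphere[where Q = "\<lambda>B. i \<in> B"] using sum_gap[of I i w] that by simp
  have w0: "w i = 0" if "i > p" for i using w that unfolding topspace_nsphere by auto
  have d: "height (from_sphere w) i - height (from_sphere w) (Suc p) = w i / spread w" if "i \<le> p" for i
  proof -
    have "i \<in> I" "Suc p \<in> I" using that by auto
    then show ?thesis unfolding h[OF \<open>i \<in> I\<close>] h[OF \<open>Suc p \<in> I\<close>] diff_divide_distrib using w0[of "Suc p"] by simp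
  qed
  have "(\<Sum>i\<le>p. (w i / spread w)\<^sup>2) = (1 / spread w)\<^sup>2"
    using w unfolding topspace_nsphere by (simp add: power_divide sum_divide_distrib[symmetric])
  then have "height_norm (from_sphere w) = 1 / spread w"
    unfolding height_norm_def using d sp by (simp add: real_sqrt_divide)
  then show ?thesis using d sp w0 by (auto simp: fun_eq_iff to_sphere_def)
qed

text \<open>Superlevel sets of the heights come from the support of \<open>x\<close>: with
  \<open>i0\<close> of least height in \<open>B\<close>, the least vertex of the support whose set
  contains \<open>i0\<close> has exactly the set \<open>B\<close>.\<close>

lemma gap_to_sphere:
  assumes x: "x \<in> points" and B: "B \<in> proper_subsets I" and g: "gap I (to_sphere x) B \<noteq> 0"
  shows "\<exists>X. x X \<noteq> 0 \<and> \<alpha> X = B"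
proof -
  have finB: "finite B" "B \<noteq> {}" "B \<subseteq> I" "I - B \<noteq> {}" using B finite_subset unfolding proper_subsets_def by auto
  have less: "height x k < height x i" if "i \<in> B" "k \<in> I - B" for i k
    using gap_pos[OF _ B g that] to_sphere_less_iff[OF x] that finB by auto
  have "Min (height x ` B) \<in> height x ` B" using finB by (intro Min_in) auto
  then obtain i0 where i0: "i0 \<in> B" "height x i0 = Min (height x ` B)" by auto
  have min: "height x i0 \<le> height x i" if "i \<in> B" for i using that finB i0(2) by simp
  let ?S = "{X. x X \<noteq> 0 \<and> i0 \<in> \<alpha> X}"
  have sub: "?S \<subseteq> P" using points_outside[OF x] by blast
  then have fin: "finite ?S" using finite_P finite_subset by blast
  have nonneg: "0 \<le> height x k" for k unfolding height_def using points_nonneg[OF x] by (intro sum_nonneg)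
  have ne: "?S \<noteq> {}"
  proof
    assume "?S = {}"
    then have "height x i0 = 0" unfolding height_def by (intro sum.neutral) auto
    then show False using less[OF i0(1)] finB(4) nonneg by (metis all_not_in_conv not_less)
  qed
  have ch: "le u v \<or> le v u" if "u \<in> ?S" "v \<in> ?S" for u v using that points_chain[OF x] by blast
  have tr: "le u z" if "u \<in> ?S" "v \<in> ?S" "z \<in> ?S" "le u v" "le v z" for u v z
    using trans[of u v z] that sub by blast
  have "\<exists>X\<in>?S. \<forall>y\<in>?S. le X y"
  proof (rule finite_chain_least[OF fin ne])
    fix u v z assume "u \<in> ?S" "v \<in> ?S" "z \<in> ?S" "le u v" "le v z"
    then show "le u z" by (rule tr)
  qed (rule ch)
  then obtain X where X: "X \<in> ?S" "\<forall>y\<in>?S. le X y" by blast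
  have XP: "X \<in> P" using X sub by blast
  have supp_height: "height x i = (\<Sum>Y | Y \<in> P \<and> x Y \<noteq> 0 \<and> i \<in> \<alpha> Y. x Y)" for i
    unfolding height_def using finite_P by (intro sum.mono_neutral_right) auto
  have "\<alpha> X = B"
  proof (intro equalityI subsetI)
    fix i assume i: "i \<in> \<alpha> X"
    \<comment> \<open>Every vertex counted at \<open>i0\<close> is above \<open>X\<close> and hence
      counted at \<open>i\<close>. Then \<open>i\<close> is as high as \<open>i0\<close> and cannot
      lie outside \<open>B\<close>.\<close>
    have "height x i0 \<le> height x i" unfolding supp_height
    proof (rule sum_mono2)
      show "{Y \<in> P. x Y \<noteq> 0 \<and> i0 \<in> \<alpha> Y} \<subseteq> {Y \<in> P. x Y \<noteq> 0 \<and> i \<in> \<alpha> Y}"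
        using X \<alpha>_mono[OF XP] i by blast
    qed (use finite_P points_nonneg[OF x] in auto)
    moreover have "i \<in> I" using i \<alpha>_proper[OF XP] unfolding proper_subsets_def by blast
    ultimately show "i \<in> B" using less[OF i0(1), of i] by force
  next
    fix i assume i: "i \<in> B"
    show "i \<in> \<alpha> X"
    proof (rule ccontr)
      assume ni: "i \<notin> \<alpha> X"
      have above: "le X Y \<and> Y \<noteq> X" if "Y \<in> P" "x Y \<noteq> 0" "i \<in> \<alpha> Y" for Y
        using points_chain[OF x, of X Y] that X(1) \<alpha>_mono[OF that(1) XP] ni by blast
      \<comment> \<open>Vertices counted at \<open>i\<close> are above \<open>X\<close>, hence
        counted at \<open>i0\<close>, where \<open>X\<close> is counted as well. This would make
        \<open>i0\<close> strictly higher than \<open>i\<close>, against its choice.\<close>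
      have "height x i + x X = (\<Sum>Y\<in>insert X {Y \<in> P. x Y \<noteq> 0 \<and> i \<in> \<alpha> Y}. x Y)"
        unfolding supp_height[of i] using finite_P ni by simp
      also have "\<dots> \<le> height x i0" unfolding supp_height[of i0]
      proof (rule sum_mono2)
        show "insert X {Y \<in> P. x Y \<noteq> 0 \<and> i \<in> \<alpha> Y} \<subseteq> {Y \<in> P. x Y \<noteq> 0 \<and> i0 \<in> \<alpha> Y}"
          using above \<alpha>_mono[OF XP] X(1) XP by blast
      qed (use finite_P points_nonneg[OF x] in auto)
      finally show False using min[OF i] X(1) points_nonneg[OF x, of X] by force
    qed
  qed
  then show ?thesis using X by blast
qed

text \<open>The composition \<open>from_sphere \<circ> to_sphere\<close> need not be computed: like
  the retraction by \<open>j \<circ> \<alpha>\<close>, it sends \<open>x\<close> to a point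
  supported on the chain of all \<open>j (\<alpha> X)\<close> with \<open>X\<close> in the support
  of \<open>x\<close>, so segments join the two maps.\<close>

theorem realization_homotopy_sphere: "realization homotopy_equivalent_space nsphere p"
proof -
  have m: "monotone_self (\<lambda>X. j (\<alpha> X))"
    unfolding monotone_self_def using \<alpha>_proper j_P j_mono \<alpha>_mono by blast
  have c: "continuous_map realization realization (push (\<lambda>X. j (\<alpha> X)))"
    using homotopic_with_imp_continuous_maps[OF homotopic_id_push[OF m j_\<alpha>]] by blast
  have c2: "continuous_map realization realization (from_sphere \<circ> to_sphere)"
    using continuous_map_compose continuous_map_to_sphere continuous_map_from_sphere by blast
  have "homotopic_with (\<lambda>_. True) realization realization (push (\<lambda>X. j (\<alpha> X))) (from_sphere \<circ> to_sphere)"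
  proof (rule homotopic_line[OF c c2])
    fix x u v assume x: "x \<in> topspace realization" and u: "push (\<lambda>X. j (\<alpha> X)) x u \<noteq> 0"
      and v: "(from_sphere \<circ> to_sphere) x v \<noteq> 0"
    have xp: "x \<in> points" using x by simp
    obtain X where X: "X \<in> P" "j (\<alpha> X) = u" "x X \<noteq> 0" using push_nonzero[OF u] by blast
    obtain B where B: "B \<in> proper_subsets I" "j B = v" "gap I (to_sphere x) B \<noteq> 0"
      using from_sphere_nonzero[of "to_sphere x" v] v by auto
    obtain Y where Y: "x Y \<noteq> 0" "\<alpha> Y = B" using gap_to_sphere[OF xp B(1,3)] by blast
    have YP: "Y \<in> P" using Y(1) points_outside[OF xp] by blast
    show "le u v \<or> le v u"
      using points_chain[OF xp X(3) Y(1)] m X(1) YP Y(2) X(2) B(2) unfolding monotone_self_def by blast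
  qed
  then have "homotopic_with (\<lambda>_. True) realization realization (from_sphere \<circ> to_sphere) id"
    using homotopic_id_push[OF m j_\<alpha>] homotopic_with_trans homotopic_with_symD by metis
  moreover have "homotopic_with (\<lambda>_. True) (nsphere p) (nsphere p) (to_sphere \<circ> from_sphere) id"
    using continuous_map_compose[OF continuous_map_from_sphere continuous_map_to_sphere] to_sphere_from_sphere
    by (intro homotopic_with_equal) auto
  ultimately show ?thesis
    unfolding homotopy_equivalent_space_def using continuous_map_to_sphere continuous_map_from_sphere by blast
qed

end

section \<open>Intervals\<close>

lemma (in flip_poset) finite_order_R:
  assumes "P \<subseteq> \<T>"
  shows "finite_order P R"
proof
  show "finite P" using finite_subset[OF assms finite_\<T>] .
  fix x assume x: "x \<in> P"
  then have xT: "x \<in> \<T>" using assms by blast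
  then show "R x x" by (rule R_refl)
  fix y assume "y \<in> P"
  then have yT: "y \<in> \<T>" using assms by blast
  show "R x y \<Longrightarrow> R y x \<Longrightarrow> x = y" using R_antisym[OF xT yT] .
  fix z assume "z \<in> P"
  then have "z \<in> \<T>" using assms by blast
  then show "R x y \<Longrightarrow> R y z \<Longrightarrow> R x z" using R_trans[OF xT yT] by blast
qed

lemma (in flip_poset) interval_homotopy_type:
  assumes YZ: "Y \<in> \<T>" "Z \<in> \<T>" "R Y Z" "Y \<noteq> Z"
  defines "P \<equiv> {X \<in> \<T>. R Y X \<and> R X Z \<and> X \<noteq> Y \<and> X \<noteq> Z}"
  shows "contractible_space (finite_order.realization P R) \<or> finite_order.realization P R = trivial_topology \<or>
    (\<exists>p. finite_order.realization P R homotopy_equivalent_space nsphere p)"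
proof -
  have PT: "X \<in> \<T>" if "X \<in> P" for X using that unfolding P_def by blast
  interpret O: finite_order P R
    by (rule finite_order_R) (use PT in blast)
  define A where "A = {a. cover Y a \<and> R a Z}"
  have AT: "a \<in> \<T>" if "a \<in> A" for a using that coverD unfolding A_def by blast
  have finA: "finite A" using finite_subset[of A \<T>] AT finite_\<T> by blast
  obtain j where j: "\<And>B. B \<subseteq> A \<Longrightarrow> j B \<in> \<T> \<and> R Y (j B) \<and> R (j B) Z \<and> (\<forall>a\<in>A. R a (j B) \<longleftrightarrow> a \<in> B) \<and>
    (\<forall>X\<in>\<T>. R Y X \<longrightarrow> R X Z \<longrightarrow> (\<forall>a\<in>B. R a X) \<longrightarrow> R (j B) X)"
    using interval_joins[OF YZ(1-3)] unfolding A_def by blast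
  have j_neq_Y: "j B \<noteq> Y" if B: "B \<subseteq> A" "B \<noteq> {}" for B
  proof -
    obtain a where "a \<in> B" using B by blast
    then have "R a (j B)" "\<not> R a Y" using j[OF B(1)] B(1) not_R_cover[of Y a] unfolding A_def by auto
    then show ?thesis by auto
  qed
  have j_mono: "R (j B) (j B')" if "B \<subseteq> B'" "B' \<subseteq> A" for B B'
    using j[of B] j[of B'] that by blast
  have j_le: "R (j B) X" if "B \<subseteq> A" "X \<in> P" "\<forall>a\<in>B. R a X" for B X
    using j[OF that(1)] that unfolding P_def by blast
  have below_ne: "\<exists>a\<in>A. R a X" if X: "X \<in> P" for X
  proof -
    obtain a where a: "cover Y a" "R a X" using R_cover_exists[OF YZ(1), of X] X unfolding P_def by blast
    have "a \<in> \<T>" using coverD[OF a(1)] by blast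
    then have "R a Z" using R_trans[of a X Z] a(2) X YZ(2) unfolding P_def by blast
    then show ?thesis using a unfolding A_def by blast
  qed
  have j_in_P: "j B \<in> P" if "B \<subseteq> A" "B \<noteq> {}" "j B \<noteq> Z" for B
    using j[OF that(1)] j_neq_Y that unfolding P_def by blast
  have j_below_in_P: "j {a \<in> A. R a X} \<in> P" if X: "X \<in> P" for X
  proof (rule j_in_P)
    show "{a \<in> A. R a X} \<noteq> {}" using below_ne[OF X] by blast
    have "R (j {a \<in> A. R a X}) X" by (rule j_le) (use X in auto)
    moreover have "X \<in> \<T>" "R X Z" "X \<noteq> Z" using X unfolding P_def by auto
    ultimately show "j {a \<in> A. R a X} \<noteq> Z" using R_antisym YZ(2) by blast
  qed blast
  have "A \<noteq> {}" using R_cover_exists[OF YZ] unfolding A_def by blast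
  show ?thesis
  proof (cases "j A = Z")
    case False
    then have c: "j A \<in> P" using j_in_P \<open>A \<noteq> {}\<close> by blast
    have "O.monotone_self (\<lambda>X. j {a \<in> A. R a X})"
      unfolding O.monotone_self_def
    proof (intro conjI ballI impI)
      fix X X' assume X: "X \<in> P" "X' \<in> P" "R X X'"
      have "{a \<in> A. R a X} \<subseteq> {a \<in> A. R a X'}" using X AT PT R_trans by blast
      then show "R (j {a \<in> A. R a X}) (j {a \<in> A. R a X'})" by (intro j_mono) auto
    qed (use j_below_in_P in blast)
    then have "contractible_space O.realization"
    proof (rule O.contractible_realization[OF _ _ c])
      show "R (j {a \<in> A. R a X}) X" if "X \<in> P" for X by (rule j_le) (use that in auto)
      show "R (j {a \<in> A. R a X}) (j A)" if "X \<in> P" for X by (rule j_mono) auto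
    qed
    then show ?thesis by blast
  next
    case True
    have not_all: "\<exists>a\<in>A. \<not> R a X" if X: "X \<in> P" for X
    proof (rule ccontr)
      assume "\<not> (\<exists>a\<in>A. \<not> R a X)"
      then have "R Z X" using j_le[of A X] X True by blast
      then show False using X R_antisym YZ(2) unfolding P_def by blast
    qed
    show ?thesis
    proof (cases "card A = 1")
      \<comment> \<open>Everything strictly between \<open>Y\<close> and \<open>Z\<close> would lie
        above the only atom, hence above its join \<open>Z\<close>. So the open interval is empty,
        which is the sphere of dimension -1.\<close>
      case True
      then obtain a where "A = {a}" by (auto simp: card_1_singleton_iff)
      then have "P = {}" using not_all below_ne by blast
      then have "topspace O.realization = {}" unfolding O.topspace_realization O.points_def by simp
      then have "O.realization = trivial_topology" unfolding null_topspace_iff_trivial .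
      then show ?thesis by blast
    next
      case False
      \<comment> \<open>The truncated subtraction is exact, as \<open>card A\<close> is neither 0
        nor 1.\<close>
      define p where "p = card A - 2"
      have "card A \<noteq> 0" using finA \<open>A \<noteq> {}\<close> by simp
      then have cA: "card A = Suc (Suc p)" using False unfolding p_def by simp
      obtain \<phi> where "bij_betw \<phi> {0..<card A} A" using ex_bij_betw_nat_finite[OF finA] by blast
      moreover have "{0..<card A} = {..Suc p}" unfolding cA by auto
      ultimately have \<phi>: "bij_betw \<phi> {..Suc p} A" by simp
      have \<phi>A: "\<phi> i \<in> A" if "i \<le> Suc p" for i using \<phi> that unfolding bij_betw_def by auto
      have \<phi>_surj: "\<exists>i\<le>Suc p. \<phi> i = a" if "a \<in> A" for a using \<phi> that unfolding bij_betw_def by auto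
      have \<phi>_mem: "\<phi> i \<in> \<phi> ` B \<longleftrightarrow> i \<in> B" if "i \<le> Suc p" "B \<subseteq> {..Suc p}" for i B
        using \<phi> that unfolding bij_betw_def by (auto dest: inj_onD)
      have \<phi>_sub: "\<phi> ` B \<subseteq> A" if "B \<subseteq> {..Suc p}" for B using \<phi>A that by auto
      interpret boolean_retract P R p "\<lambda>X. {i \<in> {..Suc p}. R (\<phi> i) X}" "\<lambda>B. j (\<phi> ` B)"
      proof
        show "{i \<in> {..Suc p}. R (\<phi> i) X} \<in> proper_subsets {..Suc p}" if X: "X \<in> P" for X
        proof -
          obtain i where "i \<le> Suc p" "R (\<phi> i) X" using below_ne[OF X] \<phi>_surj by blast
          moreover obtain k where "k \<le> Suc p" "\<not> R (\<phi> k) X" using not_all[OF X] \<phi>_surj by blast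
          ultimately show ?thesis unfolding proper_subsets_def by blast
        qed
        show "{i \<in> {..Suc p}. R (\<phi> i) X} \<subseteq> {i \<in> {..Suc p}. R (\<phi> i) X'}" if "X \<in> P" "X' \<in> P" "R X X'" for X X'
          using that AT[OF \<phi>A] PT R_trans by blast
        show "j (\<phi> ` B) \<in> P" if B: "B \<in> proper_subsets {..Suc p}" for B
        proof (rule j_in_P)
          have B': "B \<subseteq> {..Suc p}" "B \<noteq> {}" using B unfolding proper_subsets_def by auto
          show sub: "\<phi> ` B \<subseteq> A" "\<phi> ` B \<noteq> {}" using \<phi>_sub B' by auto
          obtain i where i: "i \<le> Suc p" "i \<notin> B" using B unfolding proper_subsets_def by blast
          then have "\<not> R (\<phi> i) (j (\<phi> ` B))" using j[OF sub(1)] \<phi>A \<phi>_mem[OF i(1) B'(1)] by blast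
          moreover have "R (\<phi> i) Z" using \<phi>A[OF i(1)] unfolding A_def by blast
          ultimately show "j (\<phi> ` B) \<noteq> Z" by metis
        qed
        show "{i \<in> {..Suc p}. R (\<phi> i) (j (\<phi> ` B))} = B" if "B \<in> proper_subsets {..Suc p}" for B
        proof -
          have B': "B \<subseteq> {..Suc p}" using that unfolding proper_subsets_def by blast
          have "R (\<phi> i) (j (\<phi> ` B)) \<longleftrightarrow> i \<in> B" if "i \<le> Suc p" for i
            using j[OF \<phi>_sub[OF B']] \<phi>A[OF that] \<phi>_mem[OF that B'] by blast
          then show ?thesis using B' by auto
        qed
        show "R (j (\<phi> ` B)) (j (\<phi> ` B'))"
          if "B \<in> proper_subsets {..Suc p}" "B' \<in> proper_subsets {..Suc p}" "B \<subseteq> B'" for B B'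
        proof (rule j_mono)
          show "\<phi> ` B \<subseteq> \<phi> ` B'" using that(3) by blast
          show "\<phi> ` B' \<subseteq> A" using \<phi>_sub that(2) unfolding proper_subsets_def by blast
        qed
        show "R (j (\<phi> ` {i \<in> {..Suc p}. R (\<phi> i) X})) X" if "X \<in> P" for X
          by (rule j_le[OF \<phi>_sub that]) auto
      qed
      show ?thesis using realization_homotopy_sphere by blast
    qed
  qed
qed

section \<open>The Tamari lattice\<close>

lemma below_edge_mem:
  assumes "edges n S x y" "below_chord m u v x y" "1 \<le> u" "v \<le> 2 * (n + 1)"
  shows "{vx n x, vx n y} \<in> S"
proof -
  have "u < v" using assms(2) unfolding below_chord_def by simp
  then show ?thesis
    using assms edges_chord[OF assms(1), of v u] edges_chord[OF assms(1), of u v] unfolding below_chord_def by auto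
qed

lemma tamari_coverD:
  assumes n: "n \<ge> 1" and c: "tamari_cover n S T"
  shows "\<exists>C D. C \<in> S \<and> T = S - {C, half_turn ` C} \<union> {D, half_turn ` D} \<and> bw n C D \<and>
    (\<forall>E. bw n E C \<longrightarrow> (\<exists>F\<in>T. bw n E F))"
proof -
  obtain C where S: "S \<in> typeB_triangulations n" "T \<in> typeB_triangulations n" and C: "C \<in> S" "green n S C"
    and T: "T = (S - {C, half_turn ` C}) \<union> {other_diagonal n S C, other_diagonal n S (half_turn ` C)}"
    using c unfolding tamari_cover_def by blast
  obtain a b k l where ab: "C = {vx n a, vx n b}" and q: "quad_at (edges n S) a b k l"
    using chord_quad[OF n _ C(1)] S(1) unfolding typeB_triangulations_def by blast
  define D where "D = {vx n k, vx n l}"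
  have T': "T = S - {C, half_turn ` C} \<union> {D, half_turn ` D}"
    using T typeB_flip(2,3)[OF n S(1) q ab D_def] by simp
  have g: "below_chord (n + 1) a b (min k l) (max k l)"
    using C(2) green_iff_below[OF typeB_polyg[OF S(1) n] q] unfolding ab by simp
  note r = quad_at_range[OF q]
  have "\<exists>F\<in>T. bw n E F" if E: "bw n E C" for E
  proof -
    obtain u v a' b' where uv: "E = {vx n u, vx n v}" "{vx n a, vx n b} = {vx n a', vx n b'}" "below_chord (n + 1) u v a' b'"
      "1 \<le> u" "v \<le> 2 * (n + 1)" using E unfolding bw_def ab by blast
    have "{a, b} = {a', b'}" using uv(2) by (simp only: pair_vx_eq_iff)
    moreover have "a' < b'" using uv(3) unfolding below_chord_def by simp
    ultimately have "a' = a" "b' = b" using r(9,10) by (auto simp: doubleton_eq_iff)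
    then have "below_chord (n + 1) u v a b" using uv by simp
    then have "below_chord (n + 1) u v a k \<or> below_chord (n + 1) u v l b \<or> below_chord (n + 1) u v b l"
      using below_diagonal_imp_below_side[OF r(9-11) g] by blast
    moreover have "edges n S a k" "edges n S l b" "edges n S b l"
      using q edges_sym[of n S l b] unfolding quad_at_def by auto
    \<comment> \<open>This side shares exactly one endpoint with \<open>C\<close>. So it is not
      \<open>C\<close> and, by \<open>half_turn_disjoint\<close>, not its partner either, and the
      flip keeps it.\<close>
    ultimately obtain x y where xy: "edges n S x y" "below_chord (n + 1) u v x y" "x \<in> {a, b} \<or> y \<in> {a, b}"
      "\<not> (x \<in> {a, b} \<and> y \<in> {a, b})" using r(9-11) by fastforce
    define F where "F = {vx n x, vx n y}"
    have FS: "F \<in> S" unfolding F_def by (rule below_edge_mem[OF xy(1,2) uv(4,5)])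
    have FC: "F \<noteq> C"
    proof
      assume "F = C"
      then have "vx n x \<in> {vx n a, vx n b}" "vx n y \<in> {vx n a, vx n b}" unfolding F_def ab by blast+
      then show False using xy(4) by (auto simp: vx_eq_iff)
    qed
    have "F \<inter> C \<noteq> {}" using xy(3) unfolding F_def ab by auto
    then have "F \<noteq> half_turn ` C" using FC half_turn_disjoint unfolding ab by metis
    then have "F \<in> T" using FS FC T' by blast
    moreover have "bw n E F"
      unfolding uv(1) F_def using bwI[OF xy(2) uv(4)] uv(5) xy(1) unfolding edges_def by blast
    ultimately show ?thesis by blast
  qed
  moreover have "bw n C D" unfolding ab D_def using bw_new_diagonal[OF q] g by simp
  ultimately show ?thesis using C(1) T' by (intro exI[of _ C] exI[of _ D] conjI) simp_all
qed

lemma tamari_cover_exists: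
  assumes n: "n \<ge> 1" and S: "S \<in> typeB_triangulations n" "C0 \<in> S" and w: "bw n C0 w"
  shows "\<exists>T C D. tamari_cover n S T \<and> C \<in> S \<and> T = S - {C, half_turn ` C} \<union> {D, half_turn ` D} \<and> bw n C D \<and>
    (\<forall>E. bw n E D \<longrightarrow> (\<exists>F\<in>S. bw n E F) \<or> bw n E w \<or> bw n E (half_turn ` w))"
proof -
  obtain a b c d where h: "1 \<le> c" "d \<le> 2 * (n + 1)" "1 \<le> a" "b \<le> 2 * (n + 1)"
     "C0 = {vx n c, vx n d}" "w = {vx n a, vx n b}" and cd: "below_chord (n + 1) c d a b"
    using w unfolding bw_def by blast
  have lt: "c < d" "a < b" using cd unfolding below_chord_def by auto
  have e0: "edges n S c d" using h S(2) lt unfolding edges_def by auto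
  \<comment> \<open>\<open>G\<close> means being below \<open>w\<close> or below its half-turn; the
    ends of the latter form an unordered pair because the half-turn may reverse them.\<close>
  define G where "G u v \<longleftrightarrow> below_chord (n + 1) u v a b \<or>
    (\<exists>a' b'. {a', b'} = {antipode (n + 1) a, antipode (n + 1) b} \<and> below_chord (n + 1) u v a' b')" for u v
  obtain x y k l where "up_flip (n + 1) (edges n S) G x y k l"
    using up_flip_exists[OF typeB_polyg[OF S(1) n] typeB_apexes[OF S(1) n] typeB_antipode[OF S(1) n] h(3,4) e0 cd, of G]
    unfolding G_def by blast
  then have q: "quad_at (edges n S) x y k l" and g: "below_chord (n + 1) x y (min k l) (max k l)"
    and gen: "\<And>u v. below_chord (n + 1) u v (min k l) (max k l) \<Longrightarrow>
      (\<exists>p q. edges n S p q \<and> below_chord (n + 1) u v p q) \<or> G u v"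
    unfolding up_flip_def by blast+
  note r = quad_at_range[OF q]
  define C where "C = {vx n x, vx n y}"
  define D where "D = {vx n k, vx n l}"
  define T where "T = S - {C, half_turn ` C} \<union> {D, half_turn ` D}"
  have C: "C \<in> S" using q edges_chord[of n S x y k l] r unfolding quad_at_def C_def by blast
  have "green n S C" using g green_iff_below[OF typeB_polyg[OF S(1) n] q] unfolding C_def by simp
  moreover note fl = typeB_flip[OF n S(1) q C_def D_def]
  ultimately have cov: "tamari_cover n S T"
    unfolding tamari_cover_def T_def using S(1) C by (intro conjI) (auto intro!: bexI[of _ C])
  have "(\<exists>F\<in>S. bw n E F) \<or> bw n E w \<or> bw n E (half_turn ` w)" if E: "bw n E D" for E
  proof -
    obtain u v k' l' where uv: "E = {vx n u, vx n v}" "{vx n k, vx n l} = {vx n k', vx n l'}" "below_chord (n + 1) u v k' l'"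
      "1 \<le> u" "v \<le> 2 * (n + 1)" using E unfolding bw_def D_def by blast
    have "{k, l} = {k', l'}" using uv(2) by (simp only: pair_vx_eq_iff)
    moreover have "k' < l'" using uv(3) unfolding below_chord_def by simp
    ultimately have "k' = min k l" "l' = max k l" by (auto simp: doubleton_eq_iff)
    then have "(\<exists>p q. edges n S p q \<and> below_chord (n + 1) u v p q) \<or> G u v" using gen uv(3) by simp
    then consider p q where "edges n S p q" "below_chord (n + 1) u v p q" | "below_chord (n + 1) u v a b"
      | a' b' where "{a', b'} = {antipode (n + 1) a, antipode (n + 1) b}" "below_chord (n + 1) u v a' b'"
      unfolding G_def by blast
    then show ?thesis
    proof cases
      case 1
      have "{vx n p, vx n q} \<in> S" by (rule below_edge_mem[OF 1 uv(4,5)])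
      moreover have "bw n E {vx n p, vx n q}"
        unfolding uv(1) using bwI[OF 1(2) uv(4,5)] 1(1) unfolding edges_def by blast
      ultimately show ?thesis by blast
    next
      case 2
      then show ?thesis unfolding uv(1) h(6) using bwI[OF 2 uv(4,5) h(3,4)] by blast
    next
      case 3
      have "{vx n a', vx n b'} = {vx n (antipode (n + 1) a), vx n (antipode (n + 1) b)}"
        using 3(1) by (simp only: pair_vx_eq_iff)
      also have "\<dots> = half_turn ` w" unfolding h(6) using half_turn_vx h(3,4) lt(2) by simp
      finally have hw: "half_turn ` w = {vx n a', vx n b'}" by simp
      have "1 \<le> antipode (n + 1) a \<and> antipode (n + 1) a \<le> 2 * (n + 1)"
        "1 \<le> antipode (n + 1) b \<and> antipode (n + 1) b \<le> 2 * (n + 1)"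
        using antipode_range[of a "n + 1"] antipode_range[of b "n + 1"] h(3,4) lt(2) by simp_all
      then have "1 \<le> a'" "b' \<le> 2 * (n + 1)" using 3(1) by (auto simp: doubleton_eq_iff)
      then show ?thesis unfolding hw uv(1) using bwI[OF 3(2) uv(4,5)] by blast
    qed
  qed
  moreover have "bw n C D" unfolding C_def D_def using bw_new_diagonal[OF q] g by simp
  ultimately show ?thesis using cov C T_def by (intro exI[of _ T] exI[of _ C] exI[of _ D] conjI) simp_all
qed

lemma flip_poset_typeB:
  assumes n: "n \<ge> 1"
  shows "flip_poset (typeB_triangulations n) (bw n) ((`) half_turn) (tamari_cover n)"
proof
  have "typeB_triangulations n \<subseteq> Pow (Pow (vertices n))"
    using typeB_chords unfolding chords_def by blast
  then show "finite (typeB_triangulations n)"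
    using finite_subset finite_vertices by (metis finite_Pow_iff)
  show "\<exists>c\<in>S. \<exists>d\<in>T. bw n c d \<or> bw n d c"
    if "S \<in> typeB_triangulations n" "T \<in> typeB_triangulations n" "S \<noteq> T" for S T
  proof -
    consider C where "C \<in> S" "C \<notin> T" | C where "C \<in> T" "C \<notin> S" using \<open>S \<noteq> T\<close> by blast
    then show ?thesis
    proof cases
      case 1
      then show ?thesis using crossing_chord_exists[OF that(2) n, of C] typeB_chords[OF that(1)] by blast
    next
      case 2
      then show ?thesis using crossing_chord_exists[OF that(1) n, of C] typeB_chords[OF that(2)] by blast
    qed
  qed
  show "S \<in> typeB_triangulations n \<and> T \<in> typeB_triangulations n \<and>
      (\<exists>c c'. c \<in> S \<and> T = S - {c, half_turn ` c} \<union> {c', half_turn ` c'} \<and> bw n c c' \<and>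
        (\<forall>d. bw n d c \<longrightarrow> (\<exists>t\<in>T. bw n d t)))" if c: "tamari_cover n S T" for S T
  proof -
    have "S \<in> typeB_triangulations n" "T \<in> typeB_triangulations n" using c unfolding tamari_cover_def by auto
    then show ?thesis using tamari_coverD[OF n c] by blast
  qed
  show "T = T'" if c: "tamari_cover n S T" "tamari_cover n S T'" "C \<in> S - T" "C \<in> S - T'" for S T T' C
  proof -
    \<comment> \<open>A chord lost in a cover is the flipped chord or its partner, and both
      determine the same flip.\<close>
    have *: "T = S - {C, half_turn ` C} \<union> {other_diagonal n S C, other_diagonal n S (half_turn ` C)}"
      if cov: "tamari_cover n S T" and CT: "C \<in> S - T" for T
    proof -
      obtain E where E: "T = (S - {E, half_turn ` E}) \<union> {other_diagonal n S E, other_diagonal n S (half_turn ` E)}"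
        using cov unfolding tamari_cover_def by blast
      then consider "C = E" | "C = half_turn ` E" using CT by blast
      then show ?thesis
      proof cases
        case 1
        then show ?thesis using E by simp
      next
        case 2
        then have "half_turn ` C = E" by simp
        then show ?thesis using E 2 by (metis insert_commute)
      qed
    qed
    show ?thesis using *[OF c(1,3)] *[OF c(2,4)] by simp
  qed
qed (use typeB_noncrossing n bw_asym bw_half_turn typeB_half_turn tamari_cover_exists in auto)


theorem theorem3:
  fixes n :: nat and Y Z :: "vertex set set"
  assumes "n \<ge> 1"
    and "Y \<in> typeB_triangulations n" and "Z \<in> typeB_triangulations n"
    and "tamari_less n Y Z"
  shows "contractible_space (geometric_realization (interval_complex n Y Z)) \<or>
         (\<exists>d\<ge>-1. geometric_realization (interval_complex n Y Z)
            homotopy_equivalent_space sphere_space d)"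
proof -
  interpret flip_poset "typeB_triangulations n" "bw n" "(`) half_turn" "tamari_cover n"
    by (rule flip_poset_typeB[OF assms(1)])
  have le_iff: "tamari_le n S T \<longleftrightarrow> S \<in> typeB_triangulations n \<and> T \<in> typeB_triangulations n \<and> R S T" for S T
    unfolding tamari_le_def using R_iff by blast
  define P where "P = {X \<in> typeB_triangulations n. R Y X \<and> R X Z \<and> X \<noteq> Y \<and> X \<noteq> Z}"
  have P: "tamari_open_interval n Y Z = P"
    unfolding tamari_open_interval_def tamari_less_def le_iff P_def using assms(2,3) by blast
  have PT: "X \<in> typeB_triangulations n" if "X \<in> P" for X using that unfolding P_def by blast
  interpret O: finite_order P R
    by (rule finite_order_R) (use PT in blast)
  have less: "tamari_less n S T \<longleftrightarrow> R S T \<and> S \<noteq> T" if "S \<in> P" "T \<in> P" for S T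
    unfolding tamari_less_def le_iff using PT[OF that(1)] PT[OF that(2)] by simp
  have "totalp_on c (tamari_less n) \<longleftrightarrow> totalp_on c (\<lambda>x y. R x y \<and> x \<noteq> y)" if "c \<subseteq> P" for c
    unfolding totalp_on_def using less that by (intro ball_cong refl) (simp add: subset_iff)
  then have "interval_complex n Y Z = order_complex P (\<lambda>x y. R x y \<and> x \<noteq> y)"
    unfolding interval_complex_def P order_complex_def by (intro Collect_cong conj_cong refl)
  then have eq: "geometric_realization (interval_complex n Y Z) = O.realization"
    unfolding O.realization_def by simp
  have "R Y Z" "Y \<noteq> Z" using assms(4) unfolding tamari_less_def le_iff by auto
  then consider "contractible_space O.realization" | "O.realization = trivial_topology"
    | p where "O.realization homotopy_equivalent_space nsphere p"
    using interval_homotopy_type[OF assms(2,3)] unfolding P_def by blast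
  then show ?thesis
  proof cases
    case 1
    then show ?thesis unfolding eq by blast
  next
    case 2
    then have "O.realization homotopy_equivalent_space sphere_space (-1)"
      by (intro homeomorphic_imp_homotopy_equivalent_space) (simp add: sphere_space_def homeomorphic_empty_space_eq)
    then show ?thesis unfolding eq by force
  next
    case 3
    then have "O.realization homotopy_equivalent_space sphere_space (int p)"
      by (simp add: sphere_space_def)
    then show ?thesis unfolding eq by (intro disjI2 exI[of _ "int p"]) auto
  qed
qed

end
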